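(* Let $1<p\le\infty$, and put $X_p=\ell^2$ if $1<p<\infty$ and $X_p=c_0$ if $p=\infty$. Let $f\in H^p(\mathbb T^\infty)$, and let $F$ denote its canonical holomorphic extension to $\mathbb D^\infty\cap X_p$. Suppose that $r^{(s)}=(r^{(s)}_n)_{n\ge1}\in\mathbb D^\infty\cap X_p$, $s\ge1$, is a sequence of vectors with real entries (fixed, i.e. independent of the point of $\mathbb T^\infty$) such that for every $n\ge1$ \[ 0\le r_n^{(1)}\le r_n^{(2)}\le\cdots\quad\text{and}\quad r_n^{(s)}\uparrow1\ \text{ as } s\to\infty. \] Then $F\bigl(r^{(s)}e^{i\theta}\bigr)\to f(e^{i\theta})$ as $s\to\infty$ for $m_\infty$-almost every $e^{i\theta}\in\mathbb T^\infty$.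
   Context: $\mathbb T$ is the unit circle with normalized Haar measure $m$, $\mathbb D$ is the open unit disc, $\mathbb T^\infty=\prod_{n\ge1}\mathbb T$, $\mathbb D^\infty=\prod_{n\ge1}\mathbb D$, and $m_\infty=\bigotimes_{n\ge1}m$. $c_0$ is the Banach space (sup norm) of complex sequences $(z_n)_{n\ge1}$ with $z_n\to0$, and $\ell^2$ is the space of complex sequences with $\sum_n|z_n|^2<\infty$. For $\theta=(\theta_n)$ and $r=(r_n)\in[0,1)^\infty$, write $e^{i\theta}=(e^{i\theta_n})_{n\ge1}\in\mathbb T^\infty$ and $re^{i\theta}=(r_ne^{i\theta_n})_{n\ge1}$. For $1\le p\le\infty$, $H^p(\mathbb T^\infty)$ is the subspace of those $g\in L^p(\mathbb T^\infty,m_\infty)$ whose Fourier coefficients $\hat g(\gamma)=\int_{\mathbb T^\infty} g(w)\overline{w^\gamma}\,dm_\infty(w)$, indexed by finitely supported $\gamma\in\mathbb Z^{\infty}$ with $w^\gamma=\prod_n w_n^{\gamma_n}$, vanish unless all $\gamma_n\ge0$. The canonical holomorphic extension of $g\in H^p(\mathbb T^\infty)$ is the unique holomorphic function on $\ell^2\cap\mathbb D^\infty$ (an open subset of $\ell^2$) if $1\le p<\infty$, respectively the unique bounded holomorphic function on $c_0\cap\mathbb D^\infty$ (the open unit ball of $c_0$) if $p=\infty$, whose monomial coefficients (computed on finitely supported points) are the Fourier coefficients $\hat g(\alpha)$, $\alpha\ge0$ finitely supported. Existence and uniqueness of this extension are standard. *)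

theory Defs
  imports "HOL-Probability.Probability" "HOL-Library.Poly_Mapping"
begin

text \<open>Sequences are indexed by \<^typ>\<open>nat\<close> starting at 0 instead of 1.\<close>

definition circle_measure :: "complex measure" where
  "circle_measure =
     distr (uniform_measure lborel {0..<2 * pi}) (restrict_space borel (sphere 0 1)) cis"

definition torus_measure :: "(nat \<Rightarrow> complex) measure" where
  "torus_measure = PiM UNIV (\<lambda>_. circle_measure)"

definition polydisc :: "(nat \<Rightarrow> complex) set" where
  "polydisc = {z. \<forall>n. z n \<in> ball 0 1}"

definition monomial :: "(nat \<Rightarrow>\<^sub>0 int) \<Rightarrow> (nat \<Rightarrow> complex) \<Rightarrow> complex" where
  "monomial \<gamma> z = (\<Prod>n\<in>Poly_Mapping.keys \<gamma>. z n powi Poly_Mapping.lookup \<gamma> n)"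

definition fourier_coeff :: "((nat \<Rightarrow> complex) \<Rightarrow> complex) \<Rightarrow> (nat \<Rightarrow>\<^sub>0 int) \<Rightarrow> complex" where
  "fourier_coeff g \<gamma> = (LINT w|torus_measure. g w * cnj (monomial \<gamma> w))"

text \<open>Elements of \<open>L\<^sup>p\<close> and \<open>H\<^sup>p\<close> are given by representatives; there is no quotient by
  almost everywhere equality.\<close>

definition Lp :: "'a measure \<Rightarrow> ennreal \<Rightarrow> ('a \<Rightarrow> complex) set" where
  "Lp M p = {g \<in> borel_measurable M.
     if p = \<infinity> then \<exists>C. AE x in M. cmod (g x) \<le> C
     else integrable M (\<lambda>x. cmod (g x) powr enn2real p)}"

definition Hardy :: "ennreal \<Rightarrow> ((nat \<Rightarrow> complex) \<Rightarrow> complex) set" where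
  "Hardy p = {g \<in> Lp torus_measure p.
     \<forall>\<gamma>. \<not> (\<forall>n. 0 \<le> Poly_Mapping.lookup \<gamma> n) \<longrightarrow> fourier_coeff g \<gamma> = 0}"

text \<open>\<open>ell2\<close> and \<open>c0\<close> are carrier sets with explicit norms rather than types, since the
  space used depends on the exponent \<open>p\<close>.\<close>

definition ell2 :: "(nat \<Rightarrow> complex) set" where
  "ell2 = {z. summable (\<lambda>n. (cmod (z n))\<^sup>2)}"

definition ell2_norm :: "(nat \<Rightarrow> complex) \<Rightarrow> real" where
  "ell2_norm z = sqrt (suminf (\<lambda>n. (cmod (z n))\<^sup>2))"

definition c0 :: "(nat \<Rightarrow> complex) set" where
  "c0 = {z. z \<longlonglongrightarrow> 0}"

definition sup_norm :: "(nat \<Rightarrow> complex) \<Rightarrow> real" where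
  "sup_norm z = (SUP n. cmod (z n))"

definition seq_space :: "ennreal \<Rightarrow> (nat \<Rightarrow> complex) set" where
  "seq_space p = (if p = \<infinity> then c0 else ell2)"

definition seq_norm :: "ennreal \<Rightarrow> (nat \<Rightarrow> complex) \<Rightarrow> real" where
  "seq_norm p = (if p = \<infinity> then sup_norm else ell2_norm)"

definition bounded_clinear_on ::
  "(nat \<Rightarrow> complex) set \<Rightarrow> ((nat \<Rightarrow> complex) \<Rightarrow> real) \<Rightarrow> ((nat \<Rightarrow> complex) \<Rightarrow> complex) \<Rightarrow> bool" where
  "bounded_clinear_on X N A \<longleftrightarrow>
     (\<forall>x\<in>X. \<forall>y\<in>X. A (\<lambda>n. x n + y n) = A x + A y) \<and>
     (\<forall>c. \<forall>x\<in>X. A (\<lambda>n. c * x n) = c * A x) \<and>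
     (\<exists>K. \<forall>x\<in>X. cmod (A x) \<le> K * N x)"

text \<open>Complex Frechet differentiability at every point of \<open>U\<close>, for \<open>U\<close> an open subset of the
  complex normed space \<open>X\<close> with norm \<open>N\<close>.\<close>

definition frechet_holomorphic_on ::
  "(nat \<Rightarrow> complex) set \<Rightarrow> ((nat \<Rightarrow> complex) \<Rightarrow> real) \<Rightarrow> (nat \<Rightarrow> complex) set
    \<Rightarrow> ((nat \<Rightarrow> complex) \<Rightarrow> complex) \<Rightarrow> bool" where
  "frechet_holomorphic_on X N U F \<longleftrightarrow>
     (\<forall>z\<in>U. \<exists>A. bounded_clinear_on X N A \<and>
        (\<forall>e>0. \<exists>d>0. \<forall>h\<in>X. N h < d \<and> (\<lambda>n. z n + h n) \<in> U \<longrightarrow>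
            cmod (F (\<lambda>n. z n + h n) - F z - A h) \<le> e * N h))"

text \<open>\<open>c\<close> is the family of monomial coefficients of \<open>F\<close>. At a finitely supported \<open>z\<close> only the
  monomials in the finitely many variables with \<open>z n \<noteq> 0\<close> contribute, so the sum below is the
  (absolutely convergent) power series on a finite-dimensional polydisc.\<close>

definition has_monomial_coeffs ::
  "((nat \<Rightarrow> complex) \<Rightarrow> complex) \<Rightarrow> ((nat \<Rightarrow>\<^sub>0 int) \<Rightarrow> complex) \<Rightarrow> bool" where
  "has_monomial_coeffs F c \<longleftrightarrow>
     (\<forall>z\<in>polydisc. finite {n. z n \<noteq> 0} \<longrightarrow>
        ((\<lambda>\<alpha>. c \<alpha> * monomial \<alpha> z) has_sum F z) {\<alpha>. \<forall>n. 0 \<le> Poly_Mapping.lookup \<alpha> n})"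

text \<open>Only the values of \<open>F\<close> on \<open>polydisc \<inter> seq_space p\<close> matter.\<close>

definition canonical_extension ::
  "ennreal \<Rightarrow> ((nat \<Rightarrow> complex) \<Rightarrow> complex) \<Rightarrow> ((nat \<Rightarrow> complex) \<Rightarrow> complex) \<Rightarrow> bool" where
  "canonical_extension p g F \<longleftrightarrow>
     frechet_holomorphic_on (seq_space p) (seq_norm p) (polydisc \<inter> seq_space p) F \<and>
     (p = \<infinity> \<longrightarrow> bounded (F ` (polydisc \<inter> seq_space p))) \<and>
     has_monomial_coeffs F (fourier_coeff g)"

end

theory Submission
  imports Defs
begin

text \<open>A Rota-type argument. By monotonicity of the radii, the products of Poisson kernels satisfy
  \<open>P\<^bsub>\<rho>(s)\<^esub> = Q\<^sub>s P\<^bsub>\<rho>(s+1)\<^esub>\<close> with Markov operators \<open>Q\<^sub>s\<close>. Taking \<open>\<rho> = \<surd>r\<close> gives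
  \<open>P\<^bsub>r(s)\<^esub> = P\<^bsub>\<rho>(s)\<^esub> P\<^bsub>\<rho>(s)\<^esub>\<close>, and the maximal function of the radial means is
  controlled as in the proof of Doob's inequality, with a constant that depends neither on the number
  of radii nor on the number of variables. Letting the number of variables tend to infinity (Fatou,
  and continuity of the holomorphic extension) this bounds
  \<open>sup\<^sub>s (\<bar>F(r(s) w) - G(w)\<bar> - \<eta>\<^sub>s)\<close> in mean in terms of the \<open>L\<^sup>q\<close> distance of \<open>f\<close> to \<open>G\<close>, for
  \<open>G\<close> a Lipschitz function of finitely many variables, where \<open>\<eta>\<^sub>s \<longlonglongrightarrow> 0\<close> bounds
  \<open>\<bar>P\<^bsub>r(s)\<^esub>G - G\<bar>\<close> uniformly. Such \<open>G\<close> are dense in \<open>L\<^sup>q\<close>.\<close>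

section \<open>A maximal inequality for chains of symmetric Markov kernels\<close>

text \<open>Iterating one-variable maximal operators costs a constant per variable and is useless as
  their number grows; a Markov chain moves all variables at once. Let \<open>t\<close> be the
  kernels with the original radii, \<open>s\<close> those with the square roots, and let Y be the
  end point of a chain in which Y_i leads to Y by \<open>s i\<close>. Choose weights a_i \<ge> 0 of
  sum 1 that pick a maximal index. By t = s s and symmetry the integral of the maximum becomes
  E[g(Y) sum_i b_i(Y_i)] with b_i(Y_i) = E[a_i(Y) | Y_i]; the square roots serve to have g and a_i
  both conditioned along one chain. As the a_i sum to 1, E exp(1/2 sum_i b_i(Y_i)) \<le> 2, and
  Young's inequality g y \<le> \<Psi> + exp y gives 2 \<integral>\<Psi> + 4. The choice \<Psi> = g^q
  / (q - 1) is where p > 1 enters. This bound is not homogeneous: applied to \<kappa> g and divided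
  by \<kappa>, its constant becomes 4 / \<kappa>, so a large \<kappa>, and after it a G close enough
  to f, make it small. F enters through its continuity in the norm of the sequence space and its
  expansion at finitely supported points.\<close>

definition kernel_op :: "'a measure \<Rightarrow> ('a \<Rightarrow> 'a \<Rightarrow> real) \<Rightarrow> ('a \<Rightarrow> real) \<Rightarrow> 'a \<Rightarrow> real" where
  "kernel_op M k g y = (LINT v|M. k y v * g v)"

text \<open>Kernels are densities with respect to \<open>M\<close>. Boundedness makes
  \<open>kernel_op\<close> of an integrable function converge, and stay bounded, at every point of
  the space, so the later inequalities hold pointwise without exceptional null sets. Symmetry makes
  the operators self-adjoint and \<open>M\<close> invariant.\<close>

definition sym_markov :: "'a measure \<Rightarrow> ('a \<Rightarrow> 'a \<Rightarrow> real) \<Rightarrow> bool" where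
  "sym_markov M k \<longleftrightarrow>
     case_prod k \<in> borel_measurable (M \<Otimes>\<^sub>M M) \<and>
     (\<forall>x\<in>space M. \<forall>y\<in>space M. 0 \<le> k x y \<and> k x y = k y x) \<and>
     (\<exists>B. \<forall>x\<in>space M. \<forall>y\<in>space M. k x y \<le> B) \<and>
     (\<forall>x\<in>space M. (LINT v|M. k x v) = 1)"

lemma sym_markov_measurable [measurable_dest]:
  "sym_markov M k \<Longrightarrow> case_prod k \<in> borel_measurable (M \<Otimes>\<^sub>M M)"
  by (auto simp: sym_markov_def)

context prob_space
begin

lemma sym_markov_bound:
  assumes "sym_markov M k"
  obtains B where "B \<ge> 0" "\<And>x y. x \<in> space M \<Longrightarrow> y \<in> space M \<Longrightarrow> \<bar>k x y\<bar> \<le> B"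
proof -
  obtain B where B: "\<forall>x\<in>space M. \<forall>y\<in>space M. k x y \<le> B"
    using assms by (auto simp: sym_markov_def)
  have "\<forall>x\<in>space M. \<forall>y\<in>space M. 0 \<le> k x y"
    using assms by (auto simp: sym_markov_def)
  with B show ?thesis by (intro that[of "max 0 B"]) (auto intro: max.coboundedI2)
qed

lemma kernel_slice_measurable:
  assumes "sym_markov M k" "x \<in> space M"
  shows "k x \<in> borel_measurable M"
  using measurable_compose[OF measurable_Pair1'[OF assms(2)] sym_markov_measurable[OF assms(1)]] by simp

lemma kernel_integrable:
  assumes k: "sym_markov M k" and x: "x \<in> space M" and g: "integrable M g"
  shows "integrable M (\<lambda>v. k x v * g v)"
proof -
  obtain B where B: "B \<ge> 0" "\<And>x y. x \<in> space M \<Longrightarrow> y \<in> space M \<Longrightarrow> \<bar>k x y\<bar> \<le> B"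
    using sym_markov_bound[OF k] by blast
  note [measurable] = kernel_slice_measurable[OF k x] borel_measurable_integrable[OF g]
  show ?thesis
  proof (rule Bochner_Integration.integrable_bound)
    show "integrable M (\<lambda>v. B * \<bar>g v\<bar>)" using g by simp
    show "AE v in M. norm (k x v * g v) \<le> norm (B * \<bar>g v\<bar>)"
      using B x by (intro AE_I2) (auto simp: abs_mult intro!: mult_right_mono)
  qed simp
qed

lemma kernel_op_measurable [measurable]:
  assumes [measurable]: "sym_markov M k" "g \<in> borel_measurable M"
  shows "kernel_op M k g \<in> borel_measurable M"
proof -
  have [measurable]: "case_prod k \<in> borel_measurable (M \<Otimes>\<^sub>M M)" by simp
  have "(\<lambda>y. LINT v|M. case_prod k (y, v) * g v) \<in> borel_measurable M" by measurable
  then show ?thesis by (simp add: kernel_op_def[abs_def])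
qed

lemma kernel_op_bounded:
  assumes k: "sym_markov M k" and g: "integrable M g"
  obtains C where "\<And>y. y \<in> space M \<Longrightarrow> \<bar>kernel_op M k g y\<bar> \<le> C"
proof -
  obtain B where B: "B \<ge> 0" "\<And>x y. x \<in> space M \<Longrightarrow> y \<in> space M \<Longrightarrow> \<bar>k x y\<bar> \<le> B"
    using sym_markov_bound[OF k] by blast
  have "\<bar>kernel_op M k g y\<bar> \<le> (LINT v|M. B * \<bar>g v\<bar>)" if y: "y \<in> space M" for y
  proof -
    have "\<bar>kernel_op M k g y\<bar> \<le> (LINT v|M. \<bar>k y v * g v\<bar>)"
      unfolding kernel_op_def by (rule integral_abs_bound)
    also have "\<dots> \<le> (LINT v|M. B * \<bar>g v\<bar>)"
      using integrable_abs[OF kernel_integrable[OF k y g]] g B y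
      by (intro integral_mono) (auto simp: abs_mult intro!: mult_right_mono)
    finally show ?thesis .
  qed
  then show ?thesis using that by blast
qed

lemma integrable_of_bounded:
  fixes g :: "'a \<Rightarrow> real"
  assumes "g \<in> borel_measurable M" "\<And>x. x \<in> space M \<Longrightarrow> \<bar>g x\<bar> \<le> C"
  shows "integrable M g"
  by (rule integrable_const_bound[of _ C]) (use assms in \<open>auto intro!: AE_I2\<close>)

lemma kernel_op_integrable:
  assumes k: "sym_markov M k" and g: "integrable M g"
  shows "integrable M (kernel_op M k g)"
  by (rule kernel_op_bounded[OF k g], rule integrable_of_bounded)
     (use k borel_measurable_integrable[OF g] in \<open>auto intro!: kernel_op_measurable\<close>)

lemma bounded_mult_integrable:
  fixes g h :: "'a \<Rightarrow> real"
  assumes "g \<in> borel_measurable M" "\<And>x. x \<in> space M \<Longrightarrow> \<bar>g x\<bar> \<le> C" "integrable M h"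
  shows "integrable M (\<lambda>x. g x * h x)"
proof (rule Bochner_Integration.integrable_bound)
  show "integrable M (\<lambda>v. C * \<bar>h v\<bar>)" using assms by simp
  show "AE v in M. norm (g v * h v) \<le> norm (C * \<bar>h v\<bar>)"
  proof (intro AE_I2)
    fix v assume "v \<in> space M"
    then have "\<bar>g v\<bar> \<le> \<bar>C\<bar>" using assms(2)[of v] by linarith
    then show "norm (g v * h v) \<le> norm (C * \<bar>h v\<bar>)"
      by (auto simp: abs_mult intro!: mult_right_mono)
  qed
  show "(\<lambda>x. g x * h x) \<in> borel_measurable M"
    using assms(1) borel_measurable_integrable[OF assms(3)] by measurable
qed

lemma kernel_op_add:
  assumes "sym_markov M k" "y \<in> space M" "integrable M g" "integrable M h"
  shows "kernel_op M k (\<lambda>v. g v + h v) y = kernel_op M k g y + kernel_op M k h y"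
  unfolding kernel_op_def
  using kernel_integrable[OF assms(1,2,3)] kernel_integrable[OF assms(1,2,4)]
  by (simp add: distrib_left)

lemma kernel_op_cmult: "kernel_op M k (\<lambda>v. c * g v) y = c * kernel_op M k g y"
  by (simp add: kernel_op_def mult.left_commute)

lemma kernel_op_const:
  assumes "sym_markov M k" "y \<in> space M"
  shows "kernel_op M k (\<lambda>v. c) y = c"
  using assms by (simp add: kernel_op_def sym_markov_def)

lemma kernel_op_mono:
  assumes k: "sym_markov M k" and y: "y \<in> space M" and "integrable M g" "integrable M h"
    and "\<And>v. v \<in> space M \<Longrightarrow> g v \<le> h v"
  shows "kernel_op M k g y \<le> kernel_op M k h y"
  unfolding kernel_op_def
  using kernel_integrable[OF k y assms(3)] kernel_integrable[OF k y assms(4)] assms(5) k y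
  by (intro integral_mono) (auto simp: sym_markov_def intro!: mult_left_mono)

lemma kernel_op_nonneg:
  assumes "sym_markov M k" "y \<in> space M" "\<And>v. v \<in> space M \<Longrightarrow> 0 \<le> g v"
  shows "0 \<le> kernel_op M k g y"
  unfolding kernel_op_def using assms by (auto simp: sym_markov_def intro!: integral_nonneg_AE AE_I2)

lemma pair_sigma_finite_self: "pair_sigma_finite M M"
  by (simp add: pair_sigma_finite_def sigma_finite_measure_axioms)

text \<open>Fubini together with the symmetry of \<open>k\<close>. With \<open>a\<close> and
  \<open>k\<close> bounded, the double integrand is dominated by a multiple of
  \<open>\<bar>g\<bar>\<close> in the second variable, so \<open>g\<close> may be merely
  integrable.\<close>

lemma kernel_op_adjoint:
  assumes k: "sym_markov M k" and g: "integrable M g" and [measurable]: "a \<in> borel_measurable M"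
    and a: "\<And>x. x \<in> space M \<Longrightarrow> \<bar>a x\<bar> \<le> C"
  shows "(LINT y|M. a y * kernel_op M k g y) = (LINT v|M. kernel_op M k a v * g v)"
proof -
  interpret P: pair_sigma_finite M M by (rule pair_sigma_finite_self)
  obtain B where B: "B \<ge> 0" "\<And>x y. x \<in> space M \<Longrightarrow> y \<in> space M \<Longrightarrow> \<bar>k x y\<bar> \<le> B"
    using sym_markov_bound[OF k] by blast
  note [measurable] = sym_markov_measurable[OF k] borel_measurable_integrable[OF g]
  have int_g: "integrable (M \<Otimes>\<^sub>M M) (\<lambda>z. g (snd z))"
  proof -
    have "integrable (distr (M \<Otimes>\<^sub>M M) M fst) g"
      using g by (simp add: distr_pair_fst)
    then have "integrable (M \<Otimes>\<^sub>M M) (\<lambda>z. g (fst z))"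
      by (rule integrable_distr[rotated]) simp
    from P.integrable_product_swap[OF this] show ?thesis by (simp add: case_prod_beta')
  qed
  have int: "integrable (M \<Otimes>\<^sub>M M) (\<lambda>(y, v). a y * (k y v * g v))"
  proof (rule Bochner_Integration.integrable_bound)
    show "integrable (M \<Otimes>\<^sub>M M) (\<lambda>z. (\<bar>C\<bar> * B) * \<bar>g (snd z)\<bar>)" using int_g by simp
    have "(\<lambda>z. a (fst z) * (case_prod k z * g (snd z))) \<in> borel_measurable (M \<Otimes>\<^sub>M M)" by measurable
    then show "(\<lambda>(y, v). a y * (k y v * g v)) \<in> borel_measurable (M \<Otimes>\<^sub>M M)"
      by (simp add: case_prod_beta')
    have "\<bar>a y\<bar> * \<bar>k y v\<bar> \<le> \<bar>C\<bar> * B" if "y \<in> space M" "v \<in> space M" for y v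
      using a[OF that(1)] B(2)[OF that] B(1) by (intro mult_mono) auto
    then show "AE z in M \<Otimes>\<^sub>M M. norm (case z of (y, v) \<Rightarrow> a y * (k y v * g v)) \<le> norm ((\<bar>C\<bar> * B) * \<bar>g (snd z)\<bar>)"
      using B by (intro AE_I2)
        (auto simp: space_pair_measure abs_mult mult.assoc[symmetric] intro!: mult_right_mono)
  qed
  have "(LINT y|M. a y * kernel_op M k g y) = (LINT y|M. (LINT v|M. a y * (k y v * g v)))"
    by (simp add: kernel_op_def)
  also have "\<dots> = (LINT v|M. (LINT y|M. a y * (k y v * g v)))"
    using P.Fubini_integral[OF int] by simp
  also have "\<dots> = (LINT v|M. kernel_op M k a v * g v)"
  proof (rule Bochner_Integration.integral_cong[OF refl])
    fix v assume v: "v \<in> space M"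
    have "(LINT y|M. a y * (k y v * g v)) = (LINT y|M. (k v y * a y) * g v)"
      using k v by (intro Bochner_Integration.integral_cong) (auto simp: sym_markov_def)
    then show "(LINT y|M. a y * (k y v * g v)) = kernel_op M k a v * g v"
      by (simp add: kernel_op_def)
  qed
  finally show ?thesis .
qed

text \<open>Self-adjointness tested against the constant 1, which every Markov kernel fixes: the
  measure is stationary for the chain.\<close>

lemma kernel_op_integral:
  assumes k: "sym_markov M k" and g: "integrable M g"
  shows "(LINT y|M. kernel_op M k g y) = (LINT v|M. g v)"
proof -
  have "(LINT y|M. kernel_op M k g y) = (LINT y|M. 1 * kernel_op M k g y)" by simp
  also have "\<dots> = (LINT v|M. kernel_op M k (\<lambda>_. 1) v * g v)"
    by (rule kernel_op_adjoint[OF k g, of _ 1]) auto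
  also have "\<dots> = (LINT v|M. g v)"
    by (intro Bochner_Integration.integral_cong) (auto simp: kernel_op_const[OF k])
  finally show ?thesis .
qed

text \<open>Self-adjointness of \<open>l\<close> tested against the bounded slice
  \<open>k x\<close>, which replaces a separate application of Fubini. The composition law is asked
  for at the single point \<open>x\<close>.\<close>

lemma kernel_op_comp:
  assumes k: "sym_markov M k" and l: "sym_markov M l" and g: "integrable M g"
    and x: "x \<in> space M"
    and comp: "\<And>u. u \<in> space M \<Longrightarrow> (LINT v|M. k x v * l v u) = m x u"
  shows "kernel_op M k (kernel_op M l g) x = kernel_op M m g x"
proof -
  obtain B where B: "B \<ge> 0" "\<And>x y. x \<in> space M \<Longrightarrow> y \<in> space M \<Longrightarrow> \<bar>k x y\<bar> \<le> B"
    using sym_markov_bound[OF k] by blast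
  have "kernel_op M k (kernel_op M l g) x = (LINT y|M. k x y * kernel_op M l g y)"
    by (simp add: kernel_op_def)
  also have "\<dots> = (LINT v|M. kernel_op M l (k x) v * g v)"
    using kernel_slice_measurable[OF k x] B x by (intro kernel_op_adjoint[OF l g, of _ B]) auto
  also have "\<dots> = (LINT v|M. m x v * g v)"
  proof (rule Bochner_Integration.integral_cong[OF refl])
    fix u assume u: "u \<in> space M"
    have "kernel_op M l (k x) u = (LINT v|M. k x v * l v u)"
      unfolding kernel_op_def using l u
      by (intro Bochner_Integration.integral_cong) (auto simp: sym_markov_def)
    then show "kernel_op M l (k x) u * g u = m x u * g u" using comp[OF u] by simp
  qed
  finally show ?thesis by (simp add: kernel_op_def)
qed

end

text \<open>One step of the exponential moment estimate: \<open>y\<close> is the conditional mass of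
  the weights already treated, \<open>b\<close> that of the next one, and
  \<open>b + y \<le> 1\<close> reflects that the weights sum to at most 1. The rate 1/2 leaves the
  required room: exp(b/2) \<le> 1 / (1 - b/2), while (1 - b/2)(1 + b + y) exceeds 1 + y by b/2 (1 -
  b - y).\<close>

lemma exp_half_times_le:
  fixes b y :: real
  assumes "0 \<le> b" "0 \<le> y" "b + y \<le> 1"
  shows "exp (b / 2) * (1 + y) \<le> 1 + b + y"
proof -
  have "1 + - (b/2) \<le> exp (- (b/2))" by (rule exp_ge_add_one_self)
  then have "exp (b/2) * (1 - b/2) \<le> 1"
    by (metis exp_minus_inverse add_uminus_conv_diff exp_ge_zero mult_left_mono)
  moreover have "1 + y \<le> (1 - b/2) * (1 + b + y)"
  proof -
    have "0 \<le> b / 2 * (1 - b - y)" using assms by simp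
    then show ?thesis by (simp add: algebra_simps)
  qed
  ultimately have "exp (b/2) * (1 + y) \<le> exp (b/2) * (1 - b/2) * (1 + b + y)"
    by (simp add: mult_left_mono mult.assoc)
  also have "\<dots> \<le> 1 * (1 + b + y)"
    using \<open>exp (b/2) * (1 - b/2) \<le> 1\<close> assms by (intro mult_right_mono) auto
  finally show ?thesis by simp
qed

text \<open>Doob's inequality in dual form. The left side is E[g(Y) sum_i b_i(Y_i)], where b_i(Y_i)
  = E[a_i(Y) | Y_i]. Half of this sum has exponential moment at most 2, so Young's inequality with
  the half sum in place of \<open>y\<close> bounds half of the left side by \<integral>\<Psi> + 2.
  The chain is never built as a process: its conditional expectations are iterated
  \<open>kernel_op\<close>s.\<close>

lemma (in prob_space) maximal_inequality_dual:
  fixes s q :: "nat \<Rightarrow> 'a \<Rightarrow> 'a \<Rightarrow> real" and g \<Psi> :: "'a \<Rightarrow> real"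
  assumes s: "\<And>i. i \<le> N \<Longrightarrow> sym_markov M (s i)"
    and q: "\<And>i. i < N \<Longrightarrow> sym_markov M (q i)"
    and comp: "\<And>i x u. i < N \<Longrightarrow> x \<in> space M \<Longrightarrow> u \<in> space M \<Longrightarrow>
                 (LINT v|M. q i x v * s i v u) = s (Suc i) x u"
    and g: "integrable M g" "\<And>v. v \<in> space M \<Longrightarrow> 0 \<le> g v"
    and \<Psi>: "integrable M \<Psi>" "\<And>v y. v \<in> space M \<Longrightarrow> g v * y \<le> \<Psi> v + exp y"
    and a: "\<And>i. i \<le> N \<Longrightarrow> a i \<in> borel_measurable M"
      "\<And>i v. i \<le> N \<Longrightarrow> v \<in> space M \<Longrightarrow> 0 \<le> a i v"
      "\<And>v. v \<in> space M \<Longrightarrow> (\<Sum>i\<le>N. a i v) \<le> 1"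
  shows "(\<Sum>i\<le>N. LINT x|M. kernel_op M (s i) (a i) x * kernel_op M (s i) g x)
           \<le> 2 * (LINT x|M. \<Psi> x) + 4"
proof -
  define b where "b i = kernel_op M (s i) (a i)" for i
  define u where "u i = kernel_op M (s i) g" for i
  define A where "A i v = (\<Sum>j\<le>i. a j v)" for i v
  txt \<open>\<open>2 D\<^sub>i\<close> is \<open>E[g(Y) \<Sum>\<^bsub>j \<le> i\<^esub> b\<^sub>j(Y\<^sub>j) | Y\<^sub>i]\<close> for the Markov chain \<open>Y\<^sub>i, \<dots>, Y\<^sub>0, Y\<close> with
    transitions \<open>q\<close> and final transition \<open>s 0\<close>. Adding \<open>b\<^sub>i / 2\<close> to \<open>c\<close> at each step
    propagates the bound below, which is why it is proved for all \<open>c\<close> at once.\<close>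
  define D where "D = rec_nat (\<lambda>y. b 0 y * u 0 y / 2)
    (\<lambda>i Di y. b (Suc i) y * u (Suc i) y / 2 + kernel_op M (q i) Di y)"
  have D_0: "D 0 y = b 0 y * u 0 y / 2" for y by (simp add: D_def)
  have D_Suc: "D (Suc i) y = b (Suc i) y * u (Suc i) y / 2 + kernel_op M (q i) (D i) y" for i y
    by (simp add: D_def)
  have A: "A i \<in> borel_measurable M" "\<And>v. v \<in> space M \<Longrightarrow> 0 \<le> A i v"
    "\<And>v. v \<in> space M \<Longrightarrow> A i v \<le> 1" if "i \<le> N" for i
  proof -
    show "A i \<in> borel_measurable M"
      unfolding A_def[abs_def] using a(1) that by (intro borel_measurable_sum) auto
    show "0 \<le> A i v" if "v \<in> space M" for v
      unfolding A_def using a(2) that \<open>i \<le> N\<close> by (intro sum_nonneg) auto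
    show "A i v \<le> 1" if "v \<in> space M" for v
    proof -
      have "A i v \<le> (\<Sum>i\<le>N. a i v)"
        unfolding A_def using a(2) that \<open>i \<le> N\<close> by (intro sum_mono2) auto
      then show ?thesis using a(3)[OF that] by simp
    qed
  qed
  have a_le: "a i v \<le> 1" if "i \<le> N" "v \<in> space M" for i v
  proof -
    have "a i v \<le> A i v"
      unfolding A_def using a(2) that by (intro member_le_sum) auto
    then show ?thesis using A(3)[OF that(1,2)] by simp
  qed
  have int_A: "integrable M (A i)" if "i \<le> N" for i
    using A[OF that] by (intro integrable_of_bounded[of _ 1]) auto
  have int_a: "integrable M (a i)" if "i \<le> N" for i
    using a that a_le by (intro integrable_of_bounded[of _ 1]) auto
  have int_b: "integrable M (b i)" and int_u: "integrable M (u i)" if "i \<le> N" for i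
    using kernel_op_integrable[OF s[OF that]] int_a[OF that] g by (auto simp: b_def u_def)
  have b01: "0 \<le> b i y" "b i y \<le> 1" if "i \<le> N" "y \<in> space M" for i y
    using kernel_op_nonneg[OF s[OF that(1)] that(2), of "a i"] a(2) that
      kernel_op_mono[OF s[OF that(1)] that(2) int_a[OF that(1)], of "\<lambda>_. 1"] a_le
    by (auto simp: b_def kernel_op_const[OF s[OF that(1)] that(2)])
  have int_bu: "integrable M (\<lambda>y. b i y * u i y)" if "i \<le> N" for i
    using borel_measurable_integrable[OF int_b[OF that]] int_u[OF that] b01[OF that]
    by (intro bounded_mult_integrable[of _ 1]) auto
  have "integrable M (D i) \<and> (LINT y|M. D i y) = (\<Sum>j\<le>i. LINT y|M. b j y * u j y) / 2 \<and>
      (\<forall>y\<in>space M. \<forall>c. D i y \<le> kernel_op M (s i) \<Psi> y + c * u i y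
         + exp (-c) * (1 + kernel_op M (s i) (A i) y))" if "i \<le> N" for i
    using that
  proof (induction i)
    case 0
    have "D 0 y \<le> kernel_op M (s 0) \<Psi> y + c * u 0 y
         + exp (-c) * (1 + kernel_op M (s 0) (A 0) y)" if y: "y \<in> space M" for y c
    proof -
      \<comment> \<open>The shift lets \<open>c' * u\<close> absorb the new term
        \<open>b * u / 2\<close> of \<open>D\<close>, at the price of a factor exp(b/2) in the last
        term. Young's inequality is applied at the exponent \<open>-c'\<close>.\<close>
      define c' where "c' = c - b 0 y / 2"
      have "0 = kernel_op M (s 0) (\<lambda>_. 0) y" by (simp add: kernel_op_def)
      also have "\<dots> \<le> kernel_op M (s 0) (\<lambda>v. (\<Psi> v + c' * g v) + exp (-c')) y"
      proof (rule kernel_op_mono[OF s[OF 0] y])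
        fix v assume v: "v \<in> space M"
        show "0 \<le> \<Psi> v + c' * g v + exp (- c')"
          using \<Psi>(2)[OF v, of "-c'"] by (simp add: mult.commute)
      qed (use \<Psi>(1) g(1) in auto)
      also have "\<dots> = kernel_op M (s 0) \<Psi> y + c' * u 0 y + exp (-c')"
        using \<Psi>(1) g(1) by (simp add: kernel_op_add[OF s[OF 0] y] kernel_op_cmult
            kernel_op_const[OF s[OF 0] y] u_def)
      finally have **: "b 0 y * u 0 y / 2 \<le> kernel_op M (s 0) \<Psi> y + c * u 0 y + exp (-c')"
        by (simp add: c'_def algebra_simps)
      have "exp (-c') = exp (-c) * exp (b 0 y / 2)"
        by (simp add: c'_def exp_add[symmetric])
      moreover have "exp (b 0 y / 2) \<le> 1 + b 0 y"
        using exp_half_times_le[of "b 0 y" 0] b01[OF 0 y] by simp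
      moreover have "A 0 = a 0" by (auto simp: A_def)
      then have "b 0 y = kernel_op M (s 0) (A 0) y" by (simp add: b_def)
      ultimately have "exp (-c') \<le> exp (-c) * (1 + kernel_op M (s 0) (A 0) y)"
        by simp
      with ** show ?thesis by (simp add: D_0)
    qed
    then show ?case using int_bu[OF 0] by (simp add: D_0[abs_def])
  next
    case (Suc i)
    then have i: "i < N" "i \<le> N" by auto
    note IH = Suc.IH[OF i(2)]
    have D_int: "integrable M (D i)" using IH by simp
    have comp': "kernel_op M (q i) (kernel_op M (s i) h) y = kernel_op M (s (Suc i)) h y"
      if "y \<in> space M" "integrable M h" for h y
      using comp[OF i(1)] that by (intro kernel_op_comp[OF q[OF i(1)] s[OF i(2)]]) auto
    have "D (Suc i) y \<le> kernel_op M (s (Suc i)) \<Psi> y + c * u (Suc i) y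
         + exp (-c) * (1 + kernel_op M (s (Suc i)) (A (Suc i)) y)" if y: "y \<in> space M" for y c
    proof -
      \<comment> \<open>The induction hypothesis is used at the shifted parameter, which is constant
        under \<open>kernel_op M (q i)\<close> because \<open>y\<close> is fixed; this is the reason
        for quantifying over all \<open>c\<close>.\<close>
      define c' where "c' = c - b (Suc i) y / 2"
      define Z where "Z = kernel_op M (s (Suc i)) (A i) y"
      have bZ: "kernel_op M (s (Suc i)) (A (Suc i)) y = Z + b (Suc i) y"
      proof -
        have "A (Suc i) = (\<lambda>v. A i v + a (Suc i) v)" by (auto simp: A_def)
        then show ?thesis
          using kernel_op_add[OF s[OF Suc.prems] y int_A[OF i(2)] int_a[OF Suc.prems]]
          by (simp add: Z_def b_def)
      qed
      have "kernel_op M (s (Suc i)) (A (Suc i)) y \<le> kernel_op M (s (Suc i)) (\<lambda>_. 1) y"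
        using A(3)[OF Suc.prems] by (intro kernel_op_mono[OF s[OF Suc.prems] y int_A[OF Suc.prems]]) auto
      then have bZ1: "Z + b (Suc i) y \<le> 1"
        by (simp add: bZ kernel_op_const[OF s[OF Suc.prems] y])
      have Z0: "0 \<le> Z" unfolding Z_def
        using A(2)[OF i(2)] by (intro kernel_op_nonneg[OF s[OF Suc.prems] y]) auto
      have *: "integrable M (kernel_op M (s i) \<Psi>)" "integrable M (u i)"
        "integrable M (kernel_op M (s i) (A i))"
        using kernel_op_integrable[OF s[OF i(2)]] \<Psi>(1) int_u[OF i(2)] int_A[OF i(2)] by auto
      have "kernel_op M (q i) (D i) y \<le> kernel_op M (q i)
          (\<lambda>v. (kernel_op M (s i) \<Psi> v + c' * u i v) + exp (-c') * (1 + kernel_op M (s i) (A i) v)) y"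
        using IH * by (intro kernel_op_mono[OF q[OF i(1)] y D_int]) auto
      also have "\<dots> = kernel_op M (s (Suc i)) \<Psi> y + c' * u (Suc i) y + exp (-c') * (1 + Z)"
        using * \<Psi>(1) g(1) int_A[OF i(2)] comp'[OF y, of \<Psi>] comp'[OF y, of g] comp'[OF y, of "A i"]
        by (simp add: kernel_op_add[OF q[OF i(1)] y] kernel_op_cmult
            kernel_op_const[OF q[OF i(1)] y] u_def Z_def)
      finally have "D (Suc i) y \<le> kernel_op M (s (Suc i)) \<Psi> y + c * u (Suc i) y + exp (-c') * (1 + Z)"
        by (simp add: D_Suc c'_def algebra_simps)
      moreover have "exp (-c') = exp (-c) * exp (b (Suc i) y / 2)"
        by (simp add: c'_def exp_add[symmetric])
      moreover have "exp (b (Suc i) y / 2) * (1 + Z) \<le> 1 + b (Suc i) y + Z"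
        using b01[OF Suc.prems y] Z0 bZ1 by (intro exp_half_times_le) auto
      then have "exp (-c) * (exp (b (Suc i) y / 2) * (1 + Z)) \<le> exp (-c) * (1 + (Z + b (Suc i) y))"
        by (intro mult_left_mono) auto
      ultimately show ?thesis unfolding bZ by (metis (no_types, lifting) add_left_mono mult.assoc order_trans)
    qed
    moreover have "integrable M (D (Suc i))"
      using int_bu[OF Suc.prems] kernel_op_integrable[OF q[OF i(1)] D_int]
      by (simp add: D_Suc[abs_def])
    moreover have "(LINT y|M. D (Suc i) y) = (\<Sum>j\<le>Suc i. LINT y|M. b j y * u j y) / 2"
      using int_bu[OF Suc.prems] kernel_op_integrable[OF q[OF i(1)] D_int] IH
      by (simp add: D_Suc[abs_def] kernel_op_integral[OF q[OF i(1)] D_int] add_divide_distrib)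
    ultimately show ?case by blast
  qed
  note DN = this[OF order.refl]
  have "(LINT y|M. D N y) \<le> (LINT y|M. kernel_op M (s N) \<Psi> y + 2)"
  proof (rule integral_mono)
    fix y assume y: "y \<in> space M"
    have "kernel_op M (s N) (A N) y \<le> kernel_op M (s N) (\<lambda>_. 1) y"
      using A(3)[OF order.refl] by (intro kernel_op_mono[OF s[OF order.refl] y int_A[OF order.refl]]) auto
    \<comment> \<open>At the outer end of the chain no exponent has been accumulated, so
      \<open>c = 0\<close>; then 1 plus an average of \<open>A N \<le> 1\<close> gives the constant
      2.\<close>
    moreover have "D N y \<le> kernel_op M (s N) \<Psi> y + 0 * u N y
         + exp (-0) * (1 + kernel_op M (s N) (A N) y)" using DN y by blast
    ultimately show "D N y \<le> kernel_op M (s N) \<Psi> y + 2"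
      by (simp add: kernel_op_const[OF s[OF order.refl] y])
  qed (use DN kernel_op_integrable[OF s[OF order.refl] \<Psi>(1)] in auto)
  also have "\<dots> = (LINT y|M. \<Psi> y) + 2"
    using kernel_op_integrable[OF s[OF order.refl] \<Psi>(1)] kernel_op_integral[OF s[OF order.refl] \<Psi>(1)]
    by (simp add: prob_space)
  finally show ?thesis using DN by (simp add: b_def u_def)
qed

text \<open>Linearizes the maximum: the weights select, measurably in \<open>v\<close>, one
  maximizing index, so that the integral of the maximum becomes a sum of integrals against fixed
  functions. The induction keeps the older index in case of a tie.\<close>

lemma Max_measurable_partition:
  fixes X :: "nat \<Rightarrow> 'a \<Rightarrow> real"
  assumes "\<And>i. i \<le> N \<Longrightarrow> X i \<in> borel_measurable M"
  shows "\<exists>a. (\<forall>i\<le>N. a i \<in> borel_measurable M) \<and> (\<forall>i v. 0 \<le> a i v) \<and>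
     (\<forall>v. (\<Sum>i\<le>N. a i v) = (1::real)) \<and> (\<forall>v. (\<Sum>i\<le>N. a i v * X i v) = (MAX i\<in>{..N}. X i v))"
  using assms
proof (induction N)
  case 0
  then show ?case by (intro exI[of _ "\<lambda>_ _. 1"]) auto
next
  case (Suc N)
  have "\<And>i. i \<le> N \<Longrightarrow> X i \<in> borel_measurable M" using Suc.prems by simp
  from Suc.IH[OF this] obtain a where a: "\<forall>i\<le>N. a i \<in> borel_measurable M" "\<And>i v. 0 \<le> a i v"
     "\<And>v. (\<Sum>i\<le>N. a i v) = (1::real)" "\<And>v. (\<Sum>i\<le>N. a i v * X i v) = (MAX i\<in>{..N}. X i v)"
    by blast
  define Y where "Y v = (\<Sum>i\<le>N. a i v * X i v)" for v
  have [measurable]: "Y \<in> borel_measurable M" "X (Suc N) \<in> borel_measurable M"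
    unfolding Y_def[abs_def] using a(1) Suc.prems by (auto intro!: borel_measurable_sum borel_measurable_times)
  define a' where "a' i v = (if X (Suc N) v \<le> Y v then (if i = Suc N then 0 else a i v)
                             else (if i = Suc N then 1 else 0))" for i v
  have sum_a': "(\<Sum>i\<le>N. a' i v * h i) = (if X (Suc N) v \<le> Y v then (\<Sum>i\<le>N. a i v * h i) else 0)"
    for v and h :: "nat \<Rightarrow> real"
    by (auto simp: a'_def intro!: sum.cong sum.neutral)
  have "(MAX i\<in>{..Suc N}. X i v) = max (X (Suc N) v) (Y v)" for v
    by (simp add: atMost_Suc Y_def a(4))
  moreover have "a' i \<in> borel_measurable M" if "i \<le> Suc N" for i
  proof (cases "i = Suc N")
    case False
    then have [measurable]: "a i \<in> borel_measurable M" using a(1) that by auto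
    show ?thesis unfolding a'_def[abs_def] by measurable
  next
    case True
    have "(\<lambda>v. if X (Suc N) v \<le> Y v then 0 else 1 :: real) \<in> borel_measurable M" by measurable
    then show ?thesis by (simp add: a'_def[abs_def] True cong: if_cong)
  qed
  moreover have "0 \<le> a' i v" for i v by (simp add: a'_def a(2))
  moreover have "(\<Sum>i\<le>Suc N. a' i v) = 1" for v
    using sum_a'[of v "\<lambda>_. 1"] a(3) by (simp add: a'_def)
  moreover have "(\<Sum>i\<le>Suc N. a' i v * X i v) = max (X (Suc N) v) (Y v)" for v
    using sum_a'[of v "\<lambda>i. X i v"] by (simp add: a'_def Y_def)
  ultimately show ?case by (intro exI[of _ a']) auto
qed

text \<open>The radii decrease with the index \<open>i\<close>: \<open>s 0\<close> is the kernel closest to the identity.\<close>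
theorem (in prob_space) maximal_inequality:
  fixes s q t :: "nat \<Rightarrow> 'a \<Rightarrow> 'a \<Rightarrow> real" and g \<Psi> :: "'a \<Rightarrow> real"
  assumes s: "\<And>i. i \<le> N \<Longrightarrow> sym_markov M (s i)"
    and q: "\<And>i. i < N \<Longrightarrow> sym_markov M (q i)"
    and t: "\<And>i. i \<le> N \<Longrightarrow> sym_markov M (t i)"
    and comp: "\<And>i x u. i < N \<Longrightarrow> x \<in> space M \<Longrightarrow> u \<in> space M \<Longrightarrow>
                 (LINT v|M. q i x v * s i v u) = s (Suc i) x u"
    and sqr: "\<And>i x u. i \<le> N \<Longrightarrow> x \<in> space M \<Longrightarrow> u \<in> space M \<Longrightarrow>
                 (LINT v|M. s i x v * s i v u) = t i x u"
    and g: "integrable M g" "\<And>v. v \<in> space M \<Longrightarrow> 0 \<le> g v"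
    and \<Psi>: "integrable M \<Psi>" "\<And>v y. v \<in> space M \<Longrightarrow> g v * y \<le> \<Psi> v + exp y"
  shows "integrable M (\<lambda>x. MAX i\<in>{..N}. kernel_op M (t i) g x)"
    and "(LINT x|M. (MAX i\<in>{..N}. kernel_op M (t i) g x)) \<le> 2 * (LINT x|M. \<Psi> x) + 4"
proof -
  have int_t: "integrable M (kernel_op M (t i) g)" if "i \<le> N" for i
    using kernel_op_integrable[OF t[OF that] g(1)] .
  obtain a where a: "\<And>i. i \<le> N \<Longrightarrow> a i \<in> borel_measurable M" "\<And>i v. 0 \<le> a i v"
     "\<And>v. (\<Sum>i\<le>N. a i v) = (1::real)"
     and a_Max: "\<And>v. (\<Sum>i\<le>N. a i v * kernel_op M (t i) g v) = (MAX i\<in>{..N}. kernel_op M (t i) g v)"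
    using Max_measurable_partition[of N "\<lambda>i. kernel_op M (t i) g" M,
        OF borel_measurable_integrable[OF int_t]] by blast
  have a_le: "\<bar>a i v\<bar> \<le> 1" if "i \<le> N" for i v
    using member_le_sum[of i "{..N}" "\<lambda>i. a i v"] a(2,3) that by auto
  have int_at: "integrable M (\<lambda>x. a i x * kernel_op M (t i) g x)" if "i \<le> N" for i
    using a(1)[OF that] int_t[OF that] a_le[OF that]
    by (intro bounded_mult_integrable[of _ 1]) auto
  show "integrable M (\<lambda>x. MAX i\<in>{..N}. kernel_op M (t i) g x)"
    unfolding a_Max[symmetric] using int_at by (intro Bochner_Integration.integrable_sum) auto
  have "(LINT x|M. (MAX i\<in>{..N}. kernel_op M (t i) g x))
      = (\<Sum>i\<le>N. LINT x|M. a i x * kernel_op M (t i) g x)"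
    unfolding a_Max[symmetric] using int_at by (intro Bochner_Integration.integral_sum) auto
  \<comment> \<open>Here \<open>t i\<close> factors as \<open>s i\<close> applied twice, and one of
    the two factors is moved onto the weight \<open>a i\<close>.\<close>
  also have "\<dots> = (\<Sum>i\<le>N. LINT x|M. kernel_op M (s i) (a i) x * kernel_op M (s i) g x)"
  proof (rule sum.cong[OF refl])
    fix i assume "i \<in> {..N}"
    then have i: "i \<le> N" by simp
    have "(LINT x|M. a i x * kernel_op M (t i) g x)
        = (LINT x|M. a i x * kernel_op M (s i) (kernel_op M (s i) g) x)"
      using kernel_op_comp[OF s[OF i] s[OF i] g(1)] sqr[OF i]
      by (intro Bochner_Integration.integral_cong) auto
    also have "\<dots> = (LINT x|M. kernel_op M (s i) (a i) x * kernel_op M (s i) g x)"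
      using a(1)[OF i] a_le[OF i]
      by (intro kernel_op_adjoint[OF s[OF i] kernel_op_integrable[OF s[OF i] g(1)], of _ 1]) auto
    finally show "(LINT x|M. a i x * kernel_op M (t i) g x)
        = (LINT x|M. kernel_op M (s i) (a i) x * kernel_op M (s i) g x)" .
  qed
  also have "\<dots> \<le> 2 * (LINT x|M. \<Psi> x) + 4"
    using a by (intro maximal_inequality_dual[where q = q, OF s q comp g \<Psi>]) auto
  finally show "(LINT x|M. (MAX i\<in>{..N}. kernel_op M (t i) g x)) \<le> 2 * (LINT x|M. \<Psi> x) + 4" .
qed

section \<open>The Poisson kernel on the circle\<close>

lemma cis_measurable_sphere [measurable]:
  "cis \<in> measurable borel (restrict_space borel (sphere 0 1))"
  by (rule measurable_restrict_space2) (auto intro!: borel_measurable_continuous_onI continuous_intros)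

lemma space_circle_measure [simp]: "space circle_measure = sphere 0 1"
  by (simp add: circle_measure_def space_restrict_space)

lemma sets_circle_measure [measurable_cong, simp]:
  "sets circle_measure = sets (restrict_space borel (sphere 0 1))"
  by (simp add: circle_measure_def)

lemma prob_space_circle_measure: "prob_space circle_measure"
  unfolding circle_measure_def
proof (rule prob_space.prob_space_distr)
  show "prob_space (uniform_measure lborel {0..<2 * pi})"
    by (rule prob_space_uniform_measure) auto
qed simp

text \<open>The interval integral is the form to which the fundamental theorem of calculus applies
  in the orthogonality relations. It runs over an open interval, hence the null set {0} removed in
  the proof.\<close>

lemma circle_measure_integral:
  fixes f :: "complex \<Rightarrow> 'b::{banach, second_countable_topology}"
  assumes [measurable]: "f \<in> borel_measurable (restrict_space borel (sphere 0 1))"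
  shows "(LINT v|circle_measure. f v) = (LBINT t=0..2*pi. f (cis t)) /\<^sub>R (2 * pi)"
proof -
  have "(LINT v|circle_measure. f v) = (LINT t|uniform_measure lborel {0..<2*pi}. f (cis t))"
    unfolding circle_measure_def by (subst integral_distr) auto
  also have "\<dots> = (LINT t|lborel. (indicator {0..<2*pi} t / (2*pi)) *\<^sub>R f (cis t))"
  proof -
    have "uniform_measure lborel {0..<2*pi} = density lborel (\<lambda>t. ennreal (indicator {0..<2*pi} t / (2*pi)))"
      unfolding uniform_measure_def
      using divide_ennreal[of 1 "2 * pi"]
      by (intro density_cong) (auto split: split_indicator)
    then show ?thesis by (simp add: integral_density)
  qed
  also have "\<dots> = (LINT t|lborel. (1 / (2*pi)) *\<^sub>R (indicator {0<..<2*pi} t *\<^sub>R f (cis t)))"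
  proof (rule integral_cong_AE)
    show "AE t in lborel. (indicator {0..<2*pi} t / (2*pi)) *\<^sub>R f (cis t)
        = (1 / (2*pi)) *\<^sub>R (indicator {0<..<2*pi} t *\<^sub>R f (cis t))"
      using AE_lborel_singleton[of 0] by eventually_elim (auto split: split_indicator)
  qed simp_all
  also have "\<dots> = (1 / (2*pi)) *\<^sub>R (LINT t|lborel. indicator {0<..<2*pi} t *\<^sub>R f (cis t))"
    by (rule integral_scaleR_right)
  also have "\<dots> = (1 / (2*pi)) *\<^sub>R (LBINT t=0..2*pi. f (cis t))"
    by (simp add: interval_lebesgue_integral_def set_lebesgue_integral_def einterval_eq zero_ereal_def)
  finally show ?thesis by (simp add: field_simps)
qed

lemma id_measurable_sphere [measurable]: "(\<lambda>v. v) \<in> borel_measurable (restrict_space borel (sphere 0 1))"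
  by (rule measurable_restrict_space1) simp

lemma powi_measurable [measurable (raw)]:
  fixes f :: "'a \<Rightarrow> complex"
  assumes [measurable]: "f \<in> borel_measurable M"
  shows "(\<lambda>x. f x powi k) \<in> borel_measurable M"
  unfolding power_int_def by measurable

lemma cnj_measurable [measurable (raw)]:
  assumes "f \<in> borel_measurable M"
  shows "(\<lambda>x. cnj (f x)) \<in> borel_measurable M"
  by (rule measurable_compose[OF assms borel_measurable_continuous_onI]) (intro continuous_intros)

lemma circle_measure_orthogonality:
  "(LINT v|circle_measure. v powi k) = (if k = 0 then 1 else 0)"
proof (cases "k = 0")
  case True
  then show ?thesis using prob_space.prob_space[OF prob_space_circle_measure] by simp
next
  case False
  have "(LINT v|circle_measure. v powi k) = (LBINT t=ereal 0..ereal (2*pi). cis t powi k) /\<^sub>R (2 * pi)"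
    using circle_measure_integral[of "\<lambda>v. v powi k"] by (simp add: zero_ereal_def)
  also have "(LBINT t=ereal 0..ereal (2*pi). cis t powi k) = cis (real_of_int k * (2*pi)) / (\<i> * of_int k) - cis (real_of_int k * 0) / (\<i> * of_int k)"
  proof (rule interval_integral_FTC_finite)
    show "continuous_on {min 0 (2 * pi)..max 0 (2 * pi)} (\<lambda>t. cis t powi k)"
      by (intro continuous_intros) auto
    show "((\<lambda>t. cis (real_of_int k * t) / (\<i> * of_int k)) has_vector_derivative cis t powi k)
           (at t within {min 0 (2*pi)..max 0 (2*pi)})" for t
    proof -
      have "((\<lambda>t. cis (real_of_int k * t) / (\<i> * of_int k)) has_vector_derivative 
        (real_of_int k *\<^sub>R (\<i> * cis (real_of_int k * t))) / (\<i> * of_int k)) (at t within {min 0 (2*pi)..max 0 (2*pi)})"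
        unfolding cis_conv_exp
        by (rule derivative_eq_intros has_vector_derivative_real_field refl | simp)+
          (use False in \<open>simp add: scaleR_conv_of_real field_simps\<close>)
      also have "(real_of_int k *\<^sub>R (\<i> * cis (real_of_int k * t))) / (\<i> * of_int k) = cis t powi k"
        using False by (simp add: cis_power_int scaleR_conv_of_real)
      finally show ?thesis .
    qed
  qed
  also have "\<dots> = 0" using cis_multiple_2pi[of "of_int k"] by (simp add: mult.commute)
  finally show ?thesis using False by simp
qed

definition poisson :: "real \<Rightarrow> complex \<Rightarrow> complex \<Rightarrow> real" where
  "poisson r w v = (1 - r\<^sup>2) / (cmod (1 - r * w * cnj v))\<^sup>2"

text \<open>Symmetric partial Fourier sums of the kernel. Being trigonometric polynomials they
  integrate by orthogonality, and a bound uniform in \<open>m\<close> lets dominated convergence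
  carry the identities over to \<open>poisson\<close>, whose closed form in turn shows
  positivity.\<close>

definition poisson_sum :: "nat \<Rightarrow> real \<Rightarrow> complex \<Rightarrow> complex \<Rightarrow> complex" where
  "poisson_sum m r w v = (\<Sum>k\<in>{-int m..int m}. of_real (r ^ nat \<bar>k\<bar>) * w powi k * cnj (v powi k))"

lemma sum_symmetric_int:
  fixes h :: "int \<Rightarrow> 'a::comm_monoid_add"
  shows "(\<Sum>k\<in>{-int m..int m}. h k) = h 0 + (\<Sum>j\<in>{1..m}. h (int j) + h (- int j))"
proof (induction m)
  case (Suc m)
  have "{-int (Suc m)..int (Suc m)} = insert (int (Suc m)) (insert (- int (Suc m)) {-int m..int m})"
    by auto
  then show ?case by (simp add: Suc.IH add_ac)
qed simp

lemma poisson_sum_bound: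
  assumes "0 \<le> r" "r < 1" "cmod w = 1" "cmod v = 1"
  shows "cmod (poisson_sum m r w v) \<le> 2 / (1 - r)"
proof -
  have "cmod (poisson_sum m r w v) \<le> (\<Sum>k\<in>{-int m..int m}. r ^ nat \<bar>k\<bar>)"
    unfolding poisson_sum_def using assms
    by (intro order.trans[OF norm_sum] sum_mono) (simp add: norm_mult norm_power_int norm_power)
  also have "\<dots> = 1 + 2 * (\<Sum>j\<in>{1..m}. r ^ j)"
    unfolding sum_symmetric_int by (simp add: sum_distrib_left)
  also have "\<dots> \<le> 2 * (\<Sum>j<Suc m. r ^ j)"
    by (simp add: lessThan_Suc_atMost atMost_atLeast0 sum.atLeast_Suc_atMost)
  also have "(\<Sum>j<Suc m. r ^ j) \<le> 1 / (1 - r)"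
  proof -
    have "(\<Sum>j<Suc m. r ^ j) = (1 - r ^ Suc m) / (1 - r)" using sum_gp_strict[of r "Suc m"] assms by simp
    then show ?thesis using assms by (simp add: divide_right_mono)
  qed
  finally show ?thesis by simp
qed

text \<open>With z = r w cnj v, which has modulus r, the positive and the negative frequencies form
  two conjugate geometric series, and 1/(1 - z) + 1/(1 - cnj z) - 1 = (1 - \<bar>z\<bar>^2) /
  \<bar>1 - z\<bar>^2.\<close>

lemma poisson_sum_tendsto:
  assumes "0 \<le> r" "r < 1" "cmod w = 1" "cmod v = 1"
  shows "(\<lambda>m. poisson_sum m r w v) \<longlonglongrightarrow> of_real (poisson r w v)"
proof -
  define z where "z = r * w * cnj v"
  have z: "cmod z < 1" using assms by (simp add: z_def norm_mult)
  then have z1: "1 - z \<noteq> 0" by auto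
  have v: "v \<noteq> 0" "inverse v = cnj v" and w: "w \<noteq> 0" "inverse w = cnj w"
    using assms by (auto simp: inverse_eq_divide divide_conv_cnj)
  have "poisson_sum m r w v = 1 + (\<Sum>j\<in>{1..m}. z ^ j + cnj (z ^ j))" for m
    unfolding poisson_sum_def sum_symmetric_int
    using v w
    by (simp add: z_def power_int_minus power_mult_distrib flip: power_inverse)
  also have "1 + (\<Sum>j\<in>{1..m}. z ^ j + cnj (z ^ j)) = (\<Sum>j<Suc m. z ^ j) + cnj (\<Sum>j<Suc m. z ^ j) - 1" for m
    by (simp add: lessThan_Suc_atMost atMost_atLeast0 sum.atLeast_Suc_atMost sum.distrib)
  finally have eq: "poisson_sum m r w v = (\<Sum>j<Suc m. z ^ j) + cnj (\<Sum>j<Suc m. z ^ j) - 1" for m .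
  have "(\<lambda>m. \<Sum>j<Suc m. z ^ j) \<longlonglongrightarrow> 1 / (1 - z)"
    using geometric_sums[OF z] unfolding sums_def by (rule LIMSEQ_Suc)
  then have "(\<lambda>m. poisson_sum m r w v) \<longlonglongrightarrow> 1 / (1 - z) + cnj (1 / (1 - z)) - 1"
    unfolding eq by (intro tendsto_intros)
  also have "1 / (1 - z) + cnj (1 / (1 - z)) - 1 = of_real ((1 - (cmod z)\<^sup>2) / (cmod (1 - z))\<^sup>2)"
  proof -
    have "cnj (1 - z) \<noteq> 0" using z1 by (metis complex_cnj_zero_iff)
    have "1 / u + 1 / u' - 1 = (1 - (1 - u) * (1 - u')) / (u * u')"
      if "u \<noteq> 0" "u' \<noteq> 0" for u u' :: complex
      using that by (simp add: field_simps)
    from this[OF z1 \<open>cnj (1 - z) \<noteq> 0\<close>]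
    have "1 / (1 - z) + cnj (1 / (1 - z)) - 1 = (1 - z * cnj z) / ((1 - z) * cnj (1 - z))"
      by simp
    then show ?thesis by (simp only: complex_norm_square[symmetric] of_real_divide of_real_diff of_real_1 of_real_power)
  qed
  also have "cmod z = r" using assms by (simp add: z_def norm_mult)
  finally show ?thesis by (simp add: poisson_def z_def)
qed

lemma poisson_nonneg: "0 \<le> r \<Longrightarrow> r < 1 \<Longrightarrow> 0 \<le> poisson r w v"
  by (simp add: poisson_def power_le_one)

lemma poisson_commute: "poisson r w v = poisson r v w"
proof -
  have "cmod (1 - r * w * cnj v) = cmod (cnj (1 - r * w * cnj v))" by (simp only: complex_mod_cnj)
  then show ?thesis by (simp add: poisson_def mult_ac)
qed

lemma poisson_le:
  assumes "0 \<le> r" "r < 1" "cmod w = 1" "cmod v = 1"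
  shows "poisson r w v \<le> 2 / (1 - r)"
proof -
  have "cmod (of_real (poisson r w v)) \<le> 2 / (1 - r)"
    by (rule LIMSEQ_le_const2[OF tendsto_norm[OF poisson_sum_tendsto[OF assms]]])
       (use poisson_sum_bound[OF assms] in auto)
  then show ?thesis using poisson_nonneg[OF assms(1,2)] by simp
qed

lemma poisson_0 [simp]: "poisson 0 w v = 1"
  by (simp add: poisson_def)

lemma poisson_measurable [measurable (raw)]:
  assumes [measurable]: "f \<in> borel_measurable M" "g \<in> borel_measurable M"
  shows "(\<lambda>x. poisson r (f x) (g x)) \<in> borel_measurable M"
  unfolding poisson_def by measurable

lemma poisson_sum_measurable [measurable (raw)]:
  assumes [measurable]: "f \<in> borel_measurable M" "g \<in> borel_measurable M"
  shows "(\<lambda>x. poisson_sum m r (f x) (g x)) \<in> borel_measurable M"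
  unfolding poisson_sum_def by measurable

lemma circle_measure_orthogonality':
  "(LINT v|circle_measure. cnj v powi k * v powi l) = (if k = l then 1 else 0)"
proof -
  have "(LINT v|circle_measure. cnj v powi k * v powi l) = (LINT v|circle_measure. v powi (l - k))"
  proof (rule Bochner_Integration.integral_cong[OF refl])
    fix v assume "v \<in> space circle_measure"
    then have "cmod v = 1" by simp
    then have v: "v \<noteq> 0" "inverse v = cnj v" by (auto simp: inverse_eq_divide divide_conv_cnj)
    have "cnj v powi k = v powi (- k)"
      using v(2) by (simp add: power_int_minus flip: power_int_inverse)
    then show "cnj v powi k * v powi l = v powi (l - k)"
      using v by (simp flip: power_int_add)
  qed
  then show ?thesis by (simp add: circle_measure_orthogonality)
qed

lemma circle_integrable_bounded:
  fixes f :: "complex \<Rightarrow> 'b::{banach, second_countable_topology}"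
  assumes "f \<in> borel_measurable circle_measure" "\<And>v. cmod v = 1 \<Longrightarrow> norm (f v) \<le> C"
  shows "integrable circle_measure f"
proof -
  interpret prob_space circle_measure by (rule prob_space_circle_measure)
  show ?thesis using assms by (intro integrable_const_bound[of _ C]) (auto intro!: AE_I2)
qed

lemma circle_bounded_convergence:
  fixes f :: "nat \<Rightarrow> complex \<Rightarrow> complex"
  assumes "\<And>m. f m \<in> borel_measurable circle_measure"
    and "\<And>m v. cmod v = 1 \<Longrightarrow> cmod (f m v) \<le> C"
    and "\<And>v. cmod v = 1 \<Longrightarrow> (\<lambda>m. f m v) \<longlonglongrightarrow> g v"
  shows "(\<lambda>m. LINT v|circle_measure. f m v) \<longlonglongrightarrow> (LINT v|circle_measure. g v)"
proof -
  interpret prob_space circle_measure by (rule prob_space_circle_measure)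
  have "g \<in> borel_measurable circle_measure"
    by (rule borel_measurable_LIMSEQ_metric[OF assms(1)]) (use assms(3) in auto)
  then show ?thesis using assms
    by (intro integral_dominated_convergence[of _ _ _ "\<lambda>_. C"]) (auto intro!: AE_I2)
qed

lemma monomial_times_poisson_sum_integral:
  assumes "cmod w = 1" "\<bar>l\<bar> \<le> int m"
  shows "(LINT v|circle_measure. poisson_sum m r w v * v powi l) = of_real (r ^ nat \<bar>l\<bar>) * w powi l"
proof -
  have int: "integrable circle_measure (\<lambda>v. cnj (v powi k) * v powi l)" for k
    by (rule circle_integrable_bounded[of _ 1]) (auto simp: norm_mult norm_power_int)
  have "(LINT v|circle_measure. poisson_sum m r w v * v powi l)
     = (\<Sum>k\<in>{-int m..int m}. of_real (r ^ nat \<bar>k\<bar>) * w powi k * (LINT v|circle_measure. cnj (v powi k) * v powi l))"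
    unfolding poisson_sum_def sum_distrib_right
    using int by (subst Bochner_Integration.integral_sum) (auto simp: mult.assoc)
  also have "\<dots> = of_real (r ^ nat \<bar>l\<bar>) * w powi l"
    using assms by (subst sum.remove[of _ l]) (auto simp: circle_measure_orthogonality' intro!: sum.neutral)
  finally show ?thesis .
qed

text \<open>Convolution multiplies Fourier coefficients, and r^\<bar>k\<bar> r'^\<bar>k\<bar> = (r
  r')^\<bar>k\<bar>. The identity is exact for the partial sums and passes to the limit.\<close>

lemma poisson_semigroup:
  assumes r: "0 \<le> r" "r < 1" and r': "0 \<le> r'" "r' < 1" and w: "cmod w = 1" and u: "cmod u = 1"
  shows "(LINT v|circle_measure. poisson r w v * poisson r' v u) = poisson (r * r') w u"
proof -
  have "(\<lambda>m. LINT v|circle_measure. poisson_sum m r w v * poisson_sum m r' v u) \<longlonglongrightarrow>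
     (LINT v|circle_measure. of_real (poisson r w v) * of_real (poisson r' v u))"
  proof (rule circle_bounded_convergence)
    fix m v assume v: "cmod v = 1"
    show "cmod (poisson_sum m r w v * poisson_sum m r' v u) \<le> (2 / (1 - r)) * (2 / (1 - r'))"
      unfolding norm_mult using r by (intro mult_mono poisson_sum_bound r r' w u v) auto
  qed (use assms in \<open>auto intro!: tendsto_mult poisson_sum_tendsto\<close>)
  moreover have "(LINT v|circle_measure. poisson_sum m r w v * poisson_sum m r' v u)
      = poisson_sum m (r * r') w u" for m
  proof -
    have int: "integrable circle_measure (\<lambda>v. poisson_sum m r w v * v powi k)" for k
      using poisson_sum_bound[OF r w]
      by (intro circle_integrable_bounded[of _ "2 / (1 - r)"]) (auto simp: norm_mult norm_power_int)
    have "(LINT v|circle_measure. poisson_sum m r w v * poisson_sum m r' v u)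
     = (\<Sum>k\<in>{-int m..int m}. of_real (r' ^ nat \<bar>k\<bar>) * cnj (u powi k) *
          (LINT v|circle_measure. poisson_sum m r w v * v powi k))"
    proof -
      have "poisson_sum m r w v * poisson_sum m r' v u = (\<Sum>k\<in>{-int m..int m}.
          of_real (r' ^ nat \<bar>k\<bar>) * cnj (u powi k) * (poisson_sum m r w v * v powi k))" for v
        by (simp add: poisson_sum_def[of m r'] sum_distrib_left mult_ac)
      then show ?thesis using int by (simp add: Bochner_Integration.integral_sum)
    qed
    also have "\<dots> = poisson_sum m (r * r') w u"
      unfolding poisson_sum_def[of m "r * r'"]
    proof (rule sum.cong[OF refl])
      fix k assume "k \<in> {-int m..int m}"
      then have "\<bar>k\<bar> \<le> int m" by auto
      from monomial_times_poisson_sum_integral[OF w this, of r]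
      show "of_real (r' ^ nat \<bar>k\<bar>) * cnj (u powi k) * (LINT v|circle_measure. poisson_sum m r w v * v powi k)
         = of_real ((r * r') ^ nat \<bar>k\<bar>) * w powi k * cnj (u powi k)"
        by (simp only: power_mult_distrib of_real_mult mult_ac)
    qed
    finally show ?thesis .
  qed
  moreover have "r * r' < 1" using mult_strict_mono[of r 1 r' 1] r r' by (cases "r' = 0") auto
  then have "(\<lambda>m. poisson_sum m (r * r') w u) \<longlonglongrightarrow> of_real (poisson (r * r') w u)"
    using assms by (intro poisson_sum_tendsto) auto
  ultimately have "(LINT v|circle_measure. of_real (poisson r w v) * of_real (poisson r' v u))
      = complex_of_real (poisson (r * r') w u)"
    by (simp add: LIMSEQ_unique)
  then have "complex_of_real (LINT v|circle_measure. poisson r w v * poisson r' v u)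
      = complex_of_real (poisson (r * r') w u)"
    unfolding integral_complex_of_real[symmetric] by simp
  then show ?thesis by (simp only: of_real_eq_iff)
qed

lemma poisson_integrable:
  assumes "0 \<le> r" "r < 1" "cmod w = 1"
  shows "integrable circle_measure (poisson r w)"
  using poisson_le[OF assms] poisson_nonneg[OF assms(1,2)]
  by (intro circle_integrable_bounded[of _ "2 / (1 - r)"]) auto

text \<open>The semigroup law with second radius 0, whose kernel is constantly 1.\<close>

lemma poisson_integral:
  assumes "0 \<le> r" "r < 1" "cmod w = 1"
  shows "(LINT v|circle_measure. poisson r w v) = 1"
  using poisson_semigroup[OF assms(1,2), of 0 w 1] assms by simp

text \<open>On the circle \<bar>w - v\<bar>^2 = 2 - 2 Re(cnj w v), so the value is determined by two
  moments of the kernel: its mass 1 and its mean r w.\<close>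

lemma poisson_second_moment:
  assumes r: "0 \<le> r" "r < 1" and w: "cmod w = 1"
  shows "(LINT v|circle_measure. poisson r w v * (cmod (w - v))\<^sup>2) = 2 - 2 * r"
proof -
  have int: "integrable circle_measure (\<lambda>v. of_real (poisson r w v) * v)"
    using poisson_le[OF r w] poisson_nonneg[OF r]
    by (intro circle_integrable_bounded[of _ "2 / (1 - r)"]) (auto simp: norm_mult)
  \<comment> \<open>\<open>Suc m\<close> guarantees that the frequency 1 already occurs in the
    partial sum, so that every member of the sequence equals r w.\<close>
  have "(\<lambda>m. LINT v|circle_measure. poisson_sum (Suc m) r w v * v) \<longlonglongrightarrow>
     (LINT v|circle_measure. of_real (poisson r w v) * v)"
  proof (rule circle_bounded_convergence)
    fix m v assume v: "cmod v = 1"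
    show "cmod (poisson_sum (Suc m) r w v * v) \<le> 2 / (1 - r)"
      using poisson_sum_bound[OF r w v] v by (simp add: norm_mult)
    show "(\<lambda>m. poisson_sum (Suc m) r w v * v) \<longlonglongrightarrow> of_real (poisson r w v) * v"
      by (intro tendsto_intros LIMSEQ_Suc poisson_sum_tendsto r w v)
  qed auto
  moreover have "(LINT v|circle_measure. poisson_sum (Suc m) r w v * v) = r * w" for m
    using monomial_times_poisson_sum_integral[OF w, of 1 "Suc m" r] by simp
  ultimately have 1: "(LINT v|circle_measure. of_real (poisson r w v) * v) = r * w"
    by (simp add: LIMSEQ_const_iff)
  have "(LINT v|circle_measure. poisson r w v * (cmod (w - v))\<^sup>2)
      = (LINT v|circle_measure. 2 * poisson r w v - 2 * Re (cnj w * (of_real (poisson r w v) * v)))"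
  proof (rule Bochner_Integration.integral_cong[OF refl])
    fix v assume "v \<in> space circle_measure"
    then have v: "cmod v = 1" by simp
    have "(cmod (w - v))\<^sup>2 = (cmod w)\<^sup>2 + (cmod v)\<^sup>2 - 2 * Re (cnj w * v)"
      unfolding cmod_power2 by (simp add: power2_eq_square algebra_simps)
    also have "\<dots> = 2 - 2 * Re (cnj w * v)" using w v by simp
    finally have "poisson r w v * (cmod (w - v))\<^sup>2 = poisson r w v * (2 - 2 * Re (cnj w * v))"
      by simp
    also have "\<dots> = 2 * poisson r w v - 2 * Re (cnj w * (of_real (poisson r w v) * v))"
      by (simp add: algebra_simps)
    finally show "poisson r w v * (cmod (w - v))\<^sup>2 = 2 * poisson r w v - 2 * Re (cnj w * (of_real (poisson r w v) * v))" .
  qed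
  also have "\<dots> = 2 * (LINT v|circle_measure. poisson r w v)
      - 2 * Re (LINT v|circle_measure. cnj w * (of_real (poisson r w v) * v))"
  proof -
    have "(LINT v|circle_measure. 2 * p v - 2 * Re (h v)) = 2 * (LINT v|circle_measure. p v) - 2 * Re (LINT v|circle_measure. h v)"
      if "integrable circle_measure p" "integrable circle_measure h" for p h
      using that by simp
    then show ?thesis using poisson_integrable[OF r w] integrable_mult_right[OF int] by blast
  qed
  also have "(LINT v|circle_measure. cnj w * (of_real (poisson r w v) * v)) = r * (cnj w * w)"
    using 1 by simp
  also have "cnj w * w = 1" using w complex_norm_square[of w] by (simp add: mult.commute)
  finally show ?thesis using poisson_integral[OF r w] by simp
qed

section \<open>Poisson kernels on the torus\<close>

interpretation circle: prob_space circle_measure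
  by (rule prob_space_circle_measure)

interpretation circle_prod: product_prob_space "\<lambda>_::nat. circle_measure" UNIV ..

interpretation torus: prob_space torus_measure
  unfolding torus_measure_def by (rule circle_prod.P.prob_space_axioms)

lemma space_torus_measure: "space torus_measure = {w. \<forall>n. cmod (w n) = 1}"
  by (auto simp: torus_measure_def space_PiM PiE_iff)

lemma torus_component_measurable [measurable]: "(\<lambda>w. w n) \<in> borel_measurable torus_measure"
proof -
  have "(\<lambda>w. w n) \<in> measurable torus_measure circle_measure"
    unfolding torus_measure_def by (rule measurable_component_singleton) simp
  then show ?thesis by (rule measurable_compose) simp
qed

text \<open>The integrand depends on the first \<open>d\<close> coordinates, so the integral is
  pushed to the finite product measure, where Fubini factors it.\<close>

lemma torus_integral_prod:
  fixes h :: "nat \<Rightarrow> complex \<Rightarrow> 'b::{real_normed_field, banach, second_countable_topology}"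
  assumes int: "\<And>n. n < d \<Longrightarrow> integrable circle_measure (h n)"
  shows "(LINT v|torus_measure. (\<Prod>n<d. h n (v n))) = (\<Prod>n<d. LINT x|circle_measure. h n x)"
proof -
  have [measurable]: "h n \<in> borel_measurable circle_measure" if "n < d" for n
    using int[OF that] by simp
  have "(LINT v|torus_measure. (\<Prod>n<d. h n (v n)))
      = (LINT v|torus_measure. (\<Prod>n<d. h n (restrict v {..<d} n)))"
    by simp
  also have "\<dots> = (LINT v|distr torus_measure (Pi\<^sub>M {..<d} (\<lambda>_. circle_measure)) (\<lambda>v. restrict v {..<d}).
      (\<Prod>n<d. h n (v n)))"
  proof (subst integral_distr)
    show "(\<lambda>v. \<Prod>n<d. h n (v n)) \<in> borel_measurable (Pi\<^sub>M {..<d} (\<lambda>_. circle_measure))"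
      using int by (intro borel_measurable_prod measurable_compose[OF measurable_component_singleton]) auto
    show "(\<lambda>v. restrict v {..<d}) \<in> measurable torus_measure (Pi\<^sub>M {..<d} (\<lambda>_. circle_measure))"
      unfolding torus_measure_def by (rule measurable_restrict_subset) simp
  qed simp
  also have "\<dots> = (LINT v|Pi\<^sub>M {..<d} (\<lambda>_. circle_measure). (\<Prod>n<d. h n (v n)))"
    unfolding torus_measure_def by (subst circle_prod.distr_PiM_restrict_finite) auto
  also have "\<dots> = (\<Prod>n<d. LINT x|circle_measure. h n x)"
    using int by (intro circle_prod.product_integral_prod) auto
  finally show ?thesis .
qed

text \<open>Coordinates from \<open>d\<close> on are averaged out, exactly as radius 0 would do.
  Finitely many factors keep the kernel bounded; an infinite product with radii in \<open>c0\<close>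
  need not even be a density.\<close>

definition poisson_prod :: "nat \<Rightarrow> (nat \<Rightarrow> real) \<Rightarrow> (nat \<Rightarrow> complex) \<Rightarrow> (nat \<Rightarrow> complex) \<Rightarrow> real" where
  "poisson_prod d \<rho> w v = (\<Prod>n<d. poisson (\<rho> n) (w n) (v n))"

lemma poisson_prod_bounds:
  assumes "\<And>n. n < d \<Longrightarrow> 0 \<le> \<rho> n \<and> \<rho> n < 1" "w \<in> space torus_measure" "v \<in> space torus_measure"
  shows "0 \<le> poisson_prod d \<rho> w v" "poisson_prod d \<rho> w v \<le> (\<Prod>n<d. 2 / (1 - \<rho> n))"
  unfolding poisson_prod_def using assms
  by (auto intro!: prod_nonneg prod_mono poisson_nonneg poisson_le simp: space_torus_measure)

lemma poisson_prod_comp: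
  assumes \<rho>: "\<And>n. n < d \<Longrightarrow> 0 \<le> \<rho> n \<and> \<rho> n < 1" and \<sigma>: "\<And>n. n < d \<Longrightarrow> 0 \<le> \<sigma> n \<and> \<sigma> n < 1"
    and w: "w \<in> space torus_measure" and u: "u \<in> space torus_measure"
  shows "(LINT v|torus_measure. poisson_prod d \<rho> w v * poisson_prod d \<sigma> v u)
       = poisson_prod d (\<lambda>n. \<rho> n * \<sigma> n) w u"
proof -
  have "(LINT v|torus_measure. poisson_prod d \<rho> w v * poisson_prod d \<sigma> v u)
     = (LINT v|torus_measure. (\<Prod>n<d. poisson (\<rho> n) (w n) (v n) * poisson (\<sigma> n) (v n) (u n)))"
    by (simp add: poisson_prod_def prod.distrib)
  also have "\<dots> = (\<Prod>n<d. LINT x|circle_measure. poisson (\<rho> n) (w n) x * poisson (\<sigma> n) x (u n))"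
  proof (rule torus_integral_prod)
    fix n assume n: "n < d"
    show "integrable circle_measure (\<lambda>x. poisson (\<rho> n) (w n) x * poisson (\<sigma> n) x (u n))"
    proof (rule circle_integrable_bounded)
      fix v assume v: "cmod v = 1"
      have "cmod (w n) = 1" "cmod (u n) = 1" using w u by (auto simp: space_torus_measure)
      with v \<rho>[OF n] \<sigma>[OF n] poisson_nonneg[of "\<rho> n"] poisson_nonneg[of "\<sigma> n"]
      show "norm (poisson (\<rho> n) (w n) v * poisson (\<sigma> n) v (u n)) \<le> 2 / (1 - \<rho> n) * (2 / (1 - \<sigma> n))"
        unfolding norm_mult by (intro mult_mono) (auto intro!: poisson_le)
    qed measurable
  qed
  also have "\<dots> = poisson_prod d (\<lambda>n. \<rho> n * \<sigma> n) w u"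
    unfolding poisson_prod_def using \<rho> \<sigma> w u
    by (intro prod.cong poisson_semigroup) (auto simp: space_torus_measure)
  finally show ?thesis .
qed

lemma poisson_prod_measurable [measurable (raw)]:
  assumes "f \<in> measurable M torus_measure" "g \<in> measurable M torus_measure"
  shows "(\<lambda>x. poisson_prod d \<rho> (f x) (g x)) \<in> borel_measurable M"
proof -
  have [measurable]: "(\<lambda>x. f x n) \<in> borel_measurable M" "(\<lambda>x. g x n) \<in> borel_measurable M" for n
    by (rule measurable_compose[OF assms(1)], simp, rule measurable_compose[OF assms(2)], simp)
  show ?thesis unfolding poisson_prod_def by measurable
qed

lemma poisson_prod_integral:
  assumes "\<And>n. n < d \<Longrightarrow> 0 \<le> \<rho> n \<and> \<rho> n < 1" "w \<in> space torus_measure"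
  shows "(LINT v|torus_measure. poisson_prod d \<rho> w v) = 1"
  using poisson_prod_comp[of d \<rho> "\<lambda>_. 0", OF _ _ assms(2) assms(2)] assms(1)
  by (simp add: poisson_prod_def)

lemma sym_markov_poisson_prod:
  assumes \<rho>: "\<And>n. n < d \<Longrightarrow> 0 \<le> \<rho> n \<and> \<rho> n < 1"
  shows "sym_markov torus_measure (poisson_prod d \<rho>)"
  unfolding sym_markov_def
proof (intro conjI ballI)
  have "(\<lambda>z. poisson_prod d \<rho> (fst z) (snd z)) \<in> borel_measurable (torus_measure \<Otimes>\<^sub>M torus_measure)"
    by measurable
  then show "case_prod (poisson_prod d \<rho>) \<in> borel_measurable (torus_measure \<Otimes>\<^sub>M torus_measure)"
    by (simp add: case_prod_beta')
  show "\<exists>B. \<forall>x\<in>space torus_measure. \<forall>y\<in>space torus_measure. poisson_prod d \<rho> x y \<le> B"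
    using poisson_prod_bounds(2)[where d = d and \<rho> = \<rho>, OF \<rho>] by blast
  fix x y assume "x \<in> space torus_measure" "y \<in> space torus_measure"
  then show "0 \<le> poisson_prod d \<rho> x y" using poisson_prod_bounds(1)[where d = d and \<rho> = \<rho>, OF \<rho>] by blast
  show "poisson_prod d \<rho> x y = poisson_prod d \<rho> y x"
    by (simp add: poisson_prod_def poisson_commute)
qed (use poisson_prod_integral[where d = d and \<rho> = \<rho>, OF \<rho>] in blast)

lemma poisson_prod_second_moment:
  assumes \<rho>: "\<And>n. n < d \<Longrightarrow> 0 \<le> \<rho> n \<and> \<rho> n < 1" and w: "w \<in> space torus_measure" and j: "j < d"
  shows "(LINT v|torus_measure. poisson_prod d \<rho> w v * (cmod (w j - v j))\<^sup>2) = 2 - 2 * \<rho> j"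
proof -
  define h where "h n x = poisson (\<rho> n) (w n) x * (if n = j then (cmod (w n - x))\<^sup>2 else 1)" for n x
  have w1: "cmod (w n) = 1" for n using w by (simp add: space_torus_measure)
  have "poisson_prod d \<rho> w v * (cmod (w j - v j))\<^sup>2 = (\<Prod>n<d. h n (v n))" for v
  proof -
    have "(\<Prod>n<d. h n (v n)) = poisson_prod d \<rho> w v * (\<Prod>n<d. if n = j then (cmod (w n - v n))\<^sup>2 else 1)"
      by (simp add: h_def prod.distrib poisson_prod_def)
    then show ?thesis using j by simp
  qed
  then have "(LINT v|torus_measure. poisson_prod d \<rho> w v * (cmod (w j - v j))\<^sup>2)
    = (LINT v|torus_measure. (\<Prod>n<d. h n (v n)))" by simp
  also have "\<dots> = (\<Prod>n<d. LINT x|circle_measure. h n x)"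
  proof (rule torus_integral_prod)
    fix n assume n: "n < d"
    show "integrable circle_measure (h n)"
    proof (rule circle_integrable_bounded)
      fix v assume v: "cmod v = 1"
      have "cmod (w n - v) \<le> 2" using norm_triangle_ineq4[of "w n" v] v w1[of n] by simp
      then have "(cmod (w n - v))\<^sup>2 \<le> 2\<^sup>2" by (intro power_mono) auto
      with v w1[of n] \<rho>[OF n] poisson_nonneg[of "\<rho> n"]
      show "norm (h n v) \<le> 2 / (1 - \<rho> n) * 4"
        unfolding norm_mult h_def by (intro mult_mono) (auto intro!: poisson_le)
    next
      show "h n \<in> borel_measurable circle_measure" unfolding h_def by measurable
    qed
  qed
  also have "\<dots> = (\<Prod>n<d. if n = j then 2 - 2 * \<rho> j else 1)"
    unfolding h_def using \<rho> w1
    by (intro prod.cong) (auto simp: poisson_second_moment poisson_integral)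
  finally show ?thesis using j by simp
qed

lemma poisson_prod_complex_integrable:
  fixes g :: "(nat \<Rightarrow> complex) \<Rightarrow> complex"
  assumes \<rho>: "\<And>n. n < d \<Longrightarrow> 0 \<le> \<rho> n \<and> \<rho> n < 1" and w: "w \<in> space torus_measure"
    and g: "integrable torus_measure g"
  shows "integrable torus_measure (\<lambda>v. of_real (poisson_prod d \<rho> w v) * g v)"
proof (rule Bochner_Integration.integrable_bound)
  have "integrable torus_measure (\<lambda>v. poisson_prod d \<rho> w v * cmod (g v))"
    using g by (intro torus.kernel_integrable sym_markov_poisson_prod \<rho> w) auto
  then show "integrable torus_measure (\<lambda>v. poisson_prod d \<rho> w v * cmod (g v))" .
  show "(\<lambda>v. of_real (poisson_prod d \<rho> w v) * g v) \<in> borel_measurable torus_measure"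
    using w borel_measurable_integrable[OF g] by measurable
qed (auto simp: norm_mult)

text \<open>The kernel has mass 1, so the deviation is an average of \<open>G v - G w\<close>;
  Cauchy-Schwarz bounds the mean of each \<bar>w_n - v_n\<bar> by the root of its second moment. The
  bound does not involve \<open>d\<close> and vanishes as the radii tend to 1.\<close>

lemma poisson_prod_lipschitz_bound:
  fixes G :: "(nat \<Rightarrow> complex) \<Rightarrow> complex"
  assumes \<rho>: "\<And>n. n < d \<Longrightarrow> 0 \<le> \<rho> n \<and> \<rho> n < 1" and w: "w \<in> space torus_measure"
    and e: "e \<le> d" and G: "integrable torus_measure G"
    and lip: "\<And>v. v \<in> space torus_measure \<Longrightarrow> cmod (G v - G w) \<le> L * (\<Sum>n<e. cmod (w n - v n))"
    and L: "0 \<le> L"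
  shows "cmod ((LINT v|torus_measure. of_real (poisson_prod d \<rho> w v) * G v) - G w)
           \<le> L * (\<Sum>n<e. sqrt (2 - 2 * \<rho> n))"
proof -
  let ?K = "poisson_prod d \<rho> w"
  have w1: "cmod (w n) = 1" for n using w by (simp add: space_torus_measure)
  have mk: "sym_markov torus_measure (poisson_prod d \<rho>)" by (rule sym_markov_poisson_prod[OF \<rho>])
  have int1: "integrable torus_measure (\<lambda>v. cmod (w n - v n))" for n
  proof (rule torus.integrable_of_bounded)
    fix v assume "v \<in> space torus_measure"
    then show "\<bar>cmod (w n - v n)\<bar> \<le> 2"
      using norm_triangle_ineq4[of "w n" "v n"] w1[of n] by (simp add: space_torus_measure)
  qed measurable
  have int2: "integrable torus_measure (\<lambda>v. (cmod (w n - v n))\<^sup>2)" for n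
  proof (rule torus.integrable_of_bounded)
    fix v assume "v \<in> space torus_measure"
    then have "cmod (w n - v n) \<le> 2"
      using norm_triangle_ineq4[of "w n" "v n"] w1[of n] by (simp add: space_torus_measure)
    then have "(cmod (w n - v n))\<^sup>2 \<le> 2\<^sup>2" by (intro power_mono) auto
    then show "\<bar>(cmod (w n - v n))\<^sup>2\<bar> \<le> 4" by simp
  qed measurable
  have first: "(LINT v|torus_measure. ?K v * cmod (w n - v n)) \<le> sqrt (2 - 2 * \<rho> n)" if n: "n < d" for n
  proof -
    \<comment> \<open>Cauchy-Schwarz is replaced by x \<le> x^2 / (2a) + a / 2; the best
      \<open>a\<close> is the root of the second moment, positive because the radius is below
      1.\<close>
    define a where "a = sqrt (2 - 2 * \<rho> n)"
    have a: "0 < a" "a\<^sup>2 = 2 - 2 * \<rho> n" using \<rho>[OF n] by (auto simp: a_def)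
    have "(LINT v|torus_measure. ?K v * cmod (w n - v n))
        \<le> (LINT v|torus_measure. ?K v * ((cmod (w n - v n))\<^sup>2 / (2 * a) + a / 2))"
    proof (rule integral_mono)
      fix v assume v: "v \<in> space torus_measure"
      have "0 \<le> (cmod (w n - v n) - a)\<^sup>2 / (2 * a)" using a by simp
      also have "\<dots> = (cmod (w n - v n))\<^sup>2 / (2 * a) + a / 2 - cmod (w n - v n)"
        using a(1) by (simp add: power2_diff field_simps power2_eq_square)
      finally show "?K v * cmod (w n - v n) \<le> ?K v * ((cmod (w n - v n))\<^sup>2 / (2 * a) + a / 2)"
        using poisson_prod_bounds(1)[OF \<rho> w v] by (intro mult_left_mono) auto
    next
      show "integrable torus_measure (\<lambda>v. ?K v * cmod (w n - v n))"
        by (rule torus.kernel_integrable[OF mk w int1])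
      show "integrable torus_measure (\<lambda>v. ?K v * ((cmod (w n - v n))\<^sup>2 / (2 * a) + a / 2))"
        using int2[of n] by (intro torus.kernel_integrable[OF mk w]) auto
    qed
    also have "\<dots> = (LINT v|torus_measure. (?K v * (cmod (w n - v n))\<^sup>2) / (2 * a) + ?K v * (a / 2))"
      by (simp add: distrib_left)
    also have "\<dots> = (LINT v|torus_measure. ?K v * (cmod (w n - v n))\<^sup>2) / (2 * a)
        + (LINT v|torus_measure. ?K v) * (a / 2)"
    proof (subst Bochner_Integration.integral_add)
      show "integrable torus_measure (\<lambda>v. (?K v * (cmod (w n - v n))\<^sup>2) / (2 * a))"
        using torus.kernel_integrable[OF mk w int2[of n]] by simp
      show "integrable torus_measure (\<lambda>v. ?K v * (a / 2))"
        by (rule torus.kernel_integrable[OF mk w]) simp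
    qed simp
    also have "\<dots> = a\<^sup>2 / (2 * a) + a / 2"
      using poisson_prod_second_moment[OF \<rho> w n] poisson_prod_integral[OF \<rho> w] a(2) by simp
    also have "\<dots> = a" using a(1) by (simp add: power2_eq_square)
    finally show ?thesis by (simp add: a_def)
  qed
  have intK: "integrable torus_measure (\<lambda>v. complex_of_real (?K v))"
    using poisson_prod_complex_integrable[where g = "\<lambda>_. 1", OF \<rho> w] by simp
  have "(LINT v|torus_measure. complex_of_real (?K v) * G v) - G w
      = (LINT v|torus_measure. complex_of_real (?K v) * (G v - G w))"
  proof -
    have "(LINT v|torus_measure. complex_of_real (?K v) * (G v - G w))
      = (LINT v|torus_measure. complex_of_real (?K v) * G v) - (LINT v|torus_measure. complex_of_real (?K v) * G w)"
      unfolding right_diff_distrib using poisson_prod_complex_integrable[OF \<rho> w G] intK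
      by (intro Bochner_Integration.integral_diff) auto
    then show ?thesis using poisson_prod_integral[OF \<rho> w] by simp
  qed
  also have "cmod \<dots> \<le> (LINT v|torus_measure. cmod (complex_of_real (?K v) * (G v - G w)))"
    by (rule integral_norm_bound)
  also have "\<dots> \<le> (LINT v|torus_measure. L * (\<Sum>n<e. ?K v * cmod (w n - v n)))"
  proof (rule integral_mono)
    show "integrable torus_measure (\<lambda>v. cmod (complex_of_real (?K v) * (G v - G w)))"
      using poisson_prod_complex_integrable[OF \<rho> w] G by (intro integrable_norm) auto
    show "integrable torus_measure (\<lambda>v. L * (\<Sum>n<e. ?K v * cmod (w n - v n)))"
      using torus.kernel_integrable[OF mk w int1]
      by (intro integrable_mult_right Bochner_Integration.integrable_sum) auto
    fix v assume v: "v \<in> space torus_measure"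
    have "cmod (complex_of_real (?K v) * (G v - G w)) = ?K v * cmod (G v - G w)"
      using poisson_prod_bounds(1)[OF \<rho> w v] by (simp add: norm_mult)
    also have "\<dots> \<le> ?K v * (L * (\<Sum>n<e. cmod (w n - v n)))"
      using poisson_prod_bounds(1)[OF \<rho> w v] lip[OF v] by (intro mult_left_mono) auto
    finally show "cmod (complex_of_real (?K v) * (G v - G w)) \<le> L * (\<Sum>n<e. ?K v * cmod (w n - v n))"
      by (simp add: sum_distrib_left mult.left_commute)
  qed
  also have "\<dots> = L * (\<Sum>n<e. LINT v|torus_measure. ?K v * cmod (w n - v n))"
    using torus.kernel_integrable[OF mk w int1]
    by (simp add: Bochner_Integration.integral_sum)
  also have "\<dots> \<le> L * (\<Sum>n<e. sqrt (2 - 2 * \<rho> n))"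
    using L e by (intro mult_left_mono sum_mono first) auto
  finally show ?thesis .
qed

section \<open>Multi-indices in finitely many variables and the values of \<open>F\<close> at
  finitely supported points\<close>

definition box_index :: "nat \<Rightarrow> (nat \<Rightarrow> int) \<Rightarrow> (nat \<Rightarrow>\<^sub>0 int)" where
  "box_index d g = Abs_poly_mapping (\<lambda>n. if n < d then g n else 0)"

lemma lookup_box_index: "Poly_Mapping.lookup (box_index d g) n = (if n < d then g n else 0)"
proof -
  have "finite {n. (if n < d then g n else 0) \<noteq> 0}"
    by (rule finite_subset[of _ "{..<d}"]) auto
  then show ?thesis by (simp add: box_index_def lookup_Abs_poly_mapping)
qed

lemma monomial_box_index: "monomial (box_index d g) z = (\<Prod>n<d. z n powi g n)"
proof -
  have "monomial (box_index d g) z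
      = (\<Prod>n\<in>Poly_Mapping.keys (box_index d g). z n powi g n)"
    unfolding monomial_def by (intro prod.cong) (auto simp: in_keys_iff lookup_box_index split: if_splits)
  also have "\<dots> = (\<Prod>n<d. z n powi g n)"
    by (intro prod.mono_neutral_left) (auto simp: in_keys_iff lookup_box_index split: if_splits)
  finally show ?thesis .
qed

lemma inj_on_box_index: "inj_on (box_index d) (Pi\<^sub>E {..<d} B)"
proof (rule inj_onI)
  fix g h assume g: "g \<in> Pi\<^sub>E {..<d} B" and h: "h \<in> Pi\<^sub>E {..<d} B" and eq: "box_index d g = box_index d h"
  have "g n = h n" if "n < d" for n
    using arg_cong[OF eq, of "\<lambda>x. Poly_Mapping.lookup x n"] that by (simp add: lookup_box_index)
  then show "g = h" using g h by (intro PiE_ext[OF g h]) auto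
qed

text \<open>An unordered sum may be taken along any exhaustion by finite sets, here growing cubes.
  Indices reaching beyond \<open>d\<close> drop out because a power of 0 with nonzero exponent is
  0.\<close>

lemma box_partial_sums_tendsto:
  fixes c :: "(nat \<Rightarrow>\<^sub>0 int) \<Rightarrow> complex"
  assumes F: "has_monomial_coeffs F c" and z: "z \<in> polydisc" and supp: "\<And>n. n \<ge> d \<Longrightarrow> z n = 0"
  shows "(\<lambda>m. \<Sum>g\<in>Pi\<^sub>E {..<d} (\<lambda>_. {0..int m}). c (box_index d g) * (\<Prod>n<d. z n powi g n)) \<longlonglongrightarrow> F z"
proof -
  let ?N = "{\<alpha>::nat \<Rightarrow>\<^sub>0 int. \<forall>n. 0 \<le> Poly_Mapping.lookup \<alpha> n}"
  let ?N' = "{\<alpha>::nat \<Rightarrow>\<^sub>0 int. (\<forall>n. 0 \<le> Poly_Mapping.lookup \<alpha> n) \<and> (\<forall>n\<ge>d. Poly_Mapping.lookup \<alpha> n = 0)}"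
  define S where "S m = box_index d ` Pi\<^sub>E {..<d} (\<lambda>_. {0..int m})" for m
  have "{n. z n \<noteq> 0} \<subseteq> {..<d}" using supp not_le by blast
  then have "finite {n. z n \<noteq> 0}" by (rule finite_subset) simp
  with F z have "((\<lambda>\<alpha>. c \<alpha> * monomial \<alpha> z) has_sum F z) ?N"
    unfolding has_monomial_coeffs_def by blast
  also have "((\<lambda>\<alpha>. c \<alpha> * monomial \<alpha> z) has_sum F z) ?N \<longleftrightarrow> ((\<lambda>\<alpha>. c \<alpha> * monomial \<alpha> z) has_sum F z) ?N'"
  proof (rule has_sum_cong_neutral)
    fix \<alpha> assume "\<alpha> \<in> ?N - ?N'"
    then obtain n where n: "n \<ge> d" "Poly_Mapping.lookup \<alpha> n \<noteq> 0" by auto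
    then have "n \<in> Poly_Mapping.keys \<alpha>" by (simp add: in_keys_iff)
    moreover have "z n powi Poly_Mapping.lookup \<alpha> n = 0" using n supp by simp
    ultimately have "monomial \<alpha> z = 0" unfolding monomial_def by (intro prod_zero) auto
    then show "c \<alpha> * monomial \<alpha> z = 0" by simp
  qed auto
  finally have lim: "(sum (\<lambda>\<alpha>. c \<alpha> * monomial \<alpha> z) \<longlongrightarrow> F z) (finite_subsets_at_top ?N')"
    unfolding has_sum_def .
  have "filterlim S (finite_subsets_at_top ?N') sequentially"
    unfolding filterlim_finite_subsets_at_top
  proof (intro allI impI)
    fix X assume X: "finite X \<and> X \<subseteq> ?N'"
    have "\<forall>\<^sub>F m in sequentially. \<alpha> \<in> S m" if "\<alpha> \<in> X" for \<alpha>
    proof -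
      have \<alpha>: "\<And>n. 0 \<le> Poly_Mapping.lookup \<alpha> n" "\<And>n. n \<ge> d \<Longrightarrow> Poly_Mapping.lookup \<alpha> n = 0"
        using X that by auto
      have "\<forall>\<^sub>F m in sequentially. \<forall>n\<in>{..<d}. Poly_Mapping.lookup \<alpha> n \<le> int m"
      proof (rule eventually_ball_finite)
        show "\<forall>n\<in>{..<d}. \<forall>\<^sub>F m in sequentially. Poly_Mapping.lookup \<alpha> n \<le> int m"
        proof
          fix n show "\<forall>\<^sub>F m in sequentially. Poly_Mapping.lookup \<alpha> n \<le> int m"
            using eventually_ge_at_top[of "nat (Poly_Mapping.lookup \<alpha> n)"]
            by eventually_elim simp
        qed
      qed simp
      then show ?thesis
      proof eventually_elim
        case (elim m)
        have "\<alpha> = box_index d (restrict (Poly_Mapping.lookup \<alpha>) {..<d})"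
          by (rule poly_mapping_eqI) (use \<alpha>(2) in \<open>auto simp: lookup_box_index\<close>)
        moreover have "restrict (Poly_Mapping.lookup \<alpha>) {..<d} \<in> Pi\<^sub>E {..<d} (\<lambda>_. {0..int m})"
          using elim \<alpha>(1) by auto
        ultimately show ?case unfolding S_def by (rule image_eqI)
      qed
    qed
    then have "\<forall>\<^sub>F m in sequentially. \<forall>\<alpha>\<in>X. \<alpha> \<in> S m"
      using X by (intro eventually_ball_finite) auto
    then show "\<forall>\<^sub>F m in sequentially. finite (S m) \<and> X \<subseteq> S m \<and> S m \<subseteq> ?N'"
    proof eventually_elim
      case (elim m)
      have "finite (S m)" unfolding S_def by (intro finite_imageI finite_PiE) auto
      moreover have "S m \<subseteq> ?N'" unfolding S_def by (force simp: lookup_box_index PiE_iff)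
      ultimately show ?case using elim by blast
    qed
  qed
  from filterlim_compose[OF lim this]
  have "(\<lambda>m. \<Sum>\<alpha>\<in>S m. c \<alpha> * monomial \<alpha> z) \<longlonglongrightarrow> F z" .
  then show ?thesis
    by (simp add: S_def sum.reindex[OF inj_on_box_index] monomial_box_index)
qed

text \<open>Multiplying out the partial sums of the \<open>d\<close> kernels and integrating against
  \<open>f\<close> gives Fourier coefficients of \<open>f\<close> over the cube from -m to m.
  Analyticity leaves the indices without negative entries, where \<bar>g n\<bar> = g n and the terms
  are those of the power series of \<open>F\<close>. The uniform bound on the partial sums allows m
  to tend to infinity.\<close>

lemma poisson_prod_representation:
  fixes f F :: "(nat \<Rightarrow> complex) \<Rightarrow> complex"
  assumes f: "integrable torus_measure f"
    and analytic: "\<And>\<gamma>. \<not> (\<forall>n. 0 \<le> Poly_Mapping.lookup \<gamma> n) \<Longrightarrow> fourier_coeff f \<gamma> = 0"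
    and F: "has_monomial_coeffs F (fourier_coeff f)"
    and \<rho>: "\<And>n. n < d \<Longrightarrow> 0 \<le> \<rho> n \<and> \<rho> n < 1" and w: "w \<in> space torus_measure"
  shows "F (\<lambda>n. if n < d then of_real (\<rho> n) * w n else 0)
           = (LINT v|torus_measure. of_real (poisson_prod d \<rho> w v) * f v)"
proof -
  define z where "z n = (if n < d then of_real (\<rho> n) * w n else 0)" for n
  define I where "I m = (LINT v|torus_measure. (\<Prod>n<d. poisson_sum m (\<rho> n) (w n) (v n)) * f v)" for m
  have w1: "cmod (w n) = 1" for n using w by (simp add: space_torus_measure)
  have [measurable]: "f \<in> borel_measurable torus_measure" using f by simp
  have z: "z \<in> polydisc"
    unfolding polydisc_def
  proof (intro CollectI allI)
    fix n show "z n \<in> ball 0 1"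
      using \<rho>[of n] w1[of n] by (cases "n < d") (simp_all add: z_def norm_mult)
  qed
  have "(\<Sum>g\<in>Pi\<^sub>E {..<d} (\<lambda>_. {0..int m}). fourier_coeff f (box_index d g) * (\<Prod>n<d. z n powi g n)) = I m" for m
  proof -
    define t where "t g = (\<Prod>n<d. of_real (\<rho> n ^ nat \<bar>g n\<bar>) * w n powi g n)" for g :: "nat \<Rightarrow> int"
    have int: "integrable torus_measure (\<lambda>v. f v * cnj (monomial (box_index d g) v))" for g
    proof (rule Bochner_Integration.integrable_bound[OF f])
      show "(\<lambda>v. f v * cnj (monomial (box_index d g) v)) \<in> borel_measurable torus_measure"
        unfolding monomial_box_index by measurable
      show "AE v in torus_measure. norm (f v * cnj (monomial (box_index d g) v)) \<le> norm (f v)"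
      proof (rule AE_I2)
        fix v assume "v \<in> space torus_measure"
        then have "cmod (monomial (box_index d g) v) = 1"
          unfolding monomial_box_index prod_norm[symmetric] norm_power_int
          by (simp add: space_torus_measure)
        then show "norm (f v * cnj (monomial (box_index d g) v)) \<le> norm (f v)"
          by (simp add: norm_mult)
      qed
    qed
    have "(\<Prod>n<d. poisson_sum m (\<rho> n) (w n) (v n)) * f v
        = (\<Sum>g\<in>Pi\<^sub>E {..<d} (\<lambda>_. {-int m..int m}). t g * (f v * cnj (monomial (box_index d g) v)))" for v
    proof -
      have "(\<Prod>n<d. poisson_sum m (\<rho> n) (w n) (v n)) = (\<Sum>g\<in>Pi\<^sub>E {..<d} (\<lambda>_. {-int m..int m}).
          \<Prod>n<d. of_real (\<rho> n ^ nat \<bar>g n\<bar>) * w n powi g n * cnj (v n powi g n))"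
        unfolding poisson_sum_def by (rule prod_sum_PiE) auto
      also have "\<dots> = (\<Sum>g\<in>Pi\<^sub>E {..<d} (\<lambda>_. {-int m..int m}). t g * cnj (monomial (box_index d g) v))"
        by (simp add: monomial_box_index t_def prod.distrib)
      finally show ?thesis by (simp add: sum_distrib_right sum_distrib_left mult_ac)
    qed
    then have "I m = (\<Sum>g\<in>Pi\<^sub>E {..<d} (\<lambda>_. {-int m..int m}). t g * fourier_coeff f (box_index d g))"
      using int by (simp add: I_def fourier_coeff_def Bochner_Integration.integral_sum)
    also have "\<dots> = (\<Sum>g\<in>Pi\<^sub>E {..<d} (\<lambda>_. {0..int m}). t g * fourier_coeff f (box_index d g))"
    proof (rule sum.mono_neutral_right)
      show "\<forall>g\<in>Pi\<^sub>E {..<d} (\<lambda>_. {-int m..int m}) - Pi\<^sub>E {..<d} (\<lambda>_. {0..int m}).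
          t g * fourier_coeff f (box_index d g) = 0"
      proof
        fix g assume "g \<in> Pi\<^sub>E {..<d} (\<lambda>_. {-int m..int m}) - Pi\<^sub>E {..<d} (\<lambda>_. {0..int m})"
        then have "\<not> (\<forall>n<d. 0 \<le> g n)" by (auto simp: PiE_iff)
        then obtain n where "n < d" "g n < 0" by (auto simp: not_le)
        then have "\<not> (\<forall>n. 0 \<le> Poly_Mapping.lookup (box_index d g) n)"
          by (auto simp: lookup_box_index not_le intro!: exI[of _ n])
        then show "t g * fourier_coeff f (box_index d g) = 0" using analytic by simp
      qed
    qed (auto intro!: finite_PiE PiE_mono)
    also have "\<dots> = (\<Sum>g\<in>Pi\<^sub>E {..<d} (\<lambda>_. {0..int m}). fourier_coeff f (box_index d g) * (\<Prod>n<d. z n powi g n))"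
    proof (rule sum.cong[OF refl])
      fix g assume g: "g \<in> Pi\<^sub>E {..<d} (\<lambda>_. {0..int m})"
      have "t g = (\<Prod>n<d. z n powi g n)"
        unfolding t_def
      proof (rule prod.cong[OF refl])
        fix n assume "n \<in> {..<d}"
        moreover from this g have "0 \<le> g n" by (auto simp: PiE_iff)
        ultimately show "of_real (\<rho> n ^ nat \<bar>g n\<bar>) * w n powi g n = z n powi g n"
          by (simp add: z_def power_int_def power_mult_distrib)
      qed
      then show "t g * fourier_coeff f (box_index d g) = fourier_coeff f (box_index d g) * (\<Prod>n<d. z n powi g n)"
        by simp
    qed
    finally show ?thesis by simp
  qed
  with box_partial_sums_tendsto[OF F z, of d] have "I \<longlonglongrightarrow> F z" by (simp add: z_def)
  moreover have "I \<longlonglongrightarrow> (LINT v|torus_measure. of_real (poisson_prod d \<rho> w v) * f v)"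
    unfolding I_def[abs_def]
  proof (rule integral_dominated_convergence)
    show "integrable torus_measure (\<lambda>v. (\<Prod>n<d. 2 / (1 - \<rho> n)) * cmod (f v))" using f by simp
    show "AE v in torus_measure. norm ((\<Prod>n<d. poisson_sum m (\<rho> n) (w n) (v n)) * f v)
        \<le> (\<Prod>n<d. 2 / (1 - \<rho> n)) * cmod (f v)" for m
      unfolding norm_mult prod_norm[symmetric]
      using \<rho> w1 by (intro AE_I2 mult_right_mono prod_mono) (auto simp: space_torus_measure poisson_sum_bound)
    show "AE v in torus_measure. (\<lambda>m. (\<Prod>n<d. poisson_sum m (\<rho> n) (w n) (v n)) * f v)
        \<longlonglongrightarrow> of_real (poisson_prod d \<rho> w v) * f v"
      unfolding poisson_prod_def of_real_prod
      using \<rho> w1 by (intro AE_I2 tendsto_intros tendsto_prod poisson_sum_tendsto) (auto simp: space_torus_measure)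
  qed (use w in measurable)
  ultimately show ?thesis unfolding z_def[abs_def] by (rule LIMSEQ_unique)
qed

section \<open>Density of Lipschitz cylinder functions\<close>

text \<open>The finite sum on the right forces \<open>G\<close> to depend, on the torus, on the
  first \<open>d\<close> coordinates alone; it is the shape that
  \<open>poisson_prod_lipschitz_bound\<close> consumes. The codomain is general to serve real
  approximations of indicators as well as complex functions.\<close>

definition lip_cylinder :: "((nat \<Rightarrow> complex) \<Rightarrow> 'b::real_normed_vector) \<Rightarrow> bool" where
  "lip_cylinder G \<longleftrightarrow> G \<in> borel_measurable torus_measure \<and>
     (\<exists>d L. 0 \<le> L \<and> (\<forall>w\<in>space torus_measure. \<forall>v\<in>space torus_measure.
        norm (G v - G w) \<le> L * (\<Sum>n<d. cmod (w n - v n))))"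

lemma lip_cylinder_measurable: "lip_cylinder G \<Longrightarrow> G \<in> borel_measurable torus_measure"
  by (simp add: lip_cylinder_def)

text \<open>One closure rule for sums, maxima, scalar multiples and clamping. Unary operations are
  covered by passing the same function twice with \<open>b = 0\<close>.\<close>

lemma lip_cylinder_combine:
  assumes G: "lip_cylinder G" and H: "lip_cylinder H" and K: "K \<in> borel_measurable torus_measure"
    and le: "\<And>w v. norm (K v - K w) \<le> a * norm (G v - G w) + b * norm (H v - H w)"
    and ab: "0 \<le> a" "0 \<le> b"
  shows "lip_cylinder K"
proof -
  obtain d1 L1 where 1: "0 \<le> L1" "\<And>w v. w \<in> space torus_measure \<Longrightarrow> v \<in> space torus_measure \<Longrightarrow>
       norm (G v - G w) \<le> L1 * (\<Sum>n<d1. cmod (w n - v n))" using G unfolding lip_cylinder_def by blast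
  obtain d2 L2 where 2: "0 \<le> L2" "\<And>w v. w \<in> space torus_measure \<Longrightarrow> v \<in> space torus_measure \<Longrightarrow>
       norm (H v - H w) \<le> L2 * (\<Sum>n<d2. cmod (w n - v n))" using H unfolding lip_cylinder_def by blast
  define d where "d = max d1 d2"
  have "norm (K v - K w) \<le> (a * L1 + b * L2) * (\<Sum>n<d. cmod (w n - v n))"
    if w: "w \<in> space torus_measure" and v: "v \<in> space torus_measure" for w v
  proof -
    have s: "(\<Sum>n<d1. cmod (w n - v n)) \<le> (\<Sum>n<d. cmod (w n - v n))"
      "(\<Sum>n<d2. cmod (w n - v n)) \<le> (\<Sum>n<d. cmod (w n - v n))"
      by (auto simp: d_def intro!: sum_mono2)
    have "norm (G v - G w) \<le> L1 * (\<Sum>n<d. cmod (w n - v n))"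
      using 1(2)[OF w v] mult_left_mono[OF s(1) 1(1)] by linarith
    moreover have "norm (H v - H w) \<le> L2 * (\<Sum>n<d. cmod (w n - v n))"
      using 2(2)[OF w v] mult_left_mono[OF s(2) 2(1)] by linarith
    ultimately have "a * norm (G v - G w) + b * norm (H v - H w)
        \<le> a * (L1 * (\<Sum>n<d. cmod (w n - v n))) + b * (L2 * (\<Sum>n<d. cmod (w n - v n)))"
      using ab by (intro add_mono mult_left_mono) auto
    with le[of v w] show ?thesis by (simp add: algebra_simps)
  qed
  moreover have "0 \<le> a * L1 + b * L2" using ab 1(1) 2(1) by simp
  ultimately show ?thesis unfolding lip_cylinder_def using K by blast
qed

lemma lip_cylinder_const: "lip_cylinder (\<lambda>_. c)"
  unfolding lip_cylinder_def by (auto intro!: exI[of _ 0])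

lemma lip_cylinder_bounded:
  assumes "lip_cylinder G"
  obtains B where "\<And>w. w \<in> space torus_measure \<Longrightarrow> norm (G w) \<le> B"
proof -
  obtain d L where L: "0 \<le> L" "\<And>w v. w \<in> space torus_measure \<Longrightarrow> v \<in> space torus_measure \<Longrightarrow>
       norm (G v - G w) \<le> L * (\<Sum>n<d. cmod (w n - v n))" using assms unfolding lip_cylinder_def by blast
  let ?o = "\<lambda>_. 1 :: complex"
  have o: "?o \<in> space torus_measure" by (simp add: space_torus_measure)
  have "norm (G w) \<le> norm (G ?o) + L * (\<Sum>n<d. 2)" if w: "w \<in> space torus_measure" for w
  proof -
    have "(\<Sum>n<d. cmod (1 - w n)) \<le> (\<Sum>n<d. 2)"
    proof (rule sum_mono)
      fix n
      have "cmod (w n) = 1" using w by (simp add: space_torus_measure)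
      then show "cmod (1 - w n) \<le> 2" using norm_triangle_ineq4[of 1 "w n"] by simp
    qed
    then have "L * (\<Sum>n<d. cmod (1 - w n)) \<le> L * (\<Sum>n<d. 2)" using L(1) by (rule mult_left_mono)
    with L(2)[OF o w] norm_triangle_sub[of "G w" "G ?o"] show ?thesis by linarith
  qed
  then show ?thesis by (rule that)
qed

lemma lip_cylinder_integrable:
  fixes G :: "(nat \<Rightarrow> complex) \<Rightarrow> 'b::{banach, second_countable_topology}"
  assumes "lip_cylinder G"
  shows "integrable torus_measure G"
proof -
  obtain B where "\<And>w. w \<in> space torus_measure \<Longrightarrow> norm (G w) \<le> B"
    using lip_cylinder_bounded[OF assms] by blast
  then show ?thesis
    using lip_cylinder_measurable[OF assms]
    by (intro torus.integrable_const_bound[of _ B]) (auto intro!: AE_I2)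
qed

text \<open>A property of sets, so that density can be proved by induction over the generation of
  the product sigma-algebra.\<close>

definition lip_approximable :: "(nat \<Rightarrow> complex) set \<Rightarrow> bool" where
  "lip_approximable A \<longleftrightarrow> (\<forall>\<epsilon>>0. \<exists>G :: (nat \<Rightarrow> complex) \<Rightarrow> real. lip_cylinder G \<and>
     (LINT w|torus_measure. \<bar>indicator A w - G w\<bar>) < \<epsilon>)"

lemma lip_approximableD:
  assumes "lip_approximable A" "0 < \<epsilon>"
  obtains G :: "(nat \<Rightarrow> complex) \<Rightarrow> real" where
    "lip_cylinder G" "(LINT w|torus_measure. \<bar>indicator A w - G w\<bar>) < \<epsilon>"
  using assms unfolding lip_approximable_def by blast

lemma integrable_indicator_diff:
  fixes G :: "(nat \<Rightarrow> complex) \<Rightarrow> real"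
  assumes "lip_cylinder G" "A \<in> sets torus_measure"
  shows "integrable torus_measure (\<lambda>w. \<bar>indicator A w - G w\<bar>)"
  using lip_cylinder_integrable[OF assms(1)] assms(2)
  by (intro integrable_abs Bochner_Integration.integrable_diff integrable_real_indicator)
     (auto simp: less_top[symmetric])

lemma lip_approximable_compl:
  assumes A: "lip_approximable A" and [measurable]: "A \<in> sets torus_measure"
  shows "lip_approximable (space torus_measure - A)"
  unfolding lip_approximable_def
proof (intro allI impI)
  fix \<epsilon> :: real assume "0 < \<epsilon>"
  then obtain G :: "(nat \<Rightarrow> complex) \<Rightarrow> real" where G: "lip_cylinder G"
      "(LINT w|torus_measure. \<bar>indicator A w - G w\<bar>) < \<epsilon>"
    using lip_approximableD[OF A] by blast
  note [measurable] = lip_cylinder_measurable[OF G(1)]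
  have "lip_cylinder (\<lambda>w. 1 - G w)"
    by (rule lip_cylinder_combine[OF G(1) G(1), of _ 1 0]) auto
  moreover have "(LINT w|torus_measure. \<bar>indicator (space torus_measure - A) w - (1 - G w)\<bar>)
      = (LINT w|torus_measure. \<bar>indicator A w - G w\<bar>)"
    by (intro Bochner_Integration.integral_cong) (auto simp: indicator_def)
  ultimately show "\<exists>G :: (nat \<Rightarrow> complex) \<Rightarrow> real. lip_cylinder G \<and>
     (LINT w|torus_measure. \<bar>indicator (space torus_measure - A) w - G w\<bar>) < \<epsilon>"
    using G(2) by auto
qed

text \<open>The indicator of a union is the maximum of the indicators, and the error of a maximum is
  at most the sum of the two errors.\<close>

lemma lip_approximable_Un:
  assumes A: "lip_approximable A" "A \<in> sets torus_measure"
    and B: "lip_approximable B" "B \<in> sets torus_measure"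
  shows "lip_approximable (A \<union> B)"
  unfolding lip_approximable_def
proof (intro allI impI)
  fix \<epsilon> :: real assume "0 < \<epsilon>"
  then have e: "0 < \<epsilon> / 2" by simp
  obtain G :: "(nat \<Rightarrow> complex) \<Rightarrow> real" where G: "lip_cylinder G"
      "(LINT w|torus_measure. \<bar>indicator A w - G w\<bar>) < \<epsilon> / 2"
    using lip_approximableD[OF A(1) e] by blast
  obtain H :: "(nat \<Rightarrow> complex) \<Rightarrow> real" where H: "lip_cylinder H"
      "(LINT w|torus_measure. \<bar>indicator B w - H w\<bar>) < \<epsilon> / 2"
    using lip_approximableD[OF B(1) e] by blast
  note [measurable] = lip_cylinder_measurable[OF G(1)] lip_cylinder_measurable[OF H(1)]
  have K: "lip_cylinder (\<lambda>w. max (G w) (H w))"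
    by (rule lip_cylinder_combine[OF G(1) H(1), of _ 1 1]) auto
  have "(LINT w|torus_measure. \<bar>indicator (A \<union> B) w - max (G w) (H w)\<bar>)
      \<le> (LINT w|torus_measure. \<bar>indicator A w - G w\<bar> + \<bar>indicator B w - H w\<bar>)"
    using integrable_indicator_diff[OF K sets.Un[OF A(2) B(2)]]
      integrable_indicator_diff[OF G(1) A(2)] integrable_indicator_diff[OF H(1) B(2)]
    by (intro integral_mono) (auto simp: indicator_def)
  also have "\<dots> < \<epsilon>"
    using integrable_indicator_diff[OF G(1) A(2)] integrable_indicator_diff[OF H(1) B(2)] G(2) H(2)
    by simp
  finally show "\<exists>G :: (nat \<Rightarrow> complex) \<Rightarrow> real. lip_cylinder G \<and>
     (LINT w|torus_measure. \<bar>indicator (A \<union> B) w - G w\<bar>) < \<epsilon>"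
    using K by blast
qed

lemma lip_approximable_limit:
  assumes A: "\<And>i. lip_approximable (A i)" "\<And>i. A i \<in> sets torus_measure" and B: "B \<in> sets torus_measure"
    and lim: "\<And>w. w \<in> space torus_measure \<Longrightarrow> (\<lambda>i. indicator (A i) w :: real) \<longlonglongrightarrow> indicator B w"
  shows "lip_approximable B"
  unfolding lip_approximable_def
proof (intro allI impI)
  fix \<epsilon> :: real assume \<epsilon>: "0 < \<epsilon>"
  note [measurable] = A(2) B
  have "(\<lambda>i. LINT w|torus_measure. \<bar>indicator B w - indicator (A i) w\<bar> :: real)
      \<longlonglongrightarrow> (LINT w|torus_measure. 0)"
  proof (rule integral_dominated_convergence[where w = "\<lambda>_. 1"])
    show "AE w in torus_measure. (\<lambda>i. \<bar>indicator B w - indicator (A i) w\<bar> :: real) \<longlonglongrightarrow> 0"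
    proof (intro AE_I2)
      fix w assume "w \<in> space torus_measure"
      from tendsto_rabs[OF tendsto_diff[OF tendsto_const lim[OF this], of "indicator B w"]]
      show "(\<lambda>i. \<bar>indicator B w - indicator (A i) w\<bar> :: real) \<longlonglongrightarrow> 0" by simp
    qed
  qed (auto intro!: AE_I2 simp: indicator_def)
  then have "(\<lambda>i. LINT w|torus_measure. \<bar>indicator B w - indicator (A i) w\<bar> :: real) \<longlonglongrightarrow> 0" by simp
  from order_tendstoD(2)[OF this, of "\<epsilon> / 2"] \<epsilon>
  obtain i where i: "(LINT w|torus_measure. \<bar>indicator B w - indicator (A i) w\<bar> :: real) < \<epsilon> / 2"
    by (auto simp: eventually_sequentially)
  obtain G :: "(nat \<Rightarrow> complex) \<Rightarrow> real" where G: "lip_cylinder G"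
      "(LINT w|torus_measure. \<bar>indicator (A i) w - G w\<bar>) < \<epsilon> / 2"
    using lip_approximableD[OF A(1), of "\<epsilon> / 2" i] \<epsilon> by auto
  have int: "integrable torus_measure (\<lambda>w. \<bar>indicator B w - indicator (A i) w\<bar> :: real)"
    by (rule torus.integrable_of_bounded[of _ 1]) (measurable, auto simp: indicator_def)
  have "(LINT w|torus_measure. \<bar>indicator B w - G w\<bar>)
      \<le> (LINT w|torus_measure. \<bar>indicator B w - indicator (A i) w\<bar> + \<bar>indicator (A i) w - G w\<bar>)"
    using int integrable_indicator_diff[OF G(1) B] integrable_indicator_diff[OF G(1) A(2)[of i]]
    by (intro integral_mono) auto
  also have "\<dots> < \<epsilon>" using int integrable_indicator_diff[OF G(1) A(2)[of i]] G(2) i by simp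
  finally show "\<exists>G :: (nat \<Rightarrow> complex) \<Rightarrow> real. lip_cylinder G \<and>
     (LINT w|torus_measure. \<bar>indicator B w - G w\<bar>) < \<epsilon>"
    using G(1) by blast
qed

lemma lip_approximable_empty: "lip_approximable {}"
  unfolding lip_approximable_def by (auto intro!: exI[of _ "\<lambda>_. 0"] lip_cylinder_const)

lemma lip_approximable_UN:
  assumes A: "\<And>i::nat. lip_approximable (A i)" "\<And>i. A i \<in> sets torus_measure"
  shows "lip_approximable (\<Union>i. A i)"
proof (rule lip_approximable_limit[of "\<lambda>k. \<Union>i<k. A i"])
  show "lip_approximable (\<Union>i<k. A i)" for k
  proof (induction k)
    case (Suc k)
    have "(\<Union>i<Suc k. A i) = (\<Union>i<k. A i) \<union> A k" by (auto simp: lessThan_Suc)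
    then show ?case using lip_approximable_Un[OF Suc _ A(1) A(2)] A(2) by auto
  qed (simp add: lip_approximable_empty)
  show "(\<lambda>k. indicator (\<Union>i<k. A i) w :: real) \<longlonglongrightarrow> indicator (\<Union>i. A i) w" for w
    by (rule LIMSEQ_indicator_UN)
qed (use A in auto)

text \<open>The Lipschitz functions min(1, k dist(w_n, -U)) increase to the indicator as k grows,
  because an open set is where the distance to its complement is positive.\<close>

lemma lip_approximable_open_cylinder:
  assumes U: "open (U :: complex set)"
  shows "lip_approximable {w \<in> space torus_measure. w n \<in> U}"
\<comment> \<open>\<open>infdist\<close> to the empty set is 0 by convention, so for
  \<open>U = UNIV\<close> the approximating functions would all vanish.\<close>
proof (cases "U = UNIV")
  case True
  then have "{w \<in> space torus_measure. w n \<in> U} = space torus_measure - {}" by auto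
  then show ?thesis using lip_approximable_compl[OF lip_approximable_empty] by simp
next
  case False
  let ?A = "{w \<in> space torus_measure. w n \<in> U}"
  have [measurable]: "U \<in> sets borel" using U by simp
  have A [measurable]: "?A \<in> sets torus_measure" by measurable
  define G where "G k w = min 1 (real k * infdist (w n) (- U))" for k :: nat and w
  have [measurable]: "(\<lambda>z. infdist z (- U)) \<in> borel_measurable borel"
    by (intro borel_measurable_continuous_onI continuous_intros)
  have [measurable]: "G k \<in> borel_measurable torus_measure" for k
    unfolding G_def[abs_def] by measurable
  have G: "lip_cylinder (G k)" for k
    unfolding lip_cylinder_def
  proof (intro conjI exI ballI)
    fix w v :: "nat \<Rightarrow> complex"
    have "norm (G k v - G k w) \<le> \<bar>real k * infdist (w n) (- U) - real k * infdist (v n) (- U)\<bar>"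
      unfolding G_def by (simp add: min_def abs_real_def)
    also have "\<dots> = real k * \<bar>infdist (w n) (- U) - infdist (v n) (- U)\<bar>"
      by (simp add: abs_mult flip: right_diff_distrib)
    also have "\<dots> \<le> real k * cmod (w n - v n)"
      using infdist_triangle_abs[of "w n" "- U" "v n"] by (intro mult_left_mono) (auto simp: dist_norm)
    also have "\<dots> \<le> real k * (\<Sum>n<Suc n. cmod (w n - v n))"
      by (intro mult_left_mono member_le_sum) auto
    finally show "norm (G k v - G k w) \<le> real k * (\<Sum>n<Suc n. cmod (w n - v n))" .
  qed auto
  have "(\<lambda>k. LINT w|torus_measure. \<bar>indicator ?A w - G k w\<bar>) \<longlonglongrightarrow> (LINT w|torus_measure. 0)"
  proof (rule integral_dominated_convergence[where w = "\<lambda>_. 1"])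
    show "AE w in torus_measure. (\<lambda>k. \<bar>indicator ?A w - G k w\<bar>) \<longlonglongrightarrow> 0"
    proof (intro AE_I2)
      fix w assume w: "w \<in> space torus_measure"
      have "\<forall>\<^sub>F k in sequentially. \<bar>indicator ?A w - G k w\<bar> = 0"
      proof (cases "w n \<in> U")
        case True
        have "infdist (w n) (- U) \<noteq> 0"
          using in_closed_iff_infdist_zero[of "- U" "w n"] U False True by auto
        then have pos: "0 < infdist (w n) (- U)" using infdist_nonneg[of "w n" "- U"] by linarith
        obtain k0 :: nat where k0: "1 / infdist (w n) (- U) \<le> real k0" using real_arch_simple by blast
        show ?thesis using eventually_ge_at_top[of k0]
        proof eventually_elim
          case (elim k)
          then have "1 / infdist (w n) (- U) \<le> real k" using k0 by linarith
          then have "1 \<le> real k * infdist (w n) (- U)" using pos by (simp add: divide_le_eq)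
          then show ?case using True w by (simp add: G_def)
        qed
      next
        case False
        then have "infdist (w n) (- U) = 0" by (simp add: infdist_zero)
        then show ?thesis using False by (simp add: G_def)
      qed
      then show "(\<lambda>k. \<bar>indicator ?A w - G k w\<bar>) \<longlonglongrightarrow> 0"
        by (rule tendsto_eventually)
    qed
    show "AE w in torus_measure. norm \<bar>indicator ?A w - G k w\<bar> \<le> 1" for k
    proof (intro AE_I2)
      fix w
      have "0 \<le> G k w" "G k w \<le> 1" by (auto simp: G_def infdist_nonneg)
      then show "norm \<bar>indicator ?A w - G k w\<bar> \<le> 1" by (auto simp: indicator_def)
    qed
  qed auto
  then have lim: "(\<lambda>k. LINT w|torus_measure. \<bar>indicator ?A w - G k w\<bar>) \<longlonglongrightarrow> 0" by simp
  show ?thesis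
    unfolding lip_approximable_def
  proof (intro allI impI)
    fix \<epsilon> :: real assume "0 < \<epsilon>"
    from order_tendstoD(2)[OF lim this] obtain k where
      "(LINT w|torus_measure. \<bar>indicator ?A w - G k w\<bar>) < \<epsilon>"
      by (auto simp: eventually_sequentially)
    then show "\<exists>G :: (nat \<Rightarrow> complex) \<Rightarrow> real. lip_cylinder G \<and>
       (LINT w|torus_measure. \<bar>indicator ?A w - G w\<bar>) < \<epsilon>" using G by blast
  qed
qed

lemma lip_approximable_borel_cylinder:
  assumes "B \<in> sets (borel :: complex measure)"
  shows "lip_approximable {w \<in> space torus_measure. w n \<in> B}"
proof -
  have "B \<in> sigma_sets UNIV {S. open S}" using assms by (simp add: borel_def)
  then show ?thesis
  proof induction
    case (Basic U)
    then show ?case by (simp add: lip_approximable_open_cylinder)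
  next
    case Empty
    then show ?case by (simp add: lip_approximable_empty)
  next
    case (Compl B)
    then have [measurable]: "B \<in> sets borel" by (simp add: borel_def)
    have "{w \<in> space torus_measure. w n \<in> UNIV - B} = space torus_measure - {w \<in> space torus_measure. w n \<in> B}"
      by auto
    then show ?case using lip_approximable_compl[OF Compl.IH] by simp
  next
    case (Union B)
    then have [measurable]: "B i \<in> sets borel" for i by (simp add: borel_def)
    have "{w \<in> space torus_measure. w n \<in> (\<Union>i. B i)} = (\<Union>i. {w \<in> space torus_measure. w n \<in> B i})"
      by auto
    then show ?case using lip_approximable_UN[OF Union.IH] by simp
  qed
qed

text \<open>Sets constraining a single coordinate generate the product sigma-algebra.
  Approximability is closed under complements and arbitrary countable unions, so plain induction
  over the generation suffices, without an intersection-stable generator.\<close>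

lemma lip_approximable_sets:
  assumes "A \<in> sets torus_measure"
  shows "lip_approximable A"
proof -
  let ?S = "{{f \<in> \<Pi>\<^sub>E i\<in>UNIV. space circle_measure. f i \<in> A} |i A. i \<in> (UNIV::nat set) \<and> A \<in> sets circle_measure}"
  have sp: "(\<Pi>\<^sub>E i\<in>UNIV. space circle_measure) = space torus_measure"
    by (simp add: torus_measure_def space_PiM)
  have eq: "sets torus_measure = sigma_sets (\<Pi>\<^sub>E i\<in>UNIV. space circle_measure) ?S"
    unfolding torus_measure_def by (rule sets_PiM_single)
  have "A \<in> sigma_sets (\<Pi>\<^sub>E i\<in>UNIV. space circle_measure) ?S" using assms eq by simp
  then show ?thesis
  proof induction
    case (Basic A)
    then obtain i C where C: "C \<in> sets circle_measure" "A = {w \<in> space torus_measure. w i \<in> C}"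
      unfolding sp by auto
    then obtain B where B: "B \<in> sets borel" "C = sphere 0 1 \<inter> B"
      by (auto simp: sets_restrict_space)
    have "A = {w \<in> space torus_measure. w i \<in> B}"
      using C(2) B(2) by (auto simp: space_torus_measure)
    then show ?case using lip_approximable_borel_cylinder[OF B(1)] by simp
  next
    case Empty
    then show ?case by (rule lip_approximable_empty)
  next
    case (Compl B)
    then have "B \<in> sets torus_measure" unfolding eq by simp
    then show ?case unfolding sp using lip_approximable_compl[OF Compl.IH] by blast
  next
    case (Union B)
    then have "\<And>i. B i \<in> sets torus_measure" unfolding eq by simp
    with Union.IH show ?case by (rule lip_approximable_UN)
  qed
qed


lemma lip_cylinder_L1_dense:
  fixes f :: "(nat \<Rightarrow> complex) \<Rightarrow> complex"
  assumes "integrable torus_measure f" "0 < \<epsilon>"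
  shows "\<exists>G :: (nat \<Rightarrow> complex) \<Rightarrow> complex. lip_cylinder G \<and> (LINT w|torus_measure. cmod (f w - G w)) < \<epsilon>"
  using assms
proof (induction f arbitrary: \<epsilon> rule: integrable_induct)
  case (base A c)
  then have A: "lip_approximable A" by (intro lip_approximable_sets) simp
  \<comment> \<open>The added 1 covers the coefficient \<open>c = 0\<close>.\<close>
  have "0 < \<epsilon> / (cmod c + 1)" using base by (simp add: add_nonneg_pos)
  from lip_approximableD[OF A this] obtain g :: "(nat \<Rightarrow> complex) \<Rightarrow> real" where g: "lip_cylinder g"
    "(LINT w|torus_measure. \<bar>indicator A w - g w\<bar>) < \<epsilon> / (cmod c + 1)" by blast
  note [measurable] = lip_cylinder_measurable[OF g(1)]
  have "lip_cylinder (\<lambda>w. g w *\<^sub>R c)"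
    by (rule lip_cylinder_combine[OF g(1) g(1), of _ "cmod c" 0])
       (auto simp flip: scaleR_diff_left)
  moreover have "(LINT w|torus_measure. cmod (indicator A w *\<^sub>R c - g w *\<^sub>R c))
      = (LINT w|torus_measure. \<bar>indicator A w - g w\<bar>) * cmod c"
    by (simp flip: scaleR_diff_left)
  moreover have "(LINT w|torus_measure. \<bar>indicator A w - g w\<bar>) * cmod c < \<epsilon>"
  proof -
    have "0 \<le> (LINT w|torus_measure. \<bar>indicator A w - g w\<bar>)" by simp
    then have "(LINT w|torus_measure. \<bar>indicator A w - g w\<bar>) * cmod c
        \<le> (LINT w|torus_measure. \<bar>indicator A w - g w\<bar>) * (cmod c + 1)"
      by (intro mult_left_mono) auto
    also have "\<dots> < \<epsilon>" using g(2) by (simp add: pos_less_divide_eq add_nonneg_pos)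
    finally show ?thesis .
  qed
  ultimately show ?case by (intro exI[of _ "\<lambda>w. g w *\<^sub>R c"]) simp
next
  case (add f g)
  then have "0 < \<epsilon> / 2" by simp
  with add.IH obtain G H :: "(nat \<Rightarrow> complex) \<Rightarrow> complex" where
    G: "lip_cylinder G" "(LINT w|torus_measure. cmod (f w - G w)) < \<epsilon> / 2" and
    H: "lip_cylinder H" "(LINT w|torus_measure. cmod (g w - H w)) < \<epsilon> / 2"
    by meson
  note [measurable] = lip_cylinder_measurable[OF G(1)] lip_cylinder_measurable[OF H(1)]
  have K: "lip_cylinder (\<lambda>w. G w + H w)"
    by (rule lip_cylinder_combine[OF G(1) H(1), of _ 1 1]) (auto intro: norm_diff_triangle_ineq)
  have int: "integrable torus_measure (\<lambda>w. cmod (f w - G w))" "integrable torus_measure (\<lambda>w. cmod (g w - H w))"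
    using add.hyps lip_cylinder_integrable[OF G(1)] lip_cylinder_integrable[OF H(1)] by auto
  have "(LINT w|torus_measure. cmod (f w + g w - (G w + H w)))
      \<le> (LINT w|torus_measure. cmod (f w - G w) + cmod (g w - H w))"
  proof (intro integral_mono)
    show "integrable torus_measure (\<lambda>w. cmod (f w + g w - (G w + H w)))"
      using add.hyps lip_cylinder_integrable[OF K] by auto
    show "cmod (f w + g w - (G w + H w)) \<le> cmod (f w - G w) + cmod (g w - H w)" for w
      by (rule norm_diff_triangle_ineq)
  qed (use int in auto)
  also have "\<dots> < \<epsilon>" using int G(2) H(2) by simp
  finally show ?case using K by blast
next
  case (lim f s)
  have "(\<lambda>i. LINT w|torus_measure. cmod (f w - s i w)) \<longlonglongrightarrow> (LINT w|torus_measure. 0)"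
  proof (rule integral_dominated_convergence[where w = "\<lambda>w. 3 * cmod (f w)"])
    show "AE w in torus_measure. (\<lambda>i. cmod (f w - s i w)) \<longlonglongrightarrow> 0"
    proof (intro AE_I2)
      fix w assume "w \<in> space torus_measure"
      from tendsto_norm[OF tendsto_diff[OF tendsto_const lim.hyps(2)[OF this], of "f w"]]
      show "(\<lambda>i. cmod (f w - s i w)) \<longlonglongrightarrow> 0" by simp
    qed
    show "AE w in torus_measure. norm (cmod (f w - s i w)) \<le> 3 * cmod (f w)" for i
    proof (intro AE_I2)
      fix w assume "w \<in> space torus_measure"
      from lim.hyps(3)[OF this, of i] norm_triangle_ineq4[of "f w" "s i w"]
      show "norm (cmod (f w - s i w)) \<le> 3 * cmod (f w)" by simp
    qed
  qed (use lim.hyps(1) lim.hyps(4) in \<open>auto intro!: borel_measurable_norm borel_measurable_diff\<close>)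
  then have "(\<lambda>i. LINT w|torus_measure. cmod (f w - s i w)) \<longlonglongrightarrow> 0" by simp
  from order_tendstoD(2)[OF this, of "\<epsilon> / 2"] lim.prems
  obtain i where i: "(LINT w|torus_measure. cmod (f w - s i w)) < \<epsilon> / 2"
    by (auto simp: eventually_sequentially)
  obtain G :: "(nat \<Rightarrow> complex) \<Rightarrow> complex" where
    G: "lip_cylinder G" "(LINT w|torus_measure. cmod (s i w - G w)) < \<epsilon> / 2"
    using lim.IH[of "\<epsilon> / 2" i] lim.prems by auto
  have int: "integrable torus_measure (\<lambda>w. cmod (f w - s i w))"
    "integrable torus_measure (\<lambda>w. cmod (s i w - G w))"
    using lim.hyps(1)[of i] lim.hyps(4) lip_cylinder_integrable[OF G(1)] by auto
  have "(LINT w|torus_measure. cmod (f w - G w))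
      \<le> (LINT w|torus_measure. cmod (f w - s i w) + cmod (s i w - G w))"
    using int lim.hyps(4) lip_cylinder_integrable[OF G(1)]
    by (intro integral_mono) (auto intro: order.trans[OF _ norm_triangle_ineq])
  also have "\<dots> < \<epsilon>" using int G(2) i by simp
  finally show ?case using G(1) by blast
qed

section \<open>From density in L^1 to density in L^q by truncation\<close>

definition box_clamp :: "real \<Rightarrow> complex \<Rightarrow> complex" where
  "box_clamp B z = Complex (max (- B) (min B (Re z))) (max (- B) (min B (Im z)))"

text \<open>Clamping real and imaginary part separately reduces to the contraction property of real
  min and max; the factor 2 comes from passing between the modulus and the two parts.\<close>

lemma box_clamp_lipschitz: "cmod (box_clamp B z - box_clamp B u) \<le> 2 * cmod (z - u)"
proof -
  have "cmod (box_clamp B z - box_clamp B u) \<le> \<bar>Re (z - u)\<bar> + \<bar>Im (z - u)\<bar>"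
    by (rule order.trans[OF cmod_le]) (auto simp: box_clamp_def intro!: add_mono)
  also have "\<dots> \<le> 2 * cmod (z - u)"
    using abs_Re_le_cmod[of "z - u"] abs_Im_le_cmod[of "z - u"] by linarith
  finally show ?thesis .
qed

lemma box_clamp_bound: "0 \<le> B \<Longrightarrow> cmod (box_clamp B z) \<le> 2 * B"
  by (rule order.trans[OF cmod_le]) (auto simp: box_clamp_def)

lemma box_clamp_id: "cmod z \<le> B \<Longrightarrow> box_clamp B z = z"
  using abs_Re_le_cmod[of z] abs_Im_le_cmod[of z] by (auto simp: box_clamp_def complex_eq_iff)

lemma powr_add_le:
  fixes x y q :: real
  assumes "0 \<le> x" "0 \<le> y" "0 \<le> q"
  shows "(x + y) powr q \<le> 2 powr q * (x powr q + y powr q)"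
proof -
  have "(x + y) powr q \<le> (2 * max x y) powr q" using assms by (intro powr_mono2) auto
  also have "\<dots> = 2 powr q * max x y powr q" using assms by (simp add: powr_mult)
  also have "\<dots> \<le> 2 powr q * (x powr q + y powr q)"
    by (intro mult_left_mono) (auto simp: max_def)
  finally show ?thesis .
qed

text \<open>\<open>f\<close> is cut off to a function \<open>h k\<close> bounded by k, which is
  approximated in L^1 by \<open>G0\<close>. Clamping \<open>G0\<close> fixes \<open>h k\<close> and
  bounds the difference by 3k, so its q-th power is at most (3k)^(q-1) times its modulus: for
  bounded functions L^1 closeness yields L^q closeness.\<close>

theorem lip_cylinder_Lq_dense:
  fixes f :: "(nat \<Rightarrow> complex) \<Rightarrow> complex"
  assumes [measurable]: "f \<in> borel_measurable torus_measure"
    and fq: "integrable torus_measure (\<lambda>w. cmod (f w) powr q)" and q: "1 \<le> q" and \<epsilon>: "0 < \<epsilon>"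
  obtains G :: "(nat \<Rightarrow> complex) \<Rightarrow> complex" where "lip_cylinder G"
    "integrable torus_measure (\<lambda>w. cmod (f w - G w) powr q)"
    "(LINT w|torus_measure. cmod (f w - G w) powr q) < \<epsilon>"
proof -
  \<comment> \<open>Two errors below \<open>\<delta>\<close> are added by (x + y)^q \<le> 2^q (x^q +
    y^q).\<close>
  define \<delta> where "\<delta> = \<epsilon> / (2 * 2 powr q)"
  have \<delta>: "0 < \<delta>" using \<epsilon> by (simp add: \<delta>_def)
  define h where "h k w = (if cmod (f w) \<le> real k then f w else 0)" for k :: nat and w
  have [measurable]: "h k \<in> borel_measurable torus_measure" for k unfolding h_def[abs_def] by measurable
  have dom: "cmod (f w - h k w) powr q \<le> cmod (f w) powr q" for k w
    using q by (intro powr_mono2) (auto simp: h_def)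
  have "(\<lambda>k. LINT w|torus_measure. cmod (f w - h k w) powr q) \<longlonglongrightarrow> (LINT w|torus_measure. 0)"
  proof (rule integral_dominated_convergence[OF _ _ fq])
    show "AE w in torus_measure. (\<lambda>k. cmod (f w - h k w) powr q) \<longlonglongrightarrow> 0"
    proof (intro AE_I2 tendsto_eventually)
      fix w
      obtain k0 :: nat where k0: "cmod (f w) \<le> real k0" using real_arch_simple by blast
      show "\<forall>\<^sub>F k in sequentially. cmod (f w - h k w) powr q = 0"
        using eventually_ge_at_top[of k0] by eventually_elim (use k0 in \<open>simp add: h_def\<close>)
    qed
  qed (use dom in auto)
  then have "(\<lambda>k. LINT w|torus_measure. cmod (f w - h k w) powr q) \<longlonglongrightarrow> 0" by simp
  from order_tendstoD(2)[OF this \<delta>] obtain k where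
    k: "(LINT w|torus_measure. cmod (f w - h k w) powr q) < \<delta>" by (auto simp: eventually_sequentially)
  have h_le: "cmod (h k w) \<le> real k" for w by (simp add: h_def)
  have int_h: "integrable torus_measure (h k)"
    using h_le by (intro torus.integrable_const_bound[of _ "real k"]) auto
  \<comment> \<open>\<open>C\<close> is 0 when the cut-off level is 0, which explains the 1 added to
    \<open>2 * C\<close> below.\<close>
  define C where "C = (3 * real k) powr (q - 1)"
  have "0 < \<delta> / (2 * C + 1)" using \<delta> by (simp add: C_def add_nonneg_pos)
  from lip_cylinder_L1_dense[OF int_h this] obtain G0 :: "(nat \<Rightarrow> complex) \<Rightarrow> complex" where
    G0: "lip_cylinder G0" "(LINT w|torus_measure. cmod (h k w - G0 w)) < \<delta> / (2 * C + 1)" by blast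
  define G where "G w = box_clamp (real k) (G0 w)" for w
  have [measurable]: "box_clamp B \<in> borel_measurable borel" for B
    by (rule borel_measurable_continuous_onI) (auto simp: box_clamp_def[abs_def] Complex_eq intro!: continuous_intros)
  note [measurable] = lip_cylinder_measurable[OF G0(1)]
  have G: "lip_cylinder G"
    by (rule lip_cylinder_combine[OF G0(1) G0(1), of _ 2 0])
       (auto simp: G_def[abs_def] intro: box_clamp_lipschitz)
  note [measurable] = lip_cylinder_measurable[OF G]
  have hG: "cmod (h k w - G w) powr q \<le> C * (2 * cmod (h k w - G0 w))" for w
  proof -
    have "cmod (h k w - G w) \<le> cmod (h k w) + cmod (G w)" by (rule norm_triangle_ineq4)
    also have "\<dots> \<le> 3 * real k" using h_le[of w] box_clamp_bound[of "real k" "G0 w"] by (simp add: G_def)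
    finally have 1: "cmod (h k w - G w) \<le> 3 * real k" .
    have 2: "cmod (h k w - G w) \<le> 2 * cmod (h k w - G0 w)"
      using box_clamp_lipschitz[of "real k" "h k w" "G0 w"] box_clamp_id[OF h_le[of w]] by (simp add: G_def)
    have "cmod (h k w - G w) powr q = cmod (h k w - G w) powr (q - 1) * cmod (h k w - G w)"
      by (cases "h k w = G w") (auto simp: powr_diff)
    also have "\<dots> \<le> C * (2 * cmod (h k w - G0 w))"
      unfolding C_def using 1 2 q by (intro mult_mono powr_mono2) auto
    finally show ?thesis .
  qed
  have int0: "integrable torus_measure (\<lambda>w. C * (2 * cmod (h k w - G0 w)))"
    using int_h lip_cylinder_integrable[OF G0(1)] by auto
  have int1: "integrable torus_measure (\<lambda>w. cmod (h k w - G w) powr q)"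
    by (rule Bochner_Integration.integrable_bound[OF int0])
       (use hG in \<open>auto intro!: AE_I2 order.trans[OF hG]\<close>)
  have int2: "integrable torus_measure (\<lambda>w. cmod (f w - h k w) powr q)"
    by (rule Bochner_Integration.integrable_bound[OF fq]) (use dom in \<open>auto intro!: AE_I2\<close>)
  have le: "cmod (f w - G w) powr q \<le> 2 powr q * (cmod (f w - h k w) powr q + cmod (h k w - G w) powr q)" for w
  proof -
    have "cmod (f w - G w) powr q \<le> (cmod (f w - h k w) + cmod (h k w - G w)) powr q"
      using q norm_triangle_ineq[of "f w - h k w" "h k w - G w"] by (intro powr_mono2) auto
    also have "\<dots> \<le> 2 powr q * (cmod (f w - h k w) powr q + cmod (h k w - G w) powr q)"
      using q by (intro powr_add_le) auto
    finally show ?thesis .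
  qed
  have int3: "integrable torus_measure (\<lambda>w. 2 powr q * (cmod (f w - h k w) powr q + cmod (h k w - G w) powr q))"
    using int1 int2 by auto
  have int4: "integrable torus_measure (\<lambda>w. cmod (f w - G w) powr q)"
    by (rule Bochner_Integration.integrable_bound[OF int3])
       (use le in \<open>auto intro!: AE_I2 order.trans[OF le]\<close>)
  have "(LINT w|torus_measure. cmod (h k w - G w) powr q) \<le> (LINT w|torus_measure. C * (2 * cmod (h k w - G0 w)))"
    by (rule integral_mono[OF int1 int0 hG])
  also have "\<dots> = 2 * C * (LINT w|torus_measure. cmod (h k w - G0 w))" by simp
  also have "\<dots> \<le> (2 * C + 1) * (LINT w|torus_measure. cmod (h k w - G0 w))"
    by (intro mult_right_mono) auto
  also have "\<dots> < \<delta>"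
  proof -
    have "0 < 2 * C + 1" by (simp add: C_def add_nonneg_pos)
    with G0(2) show ?thesis by (simp add: pos_less_divide_eq mult.commute)
  qed
  finally have hG_int: "(LINT w|torus_measure. cmod (h k w - G w) powr q) < \<delta>" .
  have "(LINT w|torus_measure. cmod (f w - G w) powr q)
      \<le> (LINT w|torus_measure. 2 powr q * (cmod (f w - h k w) powr q + cmod (h k w - G w) powr q))"
    by (rule integral_mono[OF int4 int3 le])
  also have "\<dots> = 2 powr q * ((LINT w|torus_measure. cmod (f w - h k w) powr q)
      + (LINT w|torus_measure. cmod (h k w - G w) powr q))"
    using int1 int2 by simp
  also have "\<dots> < 2 powr q * (\<delta> + \<delta>)" using k hG_int by (intro mult_strict_left_mono) auto
  also have "\<dots> = \<epsilon>" by (simp add: \<delta>_def)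
  finally show ?thesis using that[OF G int4] by blast
qed

section \<open>Radial convergence\<close>

lemma frechet_holomorphic_on_tendsto:
  assumes F: "frechet_holomorphic_on X N U F" and z: "z \<in> U"
    and h: "\<And>j. h j \<in> X" "\<And>j. (\<lambda>n. z n + h j n) \<in> U" and lim: "(\<lambda>j. N (h j)) \<longlonglongrightarrow> 0"
  shows "(\<lambda>j. F (\<lambda>n. z n + h j n)) \<longlonglongrightarrow> F z"
proof -
  from F z obtain A where A: "bounded_clinear_on X N A"
    "\<forall>e>0. \<exists>d>0. \<forall>h\<in>X. N h < d \<and> (\<lambda>n. z n + h n) \<in> U \<longrightarrow>
       cmod (F (\<lambda>n. z n + h n) - F z - A h) \<le> e * N h"
    unfolding frechet_holomorphic_on_def by blast
  obtain K where K: "\<And>x. x \<in> X \<Longrightarrow> cmod (A x) \<le> K * N x"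
    using A(1) unfolding bounded_clinear_on_def by blast
  \<comment> \<open>The remainder estimate at \<open>e = 1\<close> is enough: with the bound
    \<open>K\<close> on the derivative it gives a Lipschitz estimate at \<open>z\<close> with
    constant \<open>1 + K\<close>.\<close>
  obtain d where d: "0 < d" "\<And>h. h \<in> X \<Longrightarrow> N h < d \<Longrightarrow> (\<lambda>n. z n + h n) \<in> U \<Longrightarrow>
       cmod (F (\<lambda>n. z n + h n) - F z - A h) \<le> N h"
    using A(2)[rule_format, of 1] by auto
  have "(\<lambda>j. F (\<lambda>n. z n + h j n) - F z) \<longlonglongrightarrow> 0"
  proof (rule Lim_null_comparison)
    show "\<forall>\<^sub>F j in sequentially. cmod (F (\<lambda>n. z n + h j n) - F z) \<le> (1 + K) * N (h j)"
      using order_tendstoD(2)[OF lim d(1)]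
    proof eventually_elim
      case (elim j)
      have "cmod (F (\<lambda>n. z n + h j n) - F z)
          \<le> cmod (F (\<lambda>n. z n + h j n) - F z - A (h j)) + cmod (A (h j))"
        using norm_triangle_ineq[of "F (\<lambda>n. z n + h j n) - F z - A (h j)" "A (h j)"] by simp
      also have "\<dots> \<le> N (h j) + K * N (h j)"
        using d(2)[OF h(1) elim h(2)] K[OF h(1)] by (rule add_mono)
      finally show ?case by (simp add: algebra_simps)
    qed
    show "(\<lambda>j. (1 + K) * N (h j)) \<longlonglongrightarrow> 0" using tendsto_mult_right_zero[OF lim] .
  qed
  then show ?thesis by (simp add: LIM_zero_iff)
qed

text \<open>Covers two errors at once: the radii of the first \<open>j\<close> coordinates are
  slightly moved, and all later coordinates are cut off. The tail vanishes because \<open>r\<close>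
  lies in the space, in \<open>c0\<close> by its limit 0 and in \<open>ell2\<close> as the tail of a
  convergent series.\<close>

lemma seq_norm_truncation_tendsto:
  fixes r :: "nat \<Rightarrow> real" and h :: "nat \<Rightarrow> nat \<Rightarrow> complex"
  assumes r: "(\<lambda>n. complex_of_real (r n)) \<in> seq_space p"
    and head: "\<And>j n. n < j \<Longrightarrow> cmod (h j n) \<le> 1 / (real j + 1)"
    and tail: "\<And>j n. j \<le> n \<Longrightarrow> cmod (h j n) = \<bar>r n\<bar>"
  shows "h j \<in> seq_space p" "(\<lambda>j. seq_norm p (h j)) \<longlonglongrightarrow> 0"
proof -
  have inv: "(\<lambda>j. 1 / (real j + 1)) \<longlonglongrightarrow> 0"
    using LIMSEQ_inverse_real_of_nat by (simp add: inverse_eq_divide add.commute)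
  have "h j \<in> seq_space p \<and> (\<lambda>j. seq_norm p (h j)) \<longlonglongrightarrow> 0"
  proof (cases "p = \<infinity>")
    case True
    then have r0: "(\<lambda>n. \<bar>r n\<bar>) \<longlonglongrightarrow> 0"
      using r tendsto_norm_zero[of "\<lambda>n. complex_of_real (r n)" sequentially]
      by (simp add: seq_space_def c0_def)
    have "h j \<longlonglongrightarrow> 0"
    proof (rule Lim_null_comparison[OF _ r0])
      show "\<forall>\<^sub>F n in sequentially. cmod (h j n) \<le> \<bar>r n\<bar>"
        using eventually_ge_at_top[of j] by eventually_elim (simp add: tail)
    qed
    moreover have "(\<lambda>j. sup_norm (h j)) \<longlonglongrightarrow> 0"
    proof (rule LIMSEQ_I)
      fix \<epsilon> :: real assume \<epsilon>: "0 < \<epsilon>"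
      obtain n0 where n0: "\<And>n. n \<ge> n0 \<Longrightarrow> \<bar>r n\<bar> < \<epsilon> / 2"
        using order_tendstoD(2)[OF r0, of "\<epsilon> / 2"] \<epsilon> by (auto simp: eventually_sequentially)
      obtain j0 where j0: "\<And>j. j \<ge> j0 \<Longrightarrow> 1 / (real j + 1) < \<epsilon> / 2"
        using order_tendstoD(2)[OF inv, of "\<epsilon> / 2"] \<epsilon> by (auto simp: eventually_sequentially)
      have "norm (sup_norm (h j) - 0) < \<epsilon>" if j: "j \<ge> max n0 j0" for j
      proof -
        have le: "cmod (h j n) \<le> \<epsilon> / 2" for n
          using head[of n j] tail[of j n] n0[of n] j0[of j] j by (cases "n < j") auto
        have "sup_norm (h j) \<le> \<epsilon> / 2"
          unfolding sup_norm_def by (rule cSUP_least[OF _ le]) simp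
        moreover have "0 \<le> sup_norm (h j)"
          unfolding sup_norm_def using le
          by (intro cSUP_upper2[of _ _ 0]) (auto intro!: bdd_aboveI[of _ "\<epsilon> / 2"])
        ultimately show ?thesis using \<epsilon> by simp
      qed
      then show "\<exists>n0. \<forall>j\<ge>n0. norm (sup_norm (h j) - 0) < \<epsilon>" by blast
    qed
    ultimately show ?thesis using True by (simp add: seq_space_def seq_norm_def c0_def)
  next
    case False
    then have sr: "summable (\<lambda>n. (r n)\<^sup>2)" using r by (simp add: seq_space_def ell2_def)
    have tl: "(\<lambda>n. (cmod (h j (n + j)))\<^sup>2) = (\<lambda>n. (r (n + j))\<^sup>2)" for j
      by (simp add: tail)
    have sh: "summable (\<lambda>n. (cmod (h j n))\<^sup>2)" for j
      using summable_ignore_initial_segment[OF sr, of j]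
      by (subst summable_iff_shift[of _ j, symmetric]) (simp only: tl)
    have bound: "(suminf (\<lambda>n. (cmod (h j n))\<^sup>2)) \<le> 1 / (real j + 1) + ((suminf (\<lambda>n. (r n)\<^sup>2)) - (\<Sum>n<j. (r n)\<^sup>2))" for j
    proof -
      have "(suminf (\<lambda>n. (cmod (h j n))\<^sup>2)) = (suminf (\<lambda>n. (r (n + j))\<^sup>2)) + (\<Sum>n<j. (cmod (h j n))\<^sup>2)"
        using suminf_split_initial_segment[OF sh[of j], of j] by (simp only: tl)
      moreover have "(suminf (\<lambda>n. (r n)\<^sup>2)) = (suminf (\<lambda>n. (r (n + j))\<^sup>2)) + (\<Sum>n<j. (r n)\<^sup>2)"
        by (rule suminf_split_initial_segment[OF sr])
      moreover have "(\<Sum>n<j. (cmod (h j n))\<^sup>2) \<le> (\<Sum>n<j. (1 / (real j + 1))\<^sup>2)"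
        using head by (intro sum_mono power_mono) auto
      \<comment> \<open>There are \<open>j\<close> coordinates, each contributing a squared
        perturbation, and j / (j + 1)^2 \<le> 1 / (j + 1): the rate 1 / (j + 1) is small enough for
        \<open>ell2\<close> too.\<close>
      moreover have "(\<Sum>n<j. (1 / (real j + 1))\<^sup>2) \<le> 1 / (real j + 1)"
        by (simp add: power2_eq_square divide_simps)
      ultimately show ?thesis by linarith
    qed
    have "(\<lambda>j. 1 / (real j + 1) + ((suminf (\<lambda>n. (r n)\<^sup>2)) - (\<Sum>n<j. (r n)\<^sup>2))) \<longlonglongrightarrow> 0 + ((suminf (\<lambda>n. (r n)\<^sup>2)) - (suminf (\<lambda>n. (r n)\<^sup>2)))"
      by (intro tendsto_intros inv summable_LIMSEQ sr)
    then have bound_lim: "(\<lambda>j. 1 / (real j + 1) + (suminf (\<lambda>n. (r n)\<^sup>2) - (\<Sum>n<j. (r n)\<^sup>2))) \<longlonglongrightarrow> 0"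
      by simp
    have "(\<lambda>j. suminf (\<lambda>n. (cmod (h j n))\<^sup>2)) \<longlonglongrightarrow> 0"
    proof (rule tendsto_sandwich[OF _ _ tendsto_const bound_lim])
      show "\<forall>\<^sub>F j in sequentially. 0 \<le> suminf (\<lambda>n. (cmod (h j n))\<^sup>2)"
        using sh by (intro always_eventually allI suminf_nonneg) auto
      show "\<forall>\<^sub>F j in sequentially. suminf (\<lambda>n. (cmod (h j n))\<^sup>2)
          \<le> 1 / (real j + 1) + (suminf (\<lambda>n. (r n)\<^sup>2) - (\<Sum>n<j. (r n)\<^sup>2))"
        using bound by (intro always_eventually allI)
    qed
    then have "(\<lambda>j. sqrt (suminf (\<lambda>n. (cmod (h j n))\<^sup>2))) \<longlonglongrightarrow> sqrt 0" by (rule tendsto_real_sqrt)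
    then show ?thesis using False sh by (simp add: seq_space_def seq_norm_def ell2_def ell2_norm_def)
  qed
  then show "h j \<in> seq_space p" "(\<lambda>j. seq_norm p (h j)) \<longlonglongrightarrow> 0" by auto
qed

section \<open>Maximal estimates for products of Poisson kernels, uniform in the number of
  variables\<close>

lemma poisson_prod_cong:
  "(\<And>n. n < d \<Longrightarrow> \<rho> n = \<sigma> n) \<Longrightarrow> poisson_prod d \<rho> w v = poisson_prod d \<sigma> w v"
  by (simp add: poisson_prod_def)

text \<open>The semigroup law multiplies radii coordinatewise, so the one-step transition has as
  radii the ratios of consecutive square roots. Strict monotonicity keeps these ratios below 1, and
  positivity makes them meaningful.\<close>

lemma poisson_prod_maximal:
  fixes R :: "nat \<Rightarrow> nat \<Rightarrow> real" and g \<Psi> :: "(nat \<Rightarrow> complex) \<Rightarrow> real"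
  assumes R: "\<And>s n. s \<le> N \<Longrightarrow> 0 < R s n \<and> R s n < 1" "\<And>s n. s < N \<Longrightarrow> R s n < R (Suc s) n"
    and g: "integrable torus_measure g" "\<And>v. v \<in> space torus_measure \<Longrightarrow> 0 \<le> g v"
    and \<Psi>: "integrable torus_measure \<Psi>" "\<And>v y. v \<in> space torus_measure \<Longrightarrow> g v * y \<le> \<Psi> v + exp y"
  shows "integrable torus_measure (\<lambda>x. MAX s\<in>{..N}. kernel_op torus_measure (poisson_prod d (R s)) g x)"
    and "(LINT x|torus_measure. (MAX s\<in>{..N}. kernel_op torus_measure (poisson_prod d (R s)) g x))
           \<le> 2 * (LINT x|torus_measure. \<Psi> x) + 4"
proof -
  \<comment> \<open>The index is reversed: the radii \<open>R s\<close> increase with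
    \<open>s\<close>, whereas \<open>maximal_inequality\<close> starts from the kernel closest to
    the identity.\<close>
  define S where "S i = poisson_prod d (\<lambda>n. sqrt (R (N - i) n))" for i
  define Q where "Q i = poisson_prod d (\<lambda>n. sqrt (R (N - Suc i) n / R (N - i) n))" for i
  define T where "T i = poisson_prod d (R (N - i))" for i
  have S: "sym_markov torus_measure (S i)" for i
    unfolding S_def by (intro sym_markov_poisson_prod) (use R(1)[of "N - i"] in \<open>auto simp: less_imp_le\<close>)
  have T: "sym_markov torus_measure (T i)" for i
    unfolding T_def by (intro sym_markov_poisson_prod) (use R(1)[of "N - i"] in \<open>auto simp: less_imp_le\<close>)
  have Q_bounds: "0 \<le> sqrt (R (N - Suc i) n / R (N - i) n) \<and> sqrt (R (N - Suc i) n / R (N - i) n) < 1"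
    if "i < N" for i n
  proof -
    have "R (N - Suc i) n < R (N - i) n"
      using R(2)[of "N - Suc i" n] that by (simp add: Suc_diff_Suc)
    then show ?thesis using R(1)[of "N - i" n] R(1)[of "N - Suc i" n] by simp
  qed
  have Q: "sym_markov torus_measure (Q i)" if "i < N" for i
    unfolding Q_def by (intro sym_markov_poisson_prod Q_bounds that)
  have comp: "(LINT v|torus_measure. Q i x v * S i v u) = S (Suc i) x u"
    if "i < N" "x \<in> space torus_measure" "u \<in> space torus_measure" for i x u
  proof -
    have "(LINT v|torus_measure. Q i x v * S i v u)
       = poisson_prod d (\<lambda>n. sqrt (R (N - Suc i) n / R (N - i) n) * sqrt (R (N - i) n)) x u"
      unfolding Q_def S_def using R(1)[of "N - i"] that
      by (intro poisson_prod_comp Q_bounds) (auto simp: less_imp_le)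
    also have "\<dots> = S (Suc i) x u"
      unfolding S_def
    proof (rule poisson_prod_cong)
      fix n
      have "0 < R (N - i) n" using R(1)[of "N - i" n] by simp
      then show "sqrt (R (N - Suc i) n / R (N - i) n) * sqrt (R (N - i) n) = sqrt (R (N - Suc i) n)"
        by (simp flip: real_sqrt_mult)
    qed
    finally show ?thesis .
  qed
  have sqr: "(LINT v|torus_measure. S i x v * S i v u) = T i x u"
    if "x \<in> space torus_measure" "u \<in> space torus_measure" for i x u
  proof -
    have "(LINT v|torus_measure. S i x v * S i v u)
       = poisson_prod d (\<lambda>n. sqrt (R (N - i) n) * sqrt (R (N - i) n)) x u"
      unfolding S_def using R(1)[of "N - i"] that
      by (intro poisson_prod_comp) (auto simp: less_imp_le)
    also have "\<dots> = T i x u"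
      unfolding T_def by (rule poisson_prod_cong) (use R(1)[of "N - i"] in \<open>auto simp: less_imp_le\<close>)
    finally show ?thesis .
  qed
  have img: "(\<lambda>i. N - i) ` {..N} = {..N}"
  proof (intro equalityI subsetI)
    fix s assume "s \<in> {..N}"
    then show "s \<in> (\<lambda>i. N - i) ` {..N}" by (intro image_eqI[of _ _ "N - s"]) auto
  qed auto
  have "(MAX i\<in>{..N}. kernel_op torus_measure (T i) g x)
      = (MAX s\<in>{..N}. kernel_op torus_measure (poisson_prod d (R s)) g x)" for x
  proof -
    have "(\<lambda>i. kernel_op torus_measure (T i) g x) ` {..N}
      = (\<lambda>s. kernel_op torus_measure (poisson_prod d (R s)) g x) ` ((\<lambda>i. N - i) ` {..N})"
      by (simp only: image_image T_def)
    then show ?thesis by (simp only: img)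
  qed
  then show "integrable torus_measure (\<lambda>x. MAX s\<in>{..N}. kernel_op torus_measure (poisson_prod d (R s)) g x)"
    "(LINT x|torus_measure. (MAX s\<in>{..N}. kernel_op torus_measure (poisson_prod d (R s)) g x))
           \<le> 2 * (LINT x|torus_measure. \<Psi> x) + 4"
    using torus.maximal_inequality[where N = N and s = S and q = Q and t = T and g = g and \<Psi> = \<Psi>,
      OF S Q T comp sqr g \<Psi>] by simp_all
qed

text \<open>The tangent inequality 1 + t \<le> exp t at t = y - ln x yields the Legendre bound x y
  \<le> x ln x - x + exp y, and ln x \<le> x^(q-1) / (q - 1) replaces the logarithm by a power. The
  factor 1 / (q - 1) blows up as q tends to 1.\<close>

lemma powr_young_exp:
  fixes x y q :: real
  assumes "0 \<le> x" "1 < q"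
  shows "x * y \<le> x powr q / (q - 1) + exp y"
proof (cases "x = 0")
  case False
  with assms have x: "0 < x" by simp
  have "x * (1 + (y - ln x)) \<le> x * exp (y - ln x)"
    using x by (intro mult_left_mono exp_ge_add_one_self) auto
  also have "\<dots> = exp y" using x by (simp add: exp_diff)
  finally have 1: "x * y \<le> exp y + x * ln x - x" by (simp add: algebra_simps)
  have "(q - 1) * ln x = ln (x powr (q - 1))" using x by (simp add: ln_powr)
  also have "\<dots> \<le> x powr (q - 1)" using x ln_le_minus_one[of "x powr (q - 1)"] by simp
  finally have "ln x \<le> x powr (q - 1) / (q - 1)" using assms(2) by (simp add: le_divide_eq mult.commute)
  then have "x * ln x \<le> x * (x powr (q - 1) / (q - 1))" using x by (intro mult_left_mono) auto
  also have "\<dots> = x powr q / (q - 1)" using x by (simp add: powr_diff)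
  finally show ?thesis using 1 x by linarith
qed simp

text \<open>The maximal inequality is applied to \<open>\<kappa> * cmod h\<close> and divided by
  \<open>\<kappa>\<close>. The free parameter makes the additive constant 4 harmless: it appears as
  4 / \<kappa>. Positivity of the kernel passes from \<open>h\<close> to its modulus.\<close>

lemma poisson_prod_maximal_Lq:
  fixes R :: "nat \<Rightarrow> nat \<Rightarrow> real" and h :: "(nat \<Rightarrow> complex) \<Rightarrow> complex"
  assumes R: "\<And>s n. s \<le> N \<Longrightarrow> 0 < R s n \<and> R s n < 1" "\<And>s n. s < N \<Longrightarrow> R s n < R (Suc s) n"
    and h: "integrable torus_measure h" and hq: "integrable torus_measure (\<lambda>w. cmod (h w) powr q)"
    and q: "1 < q" and \<kappa>: "0 < \<kappa>"
  shows "(\<integral>\<^sup>+w. ennreal (MAX s\<in>{..N}. cmod (LINT v|torus_measure. of_real (poisson_prod d (R s) w v) * h v)) \<partial>torus_measure)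
     \<le> ennreal ((2 * (\<kappa> powr q / (q - 1)) * (LINT w|torus_measure. cmod (h w) powr q) + 4) / \<kappa>)"
proof -
  define g where "g w = \<kappa> * cmod (h w)" for w
  define \<Psi> where "\<Psi> w = g w powr q / (q - 1)" for w
  have \<Psi>_eq: "\<Psi> w = (\<kappa> powr q / (q - 1)) * cmod (h w) powr q" for w
    using \<kappa> by (simp add: \<Psi>_def g_def powr_mult)
  have g: "integrable torus_measure g" unfolding g_def[abs_def] using h by simp
  have g0: "0 \<le> g w" for w using \<kappa> by (simp add: g_def)
  have \<Psi>: "integrable torus_measure \<Psi>" unfolding \<Psi>_eq[abs_def] using hq by simp
  have young: "g v * y \<le> \<Psi> v + exp y" for v y
    unfolding \<Psi>_def by (rule powr_young_exp[OF g0 q])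
  define X where "X s = kernel_op torus_measure (poisson_prod d (R s)) g" for s
  note max = poisson_prod_maximal[where d = d and R = R and N = N and g = g and \<Psi> = \<Psi>, OF R g g0 \<Psi> young, folded X_def]
  have le: "cmod (LINT v|torus_measure. of_real (poisson_prod d (R s) w v) * h v) \<le> X s w / \<kappa>"
    if s: "s \<le> N" and w: "w \<in> space torus_measure" for s w
  proof -
    have "cmod (LINT v|torus_measure. of_real (poisson_prod d (R s) w v) * h v)
        \<le> (LINT v|torus_measure. cmod (of_real (poisson_prod d (R s) w v) * h v))"
      by (rule integral_norm_bound)
    also have "\<dots> = (LINT v|torus_measure. poisson_prod d (R s) w v * g v / \<kappa>)"
    proof (rule Bochner_Integration.integral_cong[OF refl])
      fix v assume v: "v \<in> space torus_measure"
      have "0 \<le> poisson_prod d (R s) w v"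
        using R(1)[OF s] by (intro poisson_prod_bounds(1) w v) (auto simp: less_imp_le)
      then show "cmod (of_real (poisson_prod d (R s) w v) * h v) = poisson_prod d (R s) w v * g v / \<kappa>"
        using \<kappa> by (simp add: norm_mult g_def)
    qed
    also have "\<dots> = X s w / \<kappa>" by (simp add: X_def kernel_op_def)
    finally show ?thesis .
  qed
  have X0: "0 \<le> (MAX s\<in>{..N}. X s w)" if w: "w \<in> space torus_measure" for w
  proof -
    have "0 \<le> X 0 w" unfolding X_def
      using R(1)[of 0] g0 by (intro torus.kernel_op_nonneg sym_markov_poisson_prod w) (auto simp: less_imp_le)
    also have "X 0 w \<le> (MAX s\<in>{..N}. X s w)" by (intro Max_ge) auto
    finally show ?thesis .
  qed
  have "(\<integral>\<^sup>+w. ennreal (MAX s\<in>{..N}. cmod (LINT v|torus_measure. of_real (poisson_prod d (R s) w v) * h v)) \<partial>torus_measure)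
     \<le> (\<integral>\<^sup>+w. ennreal ((MAX s\<in>{..N}. X s w) / \<kappa>) \<partial>torus_measure)"
  proof (intro nn_integral_mono ennreal_leI)
    fix w assume w: "w \<in> space torus_measure"
    show "(MAX s\<in>{..N}. cmod (LINT v|torus_measure. of_real (poisson_prod d (R s) w v) * h v)) \<le> (MAX s\<in>{..N}. X s w) / \<kappa>"
    proof (rule Max.boundedI)
      fix a assume "a \<in> (\<lambda>s. cmod (LINT v|torus_measure. of_real (poisson_prod d (R s) w v) * h v)) ` {..N}"
      then obtain s where s: "s \<le> N" and a: "a = cmod (LINT v|torus_measure. of_real (poisson_prod d (R s) w v) * h v)"
        by auto
      have "X s w \<le> (MAX s\<in>{..N}. X s w)" using s by (intro Max_ge) auto
      then show "a \<le> (MAX s\<in>{..N}. X s w) / \<kappa>"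
        using le[OF s w] \<kappa> unfolding a by (meson divide_right_mono less_imp_le order.trans)
    qed auto
  qed
  also have "\<dots> = ennreal (LINT w|torus_measure. (MAX s\<in>{..N}. X s w) / \<kappa>)"
    using max(1) X0 \<kappa> by (intro nn_integral_eq_integral) (auto intro!: AE_I2)
  also have "\<dots> \<le> ennreal ((2 * (\<kappa> powr q / (q - 1)) * (LINT w|torus_measure. cmod (h w) powr q) + 4) / \<kappa>)"
    using max(2) \<kappa> by (intro ennreal_leI) (simp add: \<Psi>_eq divide_right_mono)
  finally show ?thesis .
qed

section \<open>The extension as a limit of finite-dimensional Poisson integrals\<close>

lemma seq_space_norm_cong:
  assumes "\<And>n. cmod (x n) = cmod (y n)"
  shows "x \<in> seq_space p \<longleftrightarrow> y \<in> seq_space p"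
proof -
  have "x \<longlonglongrightarrow> 0 \<longleftrightarrow> y \<longlonglongrightarrow> 0"
    using tendsto_norm_zero_iff[of x sequentially] tendsto_norm_zero_iff[of y sequentially] by (simp add: assms)
  then show ?thesis by (simp add: seq_space_def c0_def ell2_def assms)
qed

lemma seq_space_finite_support:
  assumes "\<And>n. d \<le> n \<Longrightarrow> x n = 0"
  shows "x \<in> seq_space p"
proof -
  have "\<forall>\<^sub>F n in sequentially. x n = 0"
    using eventually_ge_at_top[of d] by eventually_elim (rule assms)
  then have "x \<longlonglongrightarrow> 0" by (rule tendsto_eventually)
  moreover have "summable (\<lambda>n. (cmod (x n))\<^sup>2)"
    by (rule summable_finite[of "{..<d}"]) (use assms in auto)
  ultimately show ?thesis by (simp add: seq_space_def c0_def ell2_def)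
qed

lemma polydisc_real_abs_less_1:
  "(\<lambda>n. complex_of_real (r n)) \<in> polydisc \<inter> X \<Longrightarrow> \<bar>r n\<bar> < 1"
  by (simp add: polydisc_def)

text \<open>The j-th integral is the value of \<open>F\<close> at a point with \<open>j\<close>
  nonzero coordinates at most, and these points converge to \<open>r w\<close> in the norm of the
  space. The radii may vary with \<open>j\<close> so that they can be perturbed to strictly monotone
  ones.\<close>

lemma canonical_extension_poisson_limit:
  fixes r :: "nat \<Rightarrow> real" and R :: "nat \<Rightarrow> nat \<Rightarrow> real"
  assumes f: "integrable torus_measure f"
    and analytic: "\<And>\<gamma>. \<not> (\<forall>n. 0 \<le> Poly_Mapping.lookup \<gamma> n) \<Longrightarrow> fourier_coeff f \<gamma> = 0"
    and ext: "canonical_extension p f F"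
    and r: "(\<lambda>n. complex_of_real (r n)) \<in> polydisc \<inter> seq_space p"
    and R: "\<And>j n. 0 \<le> R j n \<and> R j n < 1" "\<And>j n. \<bar>R j n - r n\<bar> \<le> 1 / (real j + 1)"
    and w: "w \<in> space torus_measure"
  shows "(\<lambda>j. LINT v|torus_measure. of_real (poisson_prod j (R j) w v) * f v)
            \<longlonglongrightarrow> F (\<lambda>n. of_real (r n) * w n)"
proof -
  define z where "z n = complex_of_real (r n) * w n" for n
  define h where "h j n = (if n < j then of_real (R j n - r n) * w n else - z n)" for j n
  have w1: "cmod (w n) = 1" for n using w by (simp add: space_torus_measure)
  have zh: "z n + h j n = (if n < j then of_real (R j n) * w n else 0)" for j n
    by (simp add: z_def h_def algebra_simps)
  have z: "z \<in> polydisc \<inter> seq_space p"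
  proof
    show "z \<in> polydisc" using r w1 by (simp add: polydisc_def z_def norm_mult)
    have "z \<in> seq_space p \<longleftrightarrow> (\<lambda>n. complex_of_real (r n)) \<in> seq_space p"
      by (rule seq_space_norm_cong) (simp add: z_def norm_mult w1)
    then show "z \<in> seq_space p" using r by simp
  qed
  have zh_in: "(\<lambda>n. z n + h j n) \<in> polydisc \<inter> seq_space p" for j
  proof
    show "(\<lambda>n. z n + h j n) \<in> polydisc"
      unfolding zh polydisc_def using R(1)[of j] w1 by (auto simp: norm_mult)
    show "(\<lambda>n. z n + h j n) \<in> seq_space p"
      unfolding zh by (rule seq_space_finite_support[of j]) simp
  qed
  have head: "cmod (h j n) \<le> 1 / (real j + 1)" if "n < j" for j n
    using that R(2)[of j n] w1[of n] by (simp add: h_def norm_mult del: of_real_diff)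
  have tail: "cmod (h j n) = \<bar>r n\<bar>" if "j \<le> n" for j n
    using that w1[of n] by (simp add: h_def z_def norm_mult)
  have rs: "(\<lambda>n. complex_of_real (r n)) \<in> seq_space p" using r by simp
  note h = seq_norm_truncation_tendsto[where h = h, OF rs head tail]
  have hol: "frechet_holomorphic_on (seq_space p) (seq_norm p) (polydisc \<inter> seq_space p) F"
    and coeffs: "has_monomial_coeffs F (fourier_coeff f)"
    using ext by (auto simp: canonical_extension_def)
  have "(\<lambda>j. F (\<lambda>n. z n + h j n)) \<longlonglongrightarrow> F z"
    by (rule frechet_holomorphic_on_tendsto[OF hol z h(1) zh_in h(2)])
  moreover have "F (\<lambda>n. z n + h j n) = (LINT v|torus_measure. of_real (poisson_prod j (R j) w v) * f v)" for j
    unfolding zh by (rule poisson_prod_representation[OF f analytic coeffs _ w]) (use R(1) in auto)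
  ultimately show ?thesis unfolding z_def[abs_def] by simp
qed

text \<open>Differentiability in the norm of the sequence space says nothing direct about the
  product sigma-algebra; measurability comes from being a pointwise limit of kernel
  integrals.\<close>

lemma radial_values_measurable:
  assumes f: "integrable torus_measure f"
    and analytic: "\<And>\<gamma>. \<not> (\<forall>n. 0 \<le> Poly_Mapping.lookup \<gamma> n) \<Longrightarrow> fourier_coeff f \<gamma> = 0"
    and ext: "canonical_extension p f F"
    and r: "(\<lambda>n. complex_of_real (r n)) \<in> polydisc \<inter> seq_space p" and r0: "\<And>n. 0 \<le> r n"
  shows "(\<lambda>w. F (\<lambda>n. of_real (r n) * w n)) \<in> borel_measurable torus_measure"
proof (rule borel_measurable_LIMSEQ_metric)
  show "(\<lambda>w. LINT v|torus_measure. of_real (poisson_prod j r w v) * f v) \<in> borel_measurable torus_measure" for j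
    using f by measurable
  have "r n < 1" for n
    using polydisc_real_abs_less_1[OF r, of n] by simp
  then show "(\<lambda>j. LINT v|torus_measure. of_real (poisson_prod j r w v) * f v) \<longlonglongrightarrow> F (\<lambda>n. of_real (r n) * w n)"
    if "w \<in> space torus_measure" for w
    using canonical_extension_poisson_limit[where R = "\<lambda>_. r", OF f analytic ext r _ _ that] r0 by simp
qed

text \<open>Subtracting the uniform radial error of \<open>G\<close> leaves the Poisson integrals of
  \<open>f - G\<close>, to which the maximal estimate applies. Its right side involves neither the
  number \<open>j\<close> of variables nor \<open>N\<close>: the first permits Fatou's lemma in
  \<open>j\<close>, the second a later supremum over \<open>N\<close>.\<close>

lemma hardy_maximal_bound:
  fixes r :: "nat \<Rightarrow> nat \<Rightarrow> real" and f F G :: "(nat \<Rightarrow> complex) \<Rightarrow> complex"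
  assumes f: "integrable torus_measure f"
    and analytic: "\<And>\<gamma>. \<not> (\<forall>n. 0 \<le> Poly_Mapping.lookup \<gamma> n) \<Longrightarrow> fourier_coeff f \<gamma> = 0"
    and ext: "canonical_extension p f F"
    and r: "\<And>s. (\<lambda>n. complex_of_real (r s n)) \<in> polydisc \<inter> seq_space p"
    and r0: "\<And>s n. 0 \<le> r s n" and mono: "\<And>s n. r s n \<le> r (Suc s) n"
    and G: "lip_cylinder G" "0 \<le> L"
      "\<And>w v. w \<in> space torus_measure \<Longrightarrow> v \<in> space torus_measure \<Longrightarrow>
         cmod (G v - G w) \<le> L * (\<Sum>n<e. cmod (w n - v n))"
    and q: "1 < q" "integrable torus_measure (\<lambda>w. cmod (f w - G w) powr q)" and \<kappa>: "0 < \<kappa>"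
  shows "(\<integral>\<^sup>+w. ennreal (MAX s\<in>{..N}. cmod (F (\<lambda>n. of_real (r s n) * w n) - G w)
              - L * (\<Sum>n<e. sqrt (2 - 2 * r s n))) \<partial>torus_measure)
     \<le> ennreal ((2 * (\<kappa> powr q / (q - 1)) * (LINT w|torus_measure. cmod (f w - G w) powr q) + 4) / \<kappa>)"
    (is "_ \<le> ennreal ?bound")
proof -
  define \<epsilon> where "\<epsilon> j = 1 / (real j + 1)" for j
  txt \<open>The perturbation makes the radii strictly increasing and positive, so that the one-step
    ratios stay below 1 and every transition has a bounded density.\<close>
  define R where "R j s n = (1 - \<epsilon> j) * r s n + \<epsilon> j * (real (s + 1) / real (N + 2))" for j s n
  define \<eta> where "\<eta> s = L * (\<Sum>n<e. sqrt (2 - 2 * r s n))" for s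
  define \<eta>' where "\<eta>' j s = L * (\<Sum>n<e. sqrt (2 - 2 * R j s n))" for j s
  define h where "h w = f w - G w" for w
  define X where "X j s w = cmod (LINT v|torus_measure. of_real (poisson_prod j (R j s) w v) * h v)" for j s w
  have r1: "r s n < 1" for s n using polydisc_real_abs_less_1[OF r, of s n] by simp
  have \<epsilon>: "0 < \<epsilon> j" "\<epsilon> j \<le> 1" for j by (auto simp: \<epsilon>_def)
  have frac: "0 < real (s + 1) / real (N + 2)" "real (s + 1) / real (N + 2) < 1" if "s \<le> N" for s
    using that by auto
  have R01: "0 < R j s n \<and> R j s n < 1" if "s \<le> N" for j s n
  proof
    have "0 < \<epsilon> j * (real (s + 1) / real (N + 2))" using \<epsilon>(1)[of j] frac(1)[OF that] by (rule mult_pos_pos)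
    moreover have "0 \<le> (1 - \<epsilon> j) * r s n" using \<epsilon>(2)[of j] r0[of s n] by simp
    ultimately show "0 < R j s n" by (simp add: R_def)
    have "\<epsilon> j * (real (s + 1) / real (N + 2)) < \<epsilon> j * 1" using \<epsilon>(1)[of j] frac(2)[OF that] by (rule mult_strict_left_mono[rotated])
    moreover have "(1 - \<epsilon> j) * r s n \<le> (1 - \<epsilon> j) * 1"
      using \<epsilon>(2)[of j] r1[of s n] by (intro mult_left_mono) auto
    ultimately show "R j s n < 1" by (simp add: R_def)
  qed
  have R_mono: "R j s n < R j (Suc s) n" if "s < N" for j s n
  proof -
    have "\<epsilon> j * (real (s + 1) / real (N + 2)) < \<epsilon> j * (real (Suc s + 1) / real (N + 2))"
      using \<epsilon>(1)[of j] by (intro mult_strict_left_mono divide_strict_right_mono) auto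
    moreover have "(1 - \<epsilon> j) * r s n \<le> (1 - \<epsilon> j) * r (Suc s) n"
      using \<epsilon>(2)[of j] mono[of s n] by (intro mult_left_mono) auto
    ultimately show ?thesis by (simp add: R_def)
  qed
  have R_close: "\<bar>R j s n - r s n\<bar> \<le> 1 / (real j + 1)" if "s \<le> N" for j s n
  proof -
    have "R j s n - r s n = \<epsilon> j * (real (s + 1) / real (N + 2) - r s n)"
      by (simp add: R_def algebra_simps)
    also have "\<bar>\<dots>\<bar> \<le> \<epsilon> j * 1"
    proof -
      have "\<bar>real (s + 1) / real (N + 2) - r s n\<bar> \<le> 1"
        using frac[OF that] r0[of s n] r1[of s n] by linarith
      then show ?thesis unfolding abs_mult using \<epsilon>(1)[of j] by (intro mult_mono) auto
    qed
    finally show ?thesis by (simp add: \<epsilon>_def)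
  qed
  have G_int: "integrable torus_measure G" by (rule lip_cylinder_integrable[OF G(1)])
  have h_int: "integrable torus_measure h" unfolding h_def[abs_def] using f G_int by simp
  note [measurable] = borel_measurable_integrable[OF h_int]
  have X_meas [measurable]: "X j s \<in> borel_measurable torus_measure" for j s
    unfolding X_def[abs_def] by measurable
  have X_bound: "(\<integral>\<^sup>+w. ennreal (MAX s\<in>{..N}. X j s w) \<partial>torus_measure) \<le> ennreal ?bound" for j
    using poisson_prod_maximal_Lq[where R = "R j" and N = N and d = j and h = h, OF R01 R_mono h_int _ q(1) \<kappa>] q(2)
    by (simp add: X_def h_def)
  have ptw: "ennreal (MAX s\<in>{..N}. cmod (F (\<lambda>n. of_real (r s n) * w n) - G w) - \<eta> s)
      \<le> liminf (\<lambda>j. ennreal (MAX s\<in>{..N}. X j s w))" if w: "w \<in> space torus_measure" for w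
  proof -
    \<comment> \<open>For the given \<open>w\<close> an index \<open>s\<close> attaining the maximum
      is fixed, so convergence in \<open>j\<close> is needed along this \<open>s\<close>
      alone.\<close>
    have "(MAX s\<in>{..N}. cmod (F (\<lambda>n. of_real (r s n) * w n) - G w) - \<eta> s)
        \<in> (\<lambda>s. cmod (F (\<lambda>n. of_real (r s n) * w n) - G w) - \<eta> s) ` {..N}"
      by (rule Max_in) auto
    then obtain s where "s \<in> {..N}" and max: "(MAX s\<in>{..N}. cmod (F (\<lambda>n. of_real (r s n) * w n) - G w) - \<eta> s)
        = cmod (F (\<lambda>n. of_real (r s n) * w n) - G w) - \<eta> s" by (rule imageE)
    then have s: "s \<le> N" by simp
    define T where "T j = (LINT v|torus_measure. of_real (poisson_prod j (R j s) w v) * f v)" for j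
    have R01s: "\<And>j n. 0 \<le> R j s n \<and> R j s n < 1" using R01[OF s] by (simp add: less_imp_le)
    have "T \<longlonglongrightarrow> F (\<lambda>n. of_real (r s n) * w n)"
      unfolding T_def[abs_def]
      by (rule canonical_extension_poisson_limit[where R = "\<lambda>j. R j s", OF f analytic ext r R01s R_close[OF s] w])
    moreover have "(\<lambda>j. R j s n) \<longlonglongrightarrow> r s n" for n
    proof -
      have "(\<lambda>j. R j s n - r s n) \<longlonglongrightarrow> 0"
      proof (rule Lim_null_comparison)
        show "\<forall>\<^sub>F j in sequentially. norm (R j s n - r s n) \<le> 1 / (real j + 1)"
          using R_close[OF s] by simp
        show "(\<lambda>j. 1 / (real j + 1)) \<longlonglongrightarrow> 0"
          using LIMSEQ_inverse_real_of_nat by (simp add: inverse_eq_divide add.commute)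
      qed
      then show ?thesis by (simp add: LIM_zero_iff)
    qed
    ultimately have "(\<lambda>j. cmod (T j - G w) - \<eta>' j s) \<longlonglongrightarrow> cmod (F (\<lambda>n. of_real (r s n) * w n) - G w) - \<eta> s"
      unfolding \<eta>'_def \<eta>_def by (intro tendsto_intros)
    then have "(\<lambda>j. ennreal (cmod (T j - G w) - \<eta>' j s))
        \<longlonglongrightarrow> ennreal (cmod (F (\<lambda>n. of_real (r s n) * w n) - G w) - \<eta> s)"
      by (rule tendsto_ennrealI)
    then have "ennreal (cmod (F (\<lambda>n. of_real (r s n) * w n) - G w) - \<eta> s)
        = liminf (\<lambda>j. ennreal (cmod (T j - G w) - \<eta>' j s))"
      by (simp add: lim_imp_Liminf)
    also have "\<dots> \<le> liminf (\<lambda>j. ennreal (MAX s\<in>{..N}. X j s w))"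
    proof (rule Liminf_mono)
      show "\<forall>\<^sub>F j in sequentially. ennreal (cmod (T j - G w) - \<eta>' j s) \<le> ennreal (MAX s\<in>{..N}. X j s w)"
        \<comment> \<open>From \<open>j = e\<close> on, the kernel acts on all the variables on
          which \<open>G\<close> depends.\<close>
        using eventually_ge_at_top[of e]
      proof eventually_elim
        case (elim j)
        have b: "\<And>n. n < j \<Longrightarrow> 0 \<le> R j s n \<and> R j s n < 1" using R01s by simp
        define S where "S = (LINT v|torus_measure. of_real (poisson_prod j (R j s) w v) * G v)"
        have "(LINT v|torus_measure. of_real (poisson_prod j (R j s) w v) * h v) = T j - S"
          unfolding h_def T_def S_def right_diff_distrib
          by (intro Bochner_Integration.integral_diff poisson_prod_complex_integrable b w f G_int)
        then have "cmod (T j - G w) \<le> X j s w + cmod (S - G w)"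
          using norm_triangle_ineq[of "T j - S" "S - G w"] by (simp add: X_def)
        moreover have "cmod (S - G w) \<le> \<eta>' j s"
          unfolding S_def \<eta>'_def
          by (rule poisson_prod_lipschitz_bound[OF b w elim G_int _ G(2)]) (use G(3)[OF w] in auto)
        moreover have "X j s w \<le> (MAX s\<in>{..N}. X j s w)" using s by (intro Max_ge) auto
        ultimately show ?case by (intro ennreal_leI) linarith
      qed
    qed
    finally show ?thesis by (simp only: max)
  qed
  have "(\<integral>\<^sup>+w. ennreal (MAX s\<in>{..N}. cmod (F (\<lambda>n. of_real (r s n) * w n) - G w) - \<eta> s) \<partial>torus_measure)
      \<le> (\<integral>\<^sup>+w. liminf (\<lambda>j. ennreal (MAX s\<in>{..N}. X j s w)) \<partial>torus_measure)"
    by (intro nn_integral_mono ptw)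
  also have "\<dots> \<le> liminf (\<lambda>j. \<integral>\<^sup>+w. ennreal (MAX s\<in>{..N}. X j s w) \<partial>torus_measure)"
    by (rule nn_integral_liminf) measurable
  also have "\<dots> \<le> liminf (\<lambda>j::nat. ennreal ?bound)"
    by (intro Liminf_mono always_eventually allI X_bound)
  also have "\<dots> = ennreal ?bound" by (simp add: Liminf_const)
  finally show ?thesis by (simp add: \<eta>_def)
qed

text \<open>A Banach principle: the integral of the limsup of \<bar>F(r w) - f(w)\<bar> is bounded
  by the maximal estimate for \<open>f - G\<close> plus the L^1 distance of \<open>f\<close> to
  \<open>G\<close>, and both are made small through \<open>G\<close>. The exponent \<open>q\<close>
  measures \<open>f\<close>, while \<open>p\<close> merely selects the sequence space, so the two
  may differ.\<close>

theorem hardy_radial_convergence: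
  fixes r :: "nat \<Rightarrow> nat \<Rightarrow> real" and f F :: "(nat \<Rightarrow> complex) \<Rightarrow> complex"
  assumes f_meas [measurable]: "f \<in> borel_measurable torus_measure"
    and q: "1 < q" and fq: "integrable torus_measure (\<lambda>w. cmod (f w) powr q)"
    and analytic: "\<And>\<gamma>. \<not> (\<forall>n. 0 \<le> Poly_Mapping.lookup \<gamma> n) \<Longrightarrow> fourier_coeff f \<gamma> = 0"
    and ext: "canonical_extension p f F"
    and r: "\<And>s. (\<lambda>n. complex_of_real (r s n)) \<in> polydisc \<inter> seq_space p"
    and r0: "\<And>s n. 0 \<le> r s n" and mono: "\<And>s n. r s n \<le> r (Suc s) n"
    and r_lim: "\<And>n. (\<lambda>s. r s n) \<longlonglongrightarrow> 1"
  shows "AE w in torus_measure. (\<lambda>s. F (\<lambda>n. complex_of_real (r s n) * w n)) \<longlonglongrightarrow> f w"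
proof -
  \<comment> \<open>Young's inequality at y = 1 dominates the modulus of \<open>f\<close> by its
    q-th power plus a constant.\<close>
  have f: "integrable torus_measure f"
  proof (rule Bochner_Integration.integrable_bound)
    show "integrable torus_measure (\<lambda>w. cmod (f w) powr q / (q - 1) + exp 1)" using fq by simp
    show "AE w in torus_measure. norm (f w) \<le> norm (cmod (f w) powr q / (q - 1) + exp 1)"
      using powr_young_exp[OF norm_ge_zero q, of "f _" 1] by (intro AE_I2) (simp add: abs_le_iff order.trans[OF _ abs_ge_self])
  qed simp
  define \<Phi> where "\<Phi> s w = F (\<lambda>n. complex_of_real (r s n) * w n)" for s w
  have [measurable]: "\<Phi> s \<in> borel_measurable torus_measure" for s
    unfolding \<Phi>_def[abs_def] by (rule radial_values_measurable[OF f analytic ext r r0])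
  define D where "D w = limsup (\<lambda>s. ennreal (cmod (\<Phi> s w - f w)))" for w
  have [measurable]: "D \<in> borel_measurable torus_measure" unfolding D_def[abs_def] by measurable
  have small: "(\<integral>\<^sup>+w. D w \<partial>torus_measure) \<le> ennreal \<epsilon>" if \<epsilon>: "0 < \<epsilon>" for \<epsilon>
  proof -
    \<comment> \<open>Chosen so that 8 / \<kappa> = \<epsilon> / 2. The factor \<open>A\<close>
      depends on \<open>\<kappa>\<close>, so the closeness 4 / A demanded of \<open>G\<close> is
      fixed only afterwards; it makes A I + 4 less than 8.\<close>
    define \<kappa> where "\<kappa> = 16 / \<epsilon>"
    have \<kappa>: "0 < \<kappa>" using \<epsilon> by (simp add: \<kappa>_def)
    define A where "A = 2 * (\<kappa> powr q / (q - 1))"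
    have A: "0 < A" using \<kappa> q by (simp add: A_def)
    obtain G :: "(nat \<Rightarrow> complex) \<Rightarrow> complex" where G: "lip_cylinder G"
      and Gq: "integrable torus_measure (\<lambda>w. cmod (f w - G w) powr q)"
      and G_close: "(LINT w|torus_measure. cmod (f w - G w) powr q) < 4 / A"
      using lip_cylinder_Lq_dense[OF f_meas fq, of "4 / A"] q A by auto
    obtain e L where L: "0 \<le> L" "\<And>w v. w \<in> space torus_measure \<Longrightarrow> v \<in> space torus_measure \<Longrightarrow>
       norm (G v - G w) \<le> L * (\<Sum>n<e. cmod (w n - v n))"
      using G unfolding lip_cylinder_def by blast
    note [measurable] = lip_cylinder_measurable[OF G]
    define I where "I = (LINT w|torus_measure. cmod (f w - G w) powr q)"
    have bound: "(A * I + 4) / \<kappa> \<le> \<epsilon> / 2"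
    proof -
      have "A * I < 4" using G_close A by (simp add: I_def pos_less_divide_eq mult.commute)
      then have "(A * I + 4) / \<kappa> \<le> 8 / \<kappa>" using \<kappa> by (intro divide_right_mono) auto
      also have "\<dots> = \<epsilon> / 2" using \<epsilon> by (simp add: \<kappa>_def)
      finally show ?thesis .
    qed
    define \<eta> where "\<eta> s = L * (\<Sum>n<e. sqrt (2 - 2 * r s n))" for s
    \<comment> \<open>\<open>ennreal\<close> sends negative values to 0, so \<open>Y\<close> keeps
      the positive part of the excess over the error of \<open>G\<close>. It increases with
      \<open>N\<close>, and monotone convergence transfers the bound to the supremum over all
      radii.\<close>
    define Y where "Y N w = ennreal (MAX s\<in>{..N}. cmod (\<Phi> s w - G w) - \<eta> s)" for N w
    have [measurable]: "Y N \<in> borel_measurable torus_measure" for N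
      unfolding Y_def[abs_def] by measurable
    have "incseq Y"
      by (intro incseq_SucI le_funI) (auto simp: Y_def intro!: ennreal_leI Max_mono)
    then have "(\<integral>\<^sup>+w. (SUP N. Y N w) \<partial>torus_measure) = (SUP N. \<integral>\<^sup>+w. Y N w \<partial>torus_measure)"
      by (rule nn_integral_monotone_convergence_SUP) measurable
    also have "\<dots> \<le> ennreal ((A * I + 4) / \<kappa>)"
      unfolding Y_def \<Phi>_def \<eta>_def A_def I_def
      by (intro SUP_least hardy_maximal_bound[where r = r, OF f analytic ext r r0 mono G L q Gq \<kappa>])
    finally have Y_int: "(\<integral>\<^sup>+w. (SUP N. Y N w) \<partial>torus_measure) \<le> ennreal (\<epsilon> / 2)"
      using bound by (meson ennreal_leI order.trans)
    \<comment> \<open>The same use of Young's inequality at y = 1, rescaled by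
      \<open>\<kappa>\<close>; since exp 1 \<le> 4, the estimate \<open>bound\<close> serves here
      again.\<close>
    have G_int: "(\<integral>\<^sup>+w. ennreal (cmod (f w - G w)) \<partial>torus_measure) \<le> ennreal (\<epsilon> / 2)"
    proof -
      have le: "cmod (f w - G w) \<le> (\<kappa> powr q / (q - 1) * cmod (f w - G w) powr q + exp 1) / \<kappa>" for w
        using powr_young_exp[of "\<kappa> * cmod (f w - G w)" q 1] \<kappa> q
        by (simp add: pos_le_divide_eq powr_mult mult.commute)
      have fG: "integrable torus_measure (\<lambda>w. cmod (f w - G w))"
        using f lip_cylinder_integrable[OF G] by simp
      have "(\<integral>\<^sup>+w. ennreal (cmod (f w - G w)) \<partial>torus_measure) = ennreal (LINT w|torus_measure. cmod (f w - G w))"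
        using fG by (intro nn_integral_eq_integral) auto
      also have "(LINT w|torus_measure. cmod (f w - G w))
          \<le> (LINT w|torus_measure. (\<kappa> powr q / (q - 1) * cmod (f w - G w) powr q + exp 1) / \<kappa>)"
        using Gq fG le by (intro integral_mono) auto
      also have "\<dots> = (\<kappa> powr q / (q - 1) * I + exp 1) / \<kappa>"
        using Gq by (simp add: I_def torus.prob_space)
      also have "\<dots> = (A / 2 * I + exp 1) / \<kappa>"
      proof -
        have "A / 2 = \<kappa> powr q / (q - 1)"
          unfolding A_def by (rule nonzero_mult_div_cancel_left) simp
        then show ?thesis by (simp only:)
      qed
      also have "\<dots> \<le> (A * I + 4) / \<kappa>"
      proof -
        have "0 \<le> I" by (simp add: I_def)
        then have "A / 2 * I \<le> A * I" using A by (intro mult_right_mono) auto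
        moreover have "exp (1::real) \<le> 4" using exp_le by linarith
        ultimately show ?thesis using \<kappa> by (intro divide_right_mono) auto
      qed
      finally show ?thesis using bound by (meson ennreal_leI order.trans)
    qed
    have "D w \<le> (SUP N. Y N w) + ennreal (cmod (f w - G w))" for w
    proof -
      define C where "C = (SUP N. Y N w) + ennreal (cmod (f w - G w))"
      have \<eta>0: "0 \<le> \<eta> s" for s
        unfolding \<eta>_def using L(1) polydisc_real_abs_less_1[OF r, of s]
        by (intro mult_nonneg_nonneg sum_nonneg) (auto simp: abs_less_iff less_imp_le)
      have "(\<lambda>s. \<eta> s) \<longlonglongrightarrow> L * (\<Sum>n<e. sqrt (2 - 2 * 1))"
        unfolding \<eta>_def by (intro tendsto_intros r_lim)
      then have "(\<lambda>s. C + ennreal (\<eta> s)) \<longlonglongrightarrow> C + ennreal 0"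
        by (intro tendsto_add tendsto_const tendsto_ennrealI) auto
      then have "limsup (\<lambda>s. C + ennreal (\<eta> s)) = C" by (simp add: lim_imp_Limsup)
      moreover have "D w \<le> limsup (\<lambda>s. C + ennreal (\<eta> s))"
        unfolding D_def
      proof (intro Limsup_mono always_eventually allI)
        fix s
        have "cmod (\<Phi> s w - G w) - \<eta> s \<le> (MAX s\<in>{..s}. cmod (\<Phi> s w - G w) - \<eta> s)"
          by (intro Max_ge) auto
        then have "ennreal (cmod (\<Phi> s w - G w) - \<eta> s) \<le> Y s w"
          unfolding Y_def by (rule ennreal_leI)
        also have "\<dots> \<le> (SUP N. Y N w)" by (rule SUP_upper) simp
        finally have 1: "ennreal (cmod (\<Phi> s w - G w) - \<eta> s) \<le> (SUP N. Y N w)" .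
        \<comment> \<open>The \<open>max 0\<close> makes all summands nonnegative, so that
          \<open>ennreal\<close> splits over the sum, and it agrees with the truncation in
          \<open>Y\<close>.\<close>
        have "cmod (\<Phi> s w - f w) \<le> max 0 (cmod (\<Phi> s w - G w) - \<eta> s) + cmod (f w - G w) + \<eta> s"
          using norm_triangle_ineq4[of "\<Phi> s w - G w" "f w - G w"] by simp
        then have "ennreal (cmod (\<Phi> s w - f w))
            \<le> ennreal (max 0 (cmod (\<Phi> s w - G w) - \<eta> s) + cmod (f w - G w) + \<eta> s)"
          by (rule ennreal_leI)
        also have "\<dots> = ennreal (cmod (\<Phi> s w - G w) - \<eta> s) + ennreal (cmod (f w - G w)) + ennreal (\<eta> s)"
          using \<eta>0[of s] by (simp add: ennreal_plus[symmetric] max_def ennreal_neg del: ennreal_plus)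
        also have "\<dots> \<le> C + ennreal (\<eta> s)"
          unfolding C_def using 1 by (intro add_mono) auto
        finally show "ennreal (cmod (\<Phi> s w - f w)) \<le> C + ennreal (\<eta> s)" .
      qed
      ultimately show ?thesis by (simp add: C_def)
    qed
    then have "(\<integral>\<^sup>+w. D w \<partial>torus_measure)
        \<le> (\<integral>\<^sup>+w. (SUP N. Y N w) + ennreal (cmod (f w - G w)) \<partial>torus_measure)"
      by (intro nn_integral_mono)
    also have "\<dots> = (\<integral>\<^sup>+w. (SUP N. Y N w) \<partial>torus_measure) + (\<integral>\<^sup>+w. ennreal (cmod (f w - G w)) \<partial>torus_measure)"
      by (rule nn_integral_add) measurable
    also have "\<dots> \<le> ennreal (\<epsilon> / 2) + ennreal (\<epsilon> / 2)" by (rule add_mono[OF Y_int G_int])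
    also have "\<dots> = ennreal \<epsilon>" using \<epsilon> by (simp flip: ennreal_plus)
    finally show ?thesis .
  qed
  have "(\<integral>\<^sup>+w. D w \<partial>torus_measure) \<le> 0"
    by (rule ennreal_le_epsilon) (use small in simp)
  then have "AE w in torus_measure. D w = 0" by (simp add: nn_integral_0_iff_AE)
  then show ?thesis
  proof eventually_elim
    case (elim w)
    have "(\<lambda>s. ennreal (cmod (\<Phi> s w - f w))) \<longlonglongrightarrow> 0"
    proof (rule Liminf_eq_Limsup)
      show "limsup (\<lambda>s. ennreal (cmod (\<Phi> s w - f w))) = 0" using elim by (simp add: D_def)
      then show "liminf (\<lambda>s. ennreal (cmod (\<Phi> s w - f w))) = 0"
        using Liminf_le_Limsup[of sequentially "\<lambda>s. ennreal (cmod (\<Phi> s w - f w))"] by simp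
    qed simp
    then have "(\<lambda>s. cmod (\<Phi> s w - f w)) \<longlonglongrightarrow> 0"
      using tendsto_ennreal_iff[of "\<lambda>s. cmod (\<Phi> s w - f w)" sequentially 0] by simp
    then have "(\<lambda>s. \<Phi> s w - f w) \<longlonglongrightarrow> 0" by (rule tendsto_norm_zero_cancel)
    then show ?case by (simp add: \<Phi>_def LIM_zero_iff)
  qed
qed

theorem corollary3p8:
  fixes p :: ennreal
    and f F :: "(nat \<Rightarrow> complex) \<Rightarrow> complex"
    and r :: "nat \<Rightarrow> nat \<Rightarrow> real"
  assumes "1 < p"
    and "f \<in> Hardy p"
    and "canonical_extension p f F"
    and "\<And>s. (\<lambda>n. complex_of_real (r s n)) \<in> polydisc \<inter> seq_space p"
    and "\<And>n. 0 \<le> r 0 n"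
    and "\<And>n. incseq (\<lambda>s. r s n)"
    and "\<And>n. (\<lambda>s. r s n) \<longlonglongrightarrow> 1"
  shows "AE w in torus_measure.
           (\<lambda>s. F (\<lambda>n. complex_of_real (r s n) * w n)) \<longlonglongrightarrow> f w"
proof -
  have Lp: "f \<in> Lp torus_measure p" and [measurable]: "f \<in> borel_measurable torus_measure"
    using assms(2) by (auto simp: Hardy_def Lp_def)
  \<comment> \<open>For \<open>p = \<infinity>\<close> a bounded function on a probability space is
    square integrable, so \<open>q = 2\<close> will do; otherwise \<open>q\<close> is
    \<open>p\<close> itself. The extension keeps its own \<open>p\<close>, and with it the space
    \<open>c0\<close> or \<open>ell2\<close>.\<close>
  obtain q :: real where q: "1 < q" "integrable torus_measure (\<lambda>w. cmod (f w) powr q)"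
  proof (cases "p = \<infinity>")
    case True
    then obtain C where C: "AE w in torus_measure. cmod (f w) \<le> C" using Lp by (auto simp: Lp_def)
    have "integrable torus_measure (\<lambda>w. cmod (f w) powr 2)"
    proof (rule torus.integrable_const_bound)
      show "AE w in torus_measure. norm (cmod (f w) powr 2) \<le> C\<^sup>2"
        using C by eventually_elim (auto intro: power_mono)
    qed simp
    then show ?thesis using that[of 2] by simp
  next
    case False
    then obtain x where "p = ennreal x" "0 \<le> x" by (cases p) auto
    then have "1 < enn2real p" using assms(1) by simp
    moreover have "integrable torus_measure (\<lambda>w. cmod (f w) powr enn2real p)"
      using Lp False by (simp add: Lp_def)
    ultimately show ?thesis by (rule that)
  qed
  have r0: "0 \<le> r s n" for s n
    using assms(5)[of n] incseqD[OF assms(6), of 0 s n] by simp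
  show ?thesis
  proof (rule hardy_radial_convergence[OF _ q _ assms(3,4) r0 _ assms(7)])
    show "fourier_coeff f \<gamma> = 0" if "\<not> (\<forall>n. 0 \<le> Poly_Mapping.lookup \<gamma> n)" for \<gamma>
      using assms(2) that by (simp add: Hardy_def)
    show "r s n \<le> r (Suc s) n" for s n by (rule incseq_SucD[OF assms(6)])
  qed simp
qed

end
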